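(* Let $(X_\sigma,f_\sigma)_{\sigma\in A}$ be a combinatorial Seshadri stratification on $X_P\subseteq\mathbb P(V)$ such that $\deg f_\sigma=1$ for all $\sigma\in A$ (so that the points $-\mu_\sigma$, i.e. the vertices of the associated triangulation, are lattice points). Let $\theta,\bar\theta,\theta_V,\lambda,\lambda^\dagger$ be as defined in the context. i) We have $\sqrt{\mathrm{in}_{\lambda^\dagger}\ker\theta_V}=\ker\bar\theta\cap\mathbb K[x_1,\ldots,x_r]$. ii) If we consider the toric degeneration of $X_P$ induced by the $\mathbb G_m$-action on $\mathbb P(V)$, then we get $\mathbb X_0=\lim_{s\to0}s\cdot X_P=\bigcup X_{\Delta_{\mathfrak C}}$, where the union runs over all maximal chains $\mathfrak C$ in $A$.
   Context: Toric variety. $\mathbb K$ is an algebraically closed field of characteristic zero, $T\simeq(\mathbb K^* )^n$ is a torus with character lattice $M$, $M_{\mathbb R}=M\otimes_{\mathbb Z}\mathbb R$. $P\subseteq M_{\mathbb R}$ is a full dimensional normal lattice polytope, $\Lambda=P\cap M$, $V=\mathbb K^\Lambda$ with standard basis $\{e_\chi\}_{\chi\in\Lambda}$ and dual coordinates $x_\chi$. $X_P\subseteq\mathbb P(V)$ is the Zariski closure of the image of $T\to\mathbb P(V)$, $t\mapsto[\sum_{\chi\in\Lambda}\chi(t)e_\chi]$; $\hat X_P\subseteq V$ is its affine cone and $\mathbb K[\hat X_P]$ the coordinate ring of the cone (the homogeneous coordinate ring of $X_P$), graded by degree. $\hat T=\mathbb K^*\times T$, with character lattice $\hat M=\mathbb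 Z\oplus M$, acts on $V$ by $(c,t)\cdot e_\chi=c\chi(t)e_\chi$ and on functions by $(\hat t\cdot g)(x)=g(\hat t^{-1}x)$; so $x_\chi|_{\hat X_P}$ has weight $(-1,-\chi)$. A (nonzero) $\hat T$-eigenfunction $g$ is homogeneous and its weight $\lambda_g$ has first entry $-\deg g$. $M_{\mathbb R}$ is identified with $\{1\}\times M_{\mathbb R}\subset\mathbb R\oplus M_{\mathbb R}$. Stratification. $A$ is the set of (nonempty) faces of $P$, including $P$, ordered by inclusion; $\sigma^o$ is the relative interior of $\sigma$; $X_\sigma$ is the Zariski closure of the $T$-orbit $\{[\sum_{\chi\in\Lambda\cap\sigma}\chi(t)e_\chi]\mid t\in T\}$. A combinatorial Seshadri stratification on $X_P$ is a collection $(X_\sigma,f_\sigma)_{\sigma\in A}$ where each $f_\sigma\in\mathbb K[\hat X_P]\setminus\{0\}$ is a $\hat T$-eigenfunction with $\deg f_\sigma\ge1$ whose $\hat T$-weight $\mu_\sigma$ satisfies $\frac{-\mu_\sigma}{\deg f_\sigma}\in\sigma^o$. For a maximal chain $\mathfrak C$, $\Delta_{\mathfrak C}$ is the simplex with vertices $\frac{-\mu_\sigma}{\deg f_\sigma}$, $\sigma\in\mathfrak C$; under the assumption of the claim it is a lattice simplex. $X_{\Delta_{\mathfrak C}}$ is the (not necessarily normal) toric variety given by the Zariski closure of the image of $T\to\mathbb P(\mathbb K^{\Lambda_{\mathfrak C}})$, $t\mapsto[\sum_{\chi\in\Lambda_{\mathfrak C}}\chi(t)e_\chi]$, $\Lambda_{\mathfrak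 C}=\Lambda\cap\Delta_{\mathfrak C}$, viewed in $\mathbb P(V)$ via $\mathbb K^{\Lambda_{\mathfrak C}}\subseteq\mathbb K^\Lambda=V$. Quasi-valuation. For a maximal chain $\mathfrak C=\{\sigma_n>\dots>\sigma_0\}$ in $A$ the weights $\mu_{\sigma_n},\dots,\mu_{\sigma_0}$ form a $\mathbb Q$-basis of $\hat M_{\mathbb Q}$. $\mathbb Q^{\mathfrak C}$ is the subspace of $\mathbb Q^A$ (standard basis $e_\sigma$, $\sigma\in A$) spanned by $e_\sigma$, $\sigma\in\mathfrak C$. For a $\hat T$-eigenfunction $g$ of weight $\lambda_g=\sum_i a_i\mu_{\sigma_i}$ put $\nu_{\mathfrak C}(g)=\sum_i a_ie_{\sigma_i}$; for general $g\ne0$ take the minimum of the values on the $\hat T$-weight components of $g$. The minimum is with respect to the lexicographic order on $\mathbb Q^A$ induced by a fixed total order $>^t$ on $A$ refining the partial order (the coordinate at the $>^t$-largest element is compared first). The quasi-valuation is $\nu(g)=\min\{\nu_{\mathfrak C}(g)\mid\mathfrak C\text{ a maximal chain in }A\}$; it takes values in $\mathbb Q^A_{\ge0}$; let $\Gamma$ be its image. $\mathrm{gr}_\nu\mathbb K[\hat X_P]=\bigoplus_{\underline a\in\Gamma}\mathbb K[\hat X_P]_{\ge\underline a}/\mathbb K[\hat X_P]_{>\underline a}$, with $\mathbb K[\hat X_P]_{\ge\underline a}=\{g\mid g=0\text{ or }\nu(g)\ge^t\underline a\}$ and similarly for $>\underline a$. $\bar g$ is the class of $g$ in degree $\nu(g)$.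 Generators. $S\subseteq\hat M$ is the monoid generated by $(1,\chi)$, $\chi\in\Lambda$. For $(m,\eta)=\sum_\chi a_\chi(1,\chi)\in S$ set $f_{m,\eta}=\prod_\chi x_\chi^{a_\chi}|_{\hat X_P}$ (independent of the decomposition); these form a basis of $\mathbb K[\hat X_P]$. Fix a finite set $\{f_{m_1,\chi_1},\dots,f_{m_p,\chi_p}\}$ of basis elements consisting of all degree one elements $f_{1,\chi_1},\dots,f_{1,\chi_r}$ ($\Lambda=\{\chi_1,\dots,\chi_r\}$) and further elements such that the classes $\bar f_{m_i,\chi_i}$ generate $\mathrm{gr}_\nu\mathbb K[\hat X_P]$. Define surjective algebra morphisms $\theta:\mathbb K[x_1,\dots,x_p]\to\mathbb K[\hat X_P]$, $x_i\mapsto f_{m_i,\chi_i}$, and $\bar\theta:\mathbb K[x_1,\dots,x_p]\to\mathrm{gr}_\nu\mathbb K[\hat X_P]$, $x_i\mapsto\bar f_{m_i,\chi_i}$. Identify $\mathbb K[V]=\mathbb K[x_1,\dots,x_r]\subseteq\mathbb K[x_1,\dots,x_p]$ (with $x_i=x_{\chi_i}$ for $i\le r$); $\theta_V:\mathbb K[V]\to\mathbb K[\hat X_P]$ is the restriction map, so $\ker\theta_V=\ker\theta\cap\mathbb K[x_1,\dots,x_r]$ is the vanishing ideal of $X_P\subseteq\mathbb P(V)$. Initial ideals and limits. Order $\mathbb N\times\mathbb Q^A_{\ge0}$ by $(m',\underline a')\preceq(m,\underline a)$ iff $m'<m$, or $m'=m$ and $\underline a'\ge^t\underline a$. Put $\deg_Ax^\alpha=\sum_i\alpha_i(m_i,\nu(f_{m_i,\chi_i}))$.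 For $g\ne0$, $\mathrm{in}_\nu g$ is the sum of the terms of $g$ of $\preceq$-maximal $\deg_A$; $\mathrm{in}_\nu I$ is the ideal generated by all $\mathrm{in}_\nu g$, $g\in I\setminus\{0\}$. For an integral vector $\lambda$, $\mathrm{in}_\lambda g$ is the sum of the terms $c_\alpha x^\alpha$ of $g$ with $\lambda\cdot\alpha$ maximal, and $\mathrm{in}_\lambda I$ the ideal generated by all $\mathrm{in}_\lambda g$, $g\in I\setminus\{0\}$. Fix $\lambda=(\lambda_1,\dots,\lambda_p)\in\mathbb Z^p$ with $\mathrm{in}_\nu(\ker\theta)=\mathrm{in}_\lambda(\ker\theta)$ (such $\lambda$ exists by a known theorem of Kemper, Trung and van Anh) and put $\lambda^\dagger=(\lambda_1,\dots,\lambda_r)$, used for initial terms and ideals in $\mathbb K[x_1,\dots,x_r]$. $\mathbb G_m$ acts on $V$ by $s\cdot\sum_{i\le r}c_ie_{\chi_i}=\sum_{i\le r}s^{\lambda_i}c_ie_{\chi_i}$ and hence on $\mathbb P(V)$; the limit is defined as $\mathbb X_0=\lim_{s\to0}s\cdot X_P:=V(\mathrm{in}_{\lambda^\dagger}\ker\theta_V)\subseteq\mathbb P(V)$, the vanishing set of the initial ideal. *)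

theory Defs
  imports
    "HOL-Analysis.Analysis"
    "HOL-Algebra.QuotRing"
    "HOL-Algebra.Generated_Rings"
    "HOL-Library.Poly_Mapping"
    "HOL-Computational_Algebra.Polynomial"
begin

text \<open>
  Conventions. The torus is T = (K*)^n with n = CARD('n), its character lattice is
  M = \<int>^n, and the lattice of the extended torus K* x T is \<int> \<oplus> M. A vector of K^L, for a
  set L of characters, is a function vanishing outside L, so that K^L is literally a subspace of
  K^L' whenever L \<subseteq> L'. Polynomial variables are named by elements of \<int> \<oplus> M: the variable
  attached to the basis element f_(m,eta) is called (m,eta). In particular x_chi is the variable
  (1,chi), which makes the identification K[V] = K[x_1,...,x_r] \<subseteq> K[x_1,...,x_p] an inclusion.
\<close>

type_synonym 'n chr = "int ^ 'n"
type_synonym 'n wt = "int \<times> (int ^ 'n)"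
type_synonym ('n, 'k) vec_V = "int ^ 'n \<Rightarrow> 'k"
type_synonym ('n, 'k) func = "(int ^ 'n \<Rightarrow> 'k) \<Rightarrow> 'k"
type_synonym 'n face = "(real ^ 'n) set"
type_synonym 'n mon = "(int \<times> (int ^ 'n)) \<Rightarrow>\<^sub>0 nat"
type_synonym ('n, 'k) mpoly = "((int \<times> (int ^ 'n)) \<Rightarrow>\<^sub>0 nat) \<Rightarrow>\<^sub>0 'k"


section \<open>Polynomial rings and initial ideals\<close>

definition mpoly_ring :: "'n::finite wt set \<Rightarrow> ('n, 'k::field) mpoly ring" where
  "mpoly_ring I =
    \<lparr>carrier = {p. \<forall>\<alpha>\<in>Poly_Mapping.keys p. Poly_Mapping.keys \<alpha> \<subseteq> I},
     mult = (*), one = 1, zero = 0, add = (+)\<rparr>"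

definition mpoly_eval :: "('n::finite wt \<Rightarrow> 'k::field) \<Rightarrow> ('n, 'k) mpoly \<Rightarrow> 'k" where
  "mpoly_eval a p =
    (\<Sum>\<alpha>\<in>Poly_Mapping.keys p. Poly_Mapping.lookup p \<alpha> *
       (\<Prod>i\<in>Poly_Mapping.keys \<alpha>. a i ^ Poly_Mapping.lookup \<alpha> i))"

definition homogeneous :: "nat \<Rightarrow> ('n::finite, 'k::field) mpoly \<Rightarrow> bool" where
  "homogeneous d p \<longleftrightarrow>
    (\<forall>\<alpha>\<in>Poly_Mapping.keys p. (\<Sum>i\<in>Poly_Mapping.keys \<alpha>. Poly_Mapping.lookup \<alpha> i) = d)"

definition ideal_radical :: "('a, 'b) ring_scheme \<Rightarrow> 'a set \<Rightarrow> 'a set" where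
  "ideal_radical R I = {x \<in> carrier R. \<exists>k::nat. k > 0 \<and> x [^]\<^bsub>R\<^esub> k \<in> I}"

text \<open>
  The sum of the terms of maximal degree, for a degree function \<open>d\<close> on exponents and a total
  order \<open>ord\<close> on degrees. It is used both for \<open>in_\<nu>\<close> and for \<open>in_\<lambda>\<close>.
\<close>

definition initial_form ::
  "('d \<Rightarrow> 'd \<Rightarrow> bool) \<Rightarrow> ('n::finite mon \<Rightarrow> 'd) \<Rightarrow> ('n, 'k::field) mpoly \<Rightarrow> ('n, 'k) mpoly" where
  "initial_form ord d g =
    (\<Sum>\<alpha>\<in>{\<alpha> \<in> Poly_Mapping.keys g. \<forall>\<beta>\<in>Poly_Mapping.keys g. ord (d \<beta>) (d \<alpha>)}.
       Poly_Mapping.single \<alpha> (Poly_Mapping.lookup g \<alpha>))"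

definition initial_ideal ::
  "'n::finite wt set \<Rightarrow> ('d \<Rightarrow> 'd \<Rightarrow> bool) \<Rightarrow> ('n mon \<Rightarrow> 'd) \<Rightarrow> ('n, 'k::field) mpoly set
     \<Rightarrow> ('n, 'k) mpoly set" where
  "initial_ideal I ord d J = Idl\<^bsub>mpoly_ring I\<^esub> (initial_form ord d ` (J - {0}))"

definition int_weight_deg :: "('n::finite wt \<Rightarrow> int) \<Rightarrow> 'n mon \<Rightarrow> int" where
  "int_weight_deg lam \<alpha> = (\<Sum>i\<in>Poly_Mapping.keys \<alpha>. lam i * int (Poly_Mapping.lookup \<alpha> i))"

abbreviation in_lam_ideal ::
  "'n::finite wt set \<Rightarrow> ('n wt \<Rightarrow> int) \<Rightarrow> ('n, 'k::field) mpoly set \<Rightarrow> ('n, 'k) mpoly set" where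
  "in_lam_ideal I lam J \<equiv> initial_ideal I (\<le>) (int_weight_deg lam) J"


section \<open>Lattice polytopes\<close>

definition rvec :: "'n::finite chr \<Rightarrow> real ^ 'n" where
  "rvec x = (\<chi> i. real_of_int (x $ i))"

definition lattice_points :: "'n::finite face \<Rightarrow> 'n chr set" where
  "lattice_points Q = {x. rvec x \<in> Q}"

definition lattice_polytope :: "'n::finite face \<Rightarrow> bool" where
  "lattice_polytope P \<longleftrightarrow> (\<exists>W. finite W \<and> P = convex hull (rvec ` W))"

definition normal_polytope :: "'n::finite face \<Rightarrow> bool" where
  "normal_polytope P \<longleftrightarrow>
    (\<forall>k l :: nat.
       {x + y |x y. x \<in> lattice_points ((\<lambda>z. real k *\<^sub>R z) ` P) \<and>
                    y \<in> lattice_points ((\<lambda>z. real l *\<^sub>R z) ` P)} =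
       lattice_points ((\<lambda>z. real (k + l) *\<^sub>R z) ` P))"

definition faces :: "'n::finite face \<Rightarrow> 'n face set" where
  "faces P = {\<sigma>. \<sigma> face_of P \<and> \<sigma> \<noteq> {}}"

abbreviation max_chains :: "'n::finite face \<Rightarrow> 'n face set set" where
  "max_chains P \<equiv> {C. subset.maxchain (faces P) C}"


section \<open>Projective toric varieties and their cones\<close>

definition vec_space :: "'n::finite chr set \<Rightarrow> ('n, 'k::field) vec_V set" where
  "vec_space L = {v. \<forall>x. x \<notin> L \<longrightarrow> v x = 0}"

text \<open>The point [v] is the set of nonzero multiples of \<open>v\<close>.\<close>

definition proj_pt :: "('n::finite, 'k::field) vec_V \<Rightarrow> ('n, 'k) vec_V set" where
  "proj_pt v = {(\<lambda>x. c * v x) |c. c \<noteq> 0}"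

definition proj_space :: "'n::finite chr set \<Rightarrow> ('n, 'k::field) vec_V set set" where
  "proj_space L = proj_pt ` (vec_space L - {\<lambda>x. 0})"

abbreviation coord_vars :: "'n::finite chr set \<Rightarrow> 'n wt set" where
  "coord_vars L \<equiv> {1} \<times> L"

definition poly_fun :: "('n::finite, 'k::field) mpoly \<Rightarrow> ('n, 'k) func" where
  "poly_fun p v = mpoly_eval (\<lambda>i. v (snd i)) p"

definition proj_zeros ::
  "'n::finite chr set \<Rightarrow> ('n, 'k::field) mpoly set \<Rightarrow> ('n, 'k) vec_V set set" where
  "proj_zeros L F = {y \<in> proj_space L. \<forall>p\<in>F. \<forall>v\<in>y. poly_fun p v = 0}"

definition zariski_closed :: "'n::finite chr set \<Rightarrow> ('n, 'k::field) vec_V set set \<Rightarrow> bool" where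
  "zariski_closed L Y \<longleftrightarrow>
    (\<exists>F \<subseteq> carrier (mpoly_ring (coord_vars L)).
       (\<forall>p\<in>F. \<exists>d. homogeneous d p) \<and> Y = proj_zeros L F)"

definition torus :: "('k::field ^ 'n::finite) set" where
  "torus = {t. \<forall>i. t $ i \<noteq> 0}"

definition character :: "'n::finite chr \<Rightarrow> 'k::field ^ 'n \<Rightarrow> 'k" where
  "character x t = (\<Prod>i\<in>UNIV. (t $ i) powi (x $ i))"

definition torus_orbit :: "'n::finite chr set \<Rightarrow> ('n, 'k::field) vec_V set set" where
  "torus_orbit L = {proj_pt (\<lambda>x. if x \<in> L then character x t else 0) |t. t \<in> torus}"

text \<open>The Zariski closure, in the projective space of K^B, of the orbit attached to \<open>L \<subseteq> B\<close>.\<close>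

definition orbit_closure ::
  "'n::finite chr set \<Rightarrow> 'n chr set \<Rightarrow> ('n, 'k::field) vec_V set set" where
  "orbit_closure B L = zariski_closed B hull torus_orbit L"

definition toric_variety :: "'n::finite chr set \<Rightarrow> ('n, 'k::field) vec_V set set" where
  "toric_variety L = orbit_closure L L"

definition affine_cone :: "'n::finite chr set \<Rightarrow> ('n, 'k::field) vec_V set" where
  "affine_cone L =
    {v \<in> vec_space L. v = (\<lambda>x. 0) \<or> proj_pt v \<in> toric_variety L}"

text \<open>
  The coordinate ring of the affine cone, as the ring of restrictions of polynomial functions;
  \<open>restr L\<close> is the restriction map from the polynomial ring.
\<close>

definition restr :: "'n::finite chr set \<Rightarrow> ('n, 'k::field) mpoly \<Rightarrow> ('n, 'k) func" where
  "restr L p = (\<lambda>v\<in>affine_cone L. poly_fun p v)"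

definition coord_ring :: "'n::finite chr set \<Rightarrow> ('n, 'k::field) func ring" where
  "coord_ring L =
    \<lparr>carrier = restr L ` carrier (mpoly_ring (coord_vars L)),
     mult = (\<lambda>g h. \<lambda>v\<in>affine_cone L. g v * h v),
     one = (\<lambda>v\<in>affine_cone L. 1),
     zero = (\<lambda>v\<in>affine_cone L. 0),
     add = (\<lambda>g h. \<lambda>v\<in>affine_cone L. g v + h v)\<rparr>"

definition hom_deg :: "'n::finite chr set \<Rightarrow> ('n, 'k::field) func \<Rightarrow> nat" where
  "hom_deg L g =
    (THE d. \<exists>p\<in>carrier (mpoly_ring (coord_vars L)). homogeneous d p \<and> g = restr L p)"


section \<open>Weights for the extended torus\<close>

definition ext_act :: "'k::field \<Rightarrow> 'k ^ 'n::finite \<Rightarrow> ('n, 'k) vec_V \<Rightarrow> ('n, 'k) vec_V" where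
  "ext_act c t v = (\<lambda>x. c * character x t * v x)"

text \<open>
  A nonzero \<open>g\<close> of weight (m,eta): g(s^(-1) v) = c^m eta(t) g(v) for all s = (c,t). Thus the
  coordinate function \<open>x_\<chi>\<close> has weight \<open>(-1,-\<chi>)\<close>.
\<close>

definition eigenfunction :: "'n::finite chr set \<Rightarrow> ('n, 'k::field) func \<Rightarrow> 'n wt \<Rightarrow> bool" where
  "eigenfunction L g \<mu> \<longleftrightarrow>
    g \<in> carrier (coord_ring L) \<and> g \<noteq> \<zero>\<^bsub>coord_ring L\<^esub> \<and>
    (\<forall>c t v. c \<noteq> 0 \<and> t \<in> torus \<and> v \<in> affine_cone L \<longrightarrow>
       g (ext_act (inverse c) (\<chi> i. inverse (t $ i)) v) =
         c powi (fst \<mu>) * character (snd \<mu>) t * g v)"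

definition weight :: "'n::finite chr set \<Rightarrow> ('n, 'k::field) func \<Rightarrow> 'n wt" where
  "weight L g = (THE \<mu>. eigenfunction L g \<mu>)"

definition weight_components ::
  "'n::finite chr set \<Rightarrow> ('n, 'k::field) func \<Rightarrow> 'n wt \<Rightarrow> ('n, 'k) func" where
  "weight_components L g =
    (THE h. finite {\<mu>. h \<mu> \<noteq> \<zero>\<^bsub>coord_ring L\<^esub>} \<and>
            (\<forall>\<mu>. h \<mu> = \<zero>\<^bsub>coord_ring L\<^esub> \<or> eigenfunction L (h \<mu>) \<mu>) \<and>
            g = finsum (coord_ring L) h {\<mu>. h \<mu> \<noteq> \<zero>\<^bsub>coord_ring L\<^esub>})"


section \<open>Combinatorial Seshadri stratifications\<close>

text \<open>The point \<open>-\<mu>/deg g\<close> for an eigenfunction \<open>g\<close> of weight \<open>\<mu>\<close>.\<close>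

definition normalized_weight :: "'n::finite chr set \<Rightarrow> ('n, 'k::field) func \<Rightarrow> real \<times> (real ^ 'n)" where
  "normalized_weight L g =
    (1 / real (hom_deg L g)) *\<^sub>R
      (- (real_of_int (fst (weight L g)), rvec (snd (weight L g))))"

definition combinatorial_seshadri_stratification ::
  "'n::finite face \<Rightarrow> ('n face \<Rightarrow> ('n, 'k::field) vec_V set set) \<Rightarrow>
   ('n face \<Rightarrow> ('n, 'k) func) \<Rightarrow> bool" where
  "combinatorial_seshadri_stratification P X f \<longleftrightarrow>
    (\<forall>\<sigma>\<in>faces P.
       X \<sigma> = orbit_closure (lattice_points P) (lattice_points P \<inter> lattice_points \<sigma>) \<and>
       f \<sigma> \<in> carrier (coord_ring (lattice_points P)) - {\<zero>\<^bsub>coord_ring (lattice_points P)\<^esub>} \<and>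
       (\<exists>\<mu>. eigenfunction (lattice_points P) (f \<sigma>) \<mu>) \<and>
       hom_deg (lattice_points P) (f \<sigma>) \<ge> 1 \<and>
       normalized_weight (lattice_points P) (f \<sigma>) \<in> {1} \<times> rel_interior \<sigma>)"

definition chain_simplex ::
  "'n::finite face \<Rightarrow> ('n face \<Rightarrow> ('n, 'k::field) func) \<Rightarrow> 'n face set \<Rightarrow> 'n face" where
  "chain_simplex P f C =
    {z. (1, z) \<in> convex hull ((\<lambda>\<sigma>. normalized_weight (lattice_points P) (f \<sigma>)) ` C)}"

definition chain_variety ::
  "'n::finite face \<Rightarrow> ('n face \<Rightarrow> ('n, 'k::field) func) \<Rightarrow> 'n face set \<Rightarrow> ('n, 'k) vec_V set set"
  where
  "chain_variety P f C = toric_variety (lattice_points P \<inter> lattice_points (chain_simplex P f C))"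


section \<open>The quasi-valuation\<close>

text \<open>
  Elements of \<open>\<rat>^A\<close> are functions vanishing outside \<open>A = faces P\<close>. The relation \<open>R\<close> is the
  reflexive total order on \<open>A\<close>, with \<open>(\<sigma>,\<tau>) \<in> R\<close> meaning that \<open>\<sigma>\<close> is at most \<open>\<tau>\<close>.
\<close>

definition lex_le ::
  "'n::finite face \<Rightarrow> 'n face rel \<Rightarrow> ('n face \<Rightarrow> rat) \<Rightarrow> ('n face \<Rightarrow> rat) \<Rightarrow> bool" where
  "lex_le P R a b \<longleftrightarrow>
    a = b \<or>
    (\<exists>\<sigma>\<in>faces P. a \<sigma> < b \<sigma> \<and> (\<forall>\<tau>\<in>faces P. (\<sigma>, \<tau>) \<in> R \<and> \<tau> \<noteq> \<sigma> \<longrightarrow> a \<tau> = b \<tau>))"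

definition lex_min ::
  "'n::finite face \<Rightarrow> 'n face rel \<Rightarrow> ('n face \<Rightarrow> rat) set \<Rightarrow> ('n face \<Rightarrow> rat)" where
  "lex_min P R S = (THE a. a \<in> S \<and> (\<forall>b\<in>S. lex_le P R a b))"

definition chain_coords ::
  "'n::finite face \<Rightarrow> ('n face \<Rightarrow> ('n, 'k::field) func) \<Rightarrow> 'n face set \<Rightarrow> 'n wt \<Rightarrow> ('n face \<Rightarrow> rat)"
  where
  "chain_coords P f C \<mu> =
    (THE a. (\<forall>\<sigma>. \<sigma> \<notin> C \<longrightarrow> a \<sigma> = 0) \<and>
       rat_of_int (fst \<mu>) =
         (\<Sum>\<sigma>\<in>C. a \<sigma> * rat_of_int (fst (weight (lattice_points P) (f \<sigma>)))) \<and>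
       (\<forall>i. rat_of_int (snd \<mu> $ i) =
         (\<Sum>\<sigma>\<in>C. a \<sigma> * rat_of_int (snd (weight (lattice_points P) (f \<sigma>)) $ i))))"

definition chain_val ::
  "'n::finite face \<Rightarrow> ('n face \<Rightarrow> ('n, 'k::field) func) \<Rightarrow> 'n face rel \<Rightarrow> 'n face set \<Rightarrow>
   ('n, 'k) func \<Rightarrow> ('n face \<Rightarrow> rat)" where
  "chain_val P f R C g =
    lex_min P R
      {chain_coords P f C \<mu> |\<mu>.
         weight_components (lattice_points P) g \<mu> \<noteq> \<zero>\<^bsub>coord_ring (lattice_points P)\<^esub>}"

definition quasi_val ::
  "'n::finite face \<Rightarrow> ('n face \<Rightarrow> ('n, 'k::field) func) \<Rightarrow> 'n face rel \<Rightarrow>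
   ('n, 'k) func \<Rightarrow> ('n face \<Rightarrow> rat)" where
  "quasi_val P f R g = lex_min P R {chain_val P f R C g |C. C \<in> max_chains P}"

definition val_image ::
  "'n::finite face \<Rightarrow> ('n face \<Rightarrow> ('n, 'k::field) func) \<Rightarrow> 'n face rel \<Rightarrow> ('n face \<Rightarrow> rat) set" where
  "val_image P f R =
    quasi_val P f R `
      (carrier (coord_ring (lattice_points P)) - {\<zero>\<^bsub>coord_ring (lattice_points P)\<^esub>})"


section \<open>The associated graded ring\<close>

definition filt_ge ::
  "'n::finite face \<Rightarrow> ('n face \<Rightarrow> ('n, 'k::field) func) \<Rightarrow> 'n face rel \<Rightarrow> ('n face \<Rightarrow> rat) \<Rightarrow>
   ('n, 'k) func set" where
  "filt_ge P f R a =
    {g \<in> carrier (coord_ring (lattice_points P)).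
       g = \<zero>\<^bsub>coord_ring (lattice_points P)\<^esub> \<or> lex_le P R a (quasi_val P f R g)}"

definition filt_gt ::
  "'n::finite face \<Rightarrow> ('n face \<Rightarrow> ('n, 'k::field) func) \<Rightarrow> 'n face rel \<Rightarrow> ('n face \<Rightarrow> rat) \<Rightarrow>
   ('n, 'k) func set" where
  "filt_gt P f R a =
    {g \<in> carrier (coord_ring (lattice_points P)).
       g = \<zero>\<^bsub>coord_ring (lattice_points P)\<^esub> \<or>
       (lex_le P R a (quasi_val P f R g) \<and> quasi_val P f R g \<noteq> a)}"

text \<open>
  An element of the direct sum is a family of cosets indexed by the image of the quasi-valuation,
  almost all of them zero. Since the quasi-valuation is nonnegative, \<open>filt_gt a\<close> is an ideal, so
  the component of index \<open>a\<close> lives in the quotient by it. The product of the components of index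
  \<open>a\<close> and \<open>b\<close> is the coset of index \<open>a + b\<close> of the product of representatives; it is zero when
  \<open>a + b\<close> is not a value, since then \<open>filt_ge\<close> and \<open>filt_gt\<close> agree at \<open>a + b\<close>.
\<close>

definition gr_support ::
  "'n::finite face \<Rightarrow> ('n face \<Rightarrow> ('n, 'k::field) func) \<Rightarrow> 'n face rel \<Rightarrow>
   (('n face \<Rightarrow> rat) \<Rightarrow> ('n, 'k) func set) \<Rightarrow> ('n face \<Rightarrow> rat) set" where
  "gr_support P f R u = {a \<in> val_image P f R. u a \<noteq> filt_gt P f R a}"

definition gr_ring ::
  "'n::finite face \<Rightarrow> ('n face \<Rightarrow> ('n, 'k::field) func) \<Rightarrow> 'n face rel \<Rightarrow>
   (('n face \<Rightarrow> rat) \<Rightarrow> ('n, 'k) func set) ring" where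
  "gr_ring P f R =
    (let K = coord_ring (lattice_points P); \<Gamma> = val_image P f R; N = filt_gt P f R in
    \<lparr>carrier = {u \<in> (\<Pi>\<^sub>E a\<in>\<Gamma>. (\<lambda>g. N a +>\<^bsub>K\<^esub> g) ` filt_ge P f R a).
                  finite (gr_support P f R u)},
     mult = (\<lambda>u w. \<lambda>c\<in>\<Gamma>.
       finsum (K Quot (N c)) (\<lambda>(a, b). rcoset_mult K (N c) (u a) (w b))
         {(a, b). a \<in> gr_support P f R u \<and> b \<in> gr_support P f R w \<and> (\<lambda>\<sigma>. a \<sigma> + b \<sigma>) = c}),
     one = (\<lambda>c\<in>\<Gamma>. if c = (\<lambda>\<sigma>. 0) then N c +>\<^bsub>K\<^esub> \<one>\<^bsub>K\<^esub> else N c),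
     zero = (\<lambda>c\<in>\<Gamma>. N c),
     add = (\<lambda>u w. \<lambda>c\<in>\<Gamma>. u c <+>\<^bsub>K\<^esub> w c)\<rparr>)"

definition gr_hom_elem ::
  "'n::finite face \<Rightarrow> ('n face \<Rightarrow> ('n, 'k::field) func) \<Rightarrow> 'n face rel \<Rightarrow> ('n face \<Rightarrow> rat) \<Rightarrow>
   ('n, 'k) func \<Rightarrow> (('n face \<Rightarrow> rat) \<Rightarrow> ('n, 'k) func set)" where
  "gr_hom_elem P f R a g =
    (\<lambda>c\<in>val_image P f R.
       if c = a then filt_gt P f R c +>\<^bsub>coord_ring (lattice_points P)\<^esub> g else filt_gt P f R c)"

definition gr_class ::
  "'n::finite face \<Rightarrow> ('n face \<Rightarrow> ('n, 'k::field) func) \<Rightarrow> 'n face rel \<Rightarrow>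
   ('n, 'k) func \<Rightarrow> (('n face \<Rightarrow> rat) \<Rightarrow> ('n, 'k) func set)" where
  "gr_class P f R g = gr_hom_elem P f R (quasi_val P f R g) g"

text \<open>The structure map from the ground field: constants have quasi-valuation 0.\<close>

definition gr_const ::
  "'n::finite face \<Rightarrow> ('n face \<Rightarrow> ('n, 'k::field) func) \<Rightarrow> 'n face rel \<Rightarrow>
   'k \<Rightarrow> (('n face \<Rightarrow> rat) \<Rightarrow> ('n, 'k) func set)" where
  "gr_const P f R c =
    gr_hom_elem P f R (\<lambda>\<sigma>. 0) (\<lambda>v\<in>affine_cone (lattice_points P). c)"


section \<open>Basis elements and the algebra morphisms\<close>

definition cone_monoid :: "'n::finite chr set \<Rightarrow> 'n wt set" where
  "cone_monoid L =
    {(\<Sum>x\<in>L. int (a x), \<Sum>x\<in>L. of_nat (a x) *s x) |a :: 'n chr \<Rightarrow> nat. True}"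

definition basis_fun :: "'n::finite chr set \<Rightarrow> 'n wt \<Rightarrow> ('n, 'k::field) func" where
  "basis_fun L s =
    (THE g. \<exists>a :: 'n chr \<Rightarrow> nat.
       s = (\<Sum>x\<in>L. int (a x), \<Sum>x\<in>L. of_nat (a x) *s x) \<and>
       g = (\<lambda>v\<in>affine_cone L. \<Prod>x\<in>L. v x ^ a x))"

definition theta ::
  "'n::finite face \<Rightarrow> ('n, 'k::field) mpoly \<Rightarrow> ('n, 'k) func" where
  "theta P p =
    (\<lambda>v\<in>affine_cone (lattice_points P).
       mpoly_eval (\<lambda>s. basis_fun (lattice_points P) s v) p)"

definition theta_bar ::
  "'n::finite face \<Rightarrow> ('n face \<Rightarrow> ('n, 'k::field) func) \<Rightarrow> 'n face rel \<Rightarrow>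
   ('n, 'k) mpoly \<Rightarrow> (('n face \<Rightarrow> rat) \<Rightarrow> ('n, 'k) func set)" where
  "theta_bar P f R p =
    finsum (gr_ring P f R)
      (\<lambda>\<alpha>. gr_const P f R (Poly_Mapping.lookup p \<alpha>) \<otimes>\<^bsub>gr_ring P f R\<^esub>
        finprod (gr_ring P f R)
          (\<lambda>s. gr_class P f R (basis_fun (lattice_points P) s)
                 [^]\<^bsub>gr_ring P f R\<^esub> Poly_Mapping.lookup \<alpha> s)
          (Poly_Mapping.keys \<alpha>))
      (Poly_Mapping.keys p)"

definition gr_generators ::
  "'n::finite face \<Rightarrow> ('n face \<Rightarrow> ('n, 'k::field) func) \<Rightarrow> 'n face rel \<Rightarrow> 'n wt set \<Rightarrow> bool" where
  "gr_generators P f R G \<longleftrightarrow>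
    finite G \<and> G \<subseteq> cone_monoid (lattice_points P) \<and> {1} \<times> lattice_points P \<subseteq> G \<and>
    generate_ring (gr_ring P f R)
      (range (gr_const P f R) \<union>
       (\<lambda>s. gr_class P f R (basis_fun (lattice_points P) s)) ` G) =
    carrier (gr_ring P f R)"

definition ker_theta :: "'n::finite face \<Rightarrow> 'n wt set \<Rightarrow> ('n, 'k::field) mpoly set" where
  "ker_theta P G = a_kernel (mpoly_ring G) (coord_ring (lattice_points P)) (theta P)"

definition ker_theta_V :: "'n::finite face \<Rightarrow> ('n, 'k::field) mpoly set" where
  "ker_theta_V P =
    a_kernel (mpoly_ring (coord_vars (lattice_points P))) (coord_ring (lattice_points P))
      (restr (lattice_points P))"

definition ker_theta_bar ::
  "'n::finite face \<Rightarrow> ('n face \<Rightarrow> ('n, 'k::field) func) \<Rightarrow> 'n face rel \<Rightarrow> 'n wt set \<Rightarrow>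
   ('n, 'k) mpoly set" where
  "ker_theta_bar P f R G = a_kernel (mpoly_ring G) (gr_ring P f R) (theta_bar P f R)"


section \<open>Initial ideals with respect to the quasi-valuation, and the limit\<close>

definition deg_A ::
  "'n::finite face \<Rightarrow> ('n face \<Rightarrow> ('n, 'k::field) func) \<Rightarrow> 'n face rel \<Rightarrow>
   'n mon \<Rightarrow> int \<times> ('n face \<Rightarrow> rat)" where
  "deg_A P f R \<alpha> =
    (\<Sum>s\<in>Poly_Mapping.keys \<alpha>. int (Poly_Mapping.lookup \<alpha> s) * fst s,
     \<lambda>\<sigma>. \<Sum>s\<in>Poly_Mapping.keys \<alpha>.
       of_nat (Poly_Mapping.lookup \<alpha> s) * quasi_val P f R (basis_fun (lattice_points P) s) \<sigma>)"

text \<open>In equal degree the order on values is reversed.\<close>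

definition deg_A_le ::
  "'n::finite face \<Rightarrow> 'n face rel \<Rightarrow> int \<times> ('n face \<Rightarrow> rat) \<Rightarrow> int \<times> ('n face \<Rightarrow> rat) \<Rightarrow> bool" where
  "deg_A_le P R d' d \<longleftrightarrow> fst d' < fst d \<or> (fst d' = fst d \<and> lex_le P R (snd d) (snd d'))"

abbreviation in_nu_ideal ::
  "'n::finite face \<Rightarrow> ('n face \<Rightarrow> ('n, 'k::field) func) \<Rightarrow> 'n face rel \<Rightarrow> 'n wt set \<Rightarrow>
   ('n, 'k) mpoly set \<Rightarrow> ('n, 'k) mpoly set" where
  "in_nu_ideal P f R G J \<equiv> initial_ideal G (deg_A_le P R) (deg_A P f R) J"

text \<open>
  The limit of \<open>s \<cdot> X_P\<close> for \<open>s \<rightarrow> 0\<close>, where \<open>s\<close> multiplies the coordinate of index \<open>\<chi>\<close> by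
  \<open>s^(lam (1,\<chi>))\<close>. By definition it is the vanishing set of the initial ideal; only the values
  of \<open>lam\<close> on the variables of \<open>K[V]\<close> enter, that is, the truncation of \<open>lam\<close>.
\<close>

definition degeneration_limit ::
  "'n::finite face \<Rightarrow> ('n wt \<Rightarrow> int) \<Rightarrow> ('n, 'k::field) vec_V set set" where
  "degeneration_limit P lam =
    proj_zeros (lattice_points P)
      (in_lam_ideal (coord_vars (lattice_points P)) lam (ker_theta_V P))"

end

theory Submission
  imports Defs "HOL-Library.Function_Algebras"
begin

text \<open>
  Since every \<open>f\<^sub>\<sigma>\<close> has degree one, it is a multiple of a coordinate \<open>x_\<chi>\<close>, where \<open>\<chi> = pt \<sigma>\<close> is a
  lattice point in the relative interior of \<open>\<sigma>\<close>. The simplices spanned by these points, one for each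
  maximal chain of faces, triangulate the polytope. Hence every \<open>s\<close> in the monoid \<open>S\<close> is a nonnegative
  rational combination of the points \<open>(1, pt \<sigma>)\<close> of some chain; call its coefficients \<open>val s\<close>. Affine
  forms that expose faces show that \<open>val s\<close> is lexicographically largest among all nonnegative
  combinations for \<open>s\<close> and smallest among the coordinates of \<open>s\<close> on all maximal chains
  (\<open>chain_coefficients_dominate\<close>, \<open>combo_lex_le\<close>). The second property gives \<open>\<nu>(f_s) = val s\<close>, and
  \<open>\<nu>(g)\<close> is the least \<open>val s\<close> over the basis functions \<open>f_s\<close> that occur in \<open>g\<close> (\<open>quasi_val_eq\<close>). The
  first gives \<open>val s + val s' \<le> val (s + s')\<close>, with equality iff both supports lie in a common chain.

  Therefore the graded ring has one basis element for each \<open>s\<close>, and the product of two of them is the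
  basis element of the sum or zero, according as the supports fit into one chain or not. A monomial in
  the variables \<open>x_s\<close> maps to a basis element if all its variables belong to one simplex (it
  ``survives'') and to zero otherwise. Thus the kernel of \<open>\<theta>\<close>-bar consists of the polynomials whose
  surviving coefficients sum to zero in each weight (\<open>ker_theta_bar_iff\<close>). Equivalently, these are the
  polynomials that vanish on a union of tori, one for each maximal chain (\<open>gr_ker_iff\<close>), because
  distinct characters of a torus are linearly independent. In particular the kernel is radical.

  All initial forms of elements of \<open>ker \<theta>\<close> with respect to \<open>\<nu>\<close> lie in this kernel
  (\<open>initial_form_in_gr_ker\<close>), so by the choice of \<open>\<lambda>\<close> the initial forms with respect to \<open>\<lambda>\<close> do as
  well. This gives one inclusion of the first claim. It also determines the initial forms of binomials
  \<open>x^\<alpha> - x^\<beta>\<close> in \<open>ker \<theta>\<close> (\<open>initial_binomial\<close>): if both monomials survive, the binomial is its own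
  initial form; if only \<open>x^\<beta>\<close> survives, the initial form is \<open>x^\<alpha>\<close>. For the other inclusion, the kernel
  in \<open>\<bbbK>[V]\<close> is spanned by differences of surviving monomials of equal weight, which are such initial
  forms, and by monomials that do not survive. If \<open>x^\<alpha>\<close> does not survive, clear the denominators of
  \<open>val (wt \<alpha>)\<close> by some \<open>N\<close>: then \<open>x^(N\<alpha>)\<close> has the weight of a surviving monomial in the coordinates
  \<open>x_(pt \<sigma>)\<close>, which lie in \<open>\<bbbK>[V]\<close> because the \<open>f\<^sub>\<sigma>\<close> have degree one, so \<open>x^(N\<alpha>)\<close> is an initial form.

  For the second claim, an ideal and its radical have the same zeros, so the limit is the zero set of
  the kernel in \<open>\<bbbK>[V]\<close>. At a point \<open>v\<close> of the limit the product of the nonzero coordinates does not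
  vanish, so it survives, and these coordinates belong to a single simplex \<open>\<Delta>\<close>; all monomials in the
  coordinates of \<open>\<Delta>\<close> survive, so the kernel restricts to the toric ideal of \<open>X\<^sub>\<Delta>\<close>.
\<close>

(* Weights are pairs (m, eta); quantifiers over weights stay unsplit. *)
declare split_paired_All [simp del] split_paired_Ex [simp del]

abbreviation "keys \<equiv> Poly_Mapping.keys"
abbreviation "lookup \<equiv> Poly_Mapping.lookup"
abbreviation "single \<equiv> Poly_Mapping.single"

section \<open>Polynomials: evaluation and gradings\<close>

lemma mpoly_sum_monomials:
  fixes p :: "'a \<Rightarrow>\<^sub>0 'b::comm_monoid_add"
  assumes "finite A" "keys p \<subseteq> A"
  shows "p = (\<Sum>\<alpha>\<in>A. single \<alpha> (lookup p \<alpha>))"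
  by (rule poly_mapping_eqI)
    (use assms in \<open>auto simp: lookup_sum lookup_single when_def not_in_keys_iff_lookup_eq_zero
       sum.delta'\<close>)

lemma mpoly_induct [case_names single add zero]:
  fixes p :: "'a \<Rightarrow>\<^sub>0 'b::comm_monoid_add"
  assumes single: "\<And>\<alpha> c. \<alpha> \<in> keys p \<Longrightarrow> Q (single \<alpha> c)" and add: "\<And>p q. Q p \<Longrightarrow> Q q \<Longrightarrow> Q (p + q)"
    and zero: "Q 0"
  shows "Q p"
proof -
  have "Q (\<Sum>\<alpha>\<in>A. single \<alpha> (lookup p \<alpha>))" if "finite A" "A \<subseteq> keys p" for A
    using that by (induction A rule: finite_induct) (auto intro: assms)
  then show ?thesis
    using mpoly_sum_monomials[of "keys p" p] by (metis finite_keys order_refl)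
qed

definition mon_eval :: "('a \<Rightarrow> 'k::comm_semiring_1) \<Rightarrow> ('a \<Rightarrow>\<^sub>0 nat) \<Rightarrow> 'k" where
  "mon_eval a \<alpha> = (\<Prod>i\<in>keys \<alpha>. a i ^ lookup \<alpha> i)"

lemma mon_eval_superset:
  assumes "finite A" "keys \<alpha> \<subseteq> A"
  shows "mon_eval a \<alpha> = (\<Prod>i\<in>A. a i ^ lookup \<alpha> i)"
  unfolding mon_eval_def
  by (rule prod.mono_neutral_left) (use assms in \<open>auto simp: not_in_keys_iff_lookup_eq_zero\<close>)

lemma mon_eval_add: "mon_eval a (\<alpha> + \<beta>) = mon_eval a \<alpha> * mon_eval a \<beta>"
proof -
  let ?A = "keys \<alpha> \<union> keys \<beta>"
  have "keys (\<alpha> + \<beta>) \<subseteq> ?A" by (rule keys_add)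
  then show ?thesis
    using mon_eval_superset[of ?A "\<alpha> + \<beta>" a] mon_eval_superset[of ?A \<alpha> a]
      mon_eval_superset[of ?A \<beta> a]
    by (simp add: lookup_add power_add prod.distrib)
qed

lemma mon_eval_0 [simp]: "mon_eval a 0 = 1"
  by (simp add: mon_eval_def)

lemma mon_eval_single [simp]: "mon_eval a (single i n) = a i ^ n"
  by (simp add: mon_eval_def)

lemma mon_eval_cong: "(\<And>i. i \<in> keys \<alpha> \<Longrightarrow> a i = b i) \<Longrightarrow> mon_eval a \<alpha> = mon_eval b \<alpha>"
  unfolding mon_eval_def by (rule prod.cong) auto

lemma mpoly_eval_mon_eval: "mpoly_eval a p = (\<Sum>\<alpha>\<in>keys p. lookup p \<alpha> * mon_eval a \<alpha>)"
  by (simp add: mpoly_eval_def mon_eval_def)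

lemma mpoly_eval_add: "mpoly_eval a (p + q) = mpoly_eval a p + mpoly_eval a q"
  unfolding mpoly_eval_mon_eval
  by (rule setsum_keys_plus_distrib) (auto simp: algebra_simps)

lemma mpoly_eval_0 [simp]: "mpoly_eval a 0 = 0"
  by (simp add: mpoly_eval_def)

lemma mpoly_eval_single [simp]: "mpoly_eval a (single \<alpha> c) = c * mon_eval a \<alpha>"
  by (simp add: mpoly_eval_mon_eval)

lemma mpoly_eval_sum: "mpoly_eval a (\<Sum>i\<in>A. F i) = (\<Sum>i\<in>A. mpoly_eval a (F i))"
  by (induction A rule: infinite_finite_induct) (auto simp: mpoly_eval_add)

lemma mpoly_eval_mult: "mpoly_eval a (p * q) = mpoly_eval a p * mpoly_eval a q"
proof (induction p rule: mpoly_induct)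
  case (single \<alpha> c)
  show ?case
    by (induction q rule: mpoly_induct)
      (auto simp: mult_single mon_eval_add mpoly_eval_add algebra_simps)
qed (auto simp: algebra_simps mpoly_eval_add)

lemma mpoly_eval_1 [simp]: "mpoly_eval a 1 = 1"
  unfolding single_one[symmetric] by (simp del: single_one)

lemma mpoly_eval_uminus: "mpoly_eval a (- p) = - mpoly_eval a p"
  by (metis add.inverse_unique add.right_inverse mpoly_eval_0 mpoly_eval_add)

lemma mpoly_eval_diff: "mpoly_eval a (p - q) = mpoly_eval a p - mpoly_eval a q"
  using mpoly_eval_add[of a p "- q"] by (simp add: mpoly_eval_uminus)

lemma mpoly_eval_power: "mpoly_eval a (p ^ k) = mpoly_eval a p ^ k"
  by (induction k) (auto simp: mpoly_eval_mult)

lemma mpoly_eval_cong: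
  "(\<And>\<alpha> i. \<alpha> \<in> keys p \<Longrightarrow> i \<in> keys \<alpha> \<Longrightarrow> a i = b i) \<Longrightarrow> mpoly_eval a p = mpoly_eval b p"
  unfolding mpoly_eval_mon_eval by (intro sum.cong refl arg_cong2[of _ _ _ _ "(*)"] mon_eval_cong) auto

text \<open>The degree function \<open>d\<close> is arbitrary because several are used: the weight of a monomial, its
  value in \<open>\<rat>^A\<close>, and the predicate that its variables belong to a given simplex.\<close>

definition hpart :: "('a \<Rightarrow> 'd) \<Rightarrow> 'd \<Rightarrow> ('a \<Rightarrow>\<^sub>0 'b::zero) \<Rightarrow> ('a \<Rightarrow>\<^sub>0 'b)" where
  "hpart d a p = Poly_Mapping.mapp (\<lambda>\<alpha> c. if d \<alpha> = a then c else 0) p"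

lemma lookup_hpart: "lookup (hpart d a p) \<alpha> = (if d \<alpha> = a then lookup p \<alpha> else 0)"
  by (auto simp: hpart_def lookup_mapp when_def in_keys_iff)

lemma keys_hpart: "keys (hpart d a p) = {\<alpha> \<in> keys p. d \<alpha> = a}"
  by (auto simp: in_keys_iff lookup_hpart split: if_splits)

lemma hpart_add:
  fixes p :: "'a \<Rightarrow>\<^sub>0 'b::monoid_add"
  shows "hpart d a (p + q) = hpart d a p + hpart d a q"
  by (rule poly_mapping_eqI) (simp add: lookup_hpart lookup_add)

lemma hpart_0 [simp]: "hpart d a 0 = 0"
  by (rule poly_mapping_eqI) (simp add: lookup_hpart)

lemma hpart_sum:
  fixes F :: "'i \<Rightarrow> 'a \<Rightarrow>\<^sub>0 'b::comm_monoid_add"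
  shows "hpart d a (\<Sum>i\<in>A. F i) = (\<Sum>i\<in>A. hpart d a (F i))"
  by (induction A rule: infinite_finite_induct) (auto simp: hpart_add)

lemma hpart_eq_self: "(\<And>\<alpha>. \<alpha> \<in> keys p \<Longrightarrow> d \<alpha> = a) \<Longrightarrow> hpart d a p = p"
  by (rule poly_mapping_eqI) (auto simp: lookup_hpart in_keys_iff)

lemma hpart_eq_0: "(\<And>\<alpha>. \<alpha> \<in> keys p \<Longrightarrow> d \<alpha> \<noteq> a) \<Longrightarrow> hpart d a p = 0"
  by (rule poly_mapping_eqI) (auto simp: lookup_hpart in_keys_iff)

lemma hpart_single: "hpart d a (single \<alpha> c) = (if d \<alpha> = a then single \<alpha> c else 0)"
  by (rule poly_mapping_eqI) (auto simp: lookup_hpart lookup_single when_def)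

lemma sum_hpart:
  fixes p :: "'a \<Rightarrow>\<^sub>0 'b::comm_monoid_add"
  assumes "finite A" "d ` keys p \<subseteq> A"
  shows "p = (\<Sum>a\<in>A. hpart d a p)"
  by (rule poly_mapping_eqI)
    (use assms in \<open>auto simp: lookup_sum lookup_hpart sum.delta in_keys_iff image_subset_iff\<close>)

lemma hpart_mult:
  fixes p q :: "'a::comm_monoid_add \<Rightarrow>\<^sub>0 'b::comm_semiring_0" and d :: "'a \<Rightarrow> 'd::ab_semigroup_add"
  assumes add: "\<And>\<alpha> \<beta>. d (\<alpha> + \<beta>) = d \<alpha> + d \<beta>"
    and A: "finite A" "d ` keys p \<subseteq> A" and B: "finite B" "d ` keys q \<subseteq> B"
  shows "hpart d c (p * q) =
    (\<Sum>(a, b)\<in>{(a, b). a \<in> A \<and> b \<in> B \<and> a + b = c}. hpart d a p * hpart d b q)"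
proof -
  have part: "hpart d c (hpart d a p * hpart d b q) =
      (if a + b = c then hpart d a p * hpart d b q else 0)" for a b
  proof -
    have "d \<gamma> = a + b" if "\<gamma> \<in> keys (hpart d a p * hpart d b q)" for \<gamma>
      using keys_mult[of "hpart d a p" "hpart d b q"] that by (auto simp: keys_hpart add)
    then show ?thesis by (auto intro!: hpart_eq_self hpart_eq_0)
  qed
  have "p * q = (\<Sum>a\<in>A. hpart d a p) * (\<Sum>b\<in>B. hpart d b q)"
    using sum_hpart[OF A] sum_hpart[OF B] by simp
  also have "\<dots> = (\<Sum>(a, b)\<in>A \<times> B. hpart d a p * hpart d b q)"
    by (simp add: sum_product sum.cartesian_product)
  finally have "hpart d c (p * q) =
      (\<Sum>(a, b)\<in>A \<times> B. if a + b = c then hpart d a p * hpart d b q else 0)"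
    by (simp add: hpart_sum part case_prod_unfold)
  also have "\<dots> = (\<Sum>(a, b)\<in>{(a, b). a \<in> A \<and> b \<in> B \<and> a + b = c}. hpart d a p * hpart d b q)"
    using A B by (intro sum.mono_neutral_cong_right) (auto split: if_splits)
  finally show ?thesis .
qed


section \<open>The polynomial rings on a set of variables\<close>

lemma mpoly_ring_sel [simp]:
  "mult (mpoly_ring I) = (*)" "one (mpoly_ring I) = 1"
  "zero (mpoly_ring I) = 0" "add (mpoly_ring I) = (+)"
  by (simp_all add: mpoly_ring_def)

lemma carrier_mpoly_ring:
  "p \<in> carrier (mpoly_ring I) \<longleftrightarrow> (\<forall>\<alpha>\<in>keys p. keys \<alpha> \<subseteq> I)"
  by (simp add: mpoly_ring_def)

lemma carrier_mpoly_ring_mono: "I \<subseteq> J \<Longrightarrow> carrier (mpoly_ring I) \<subseteq> carrier (mpoly_ring J)"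
  by (force simp: carrier_mpoly_ring)

lemma mpoly_ring_add_closed:
  "p \<in> carrier (mpoly_ring I) \<Longrightarrow> q \<in> carrier (mpoly_ring I) \<Longrightarrow> p + q \<in> carrier (mpoly_ring I)"
  using keys_add[of p q] by (fastforce simp: carrier_mpoly_ring)

lemma mpoly_ring_uminus_closed:
  "p \<in> carrier (mpoly_ring I) \<Longrightarrow> - p \<in> carrier (mpoly_ring I)"
  by (simp add: carrier_mpoly_ring in_keys_iff)

lemma mpoly_ring_diff_closed:
  "p \<in> carrier (mpoly_ring I) \<Longrightarrow> q \<in> carrier (mpoly_ring I) \<Longrightarrow> p - q \<in> carrier (mpoly_ring I)"
  using mpoly_ring_add_closed[of p I "- q"] mpoly_ring_uminus_closed by fastforce

lemma mpoly_ring_mult_closed: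
  assumes "p \<in> carrier (mpoly_ring I)" "q \<in> carrier (mpoly_ring I)"
  shows "p * q \<in> carrier (mpoly_ring I)"
  unfolding carrier_mpoly_ring
proof
  fix \<gamma> assume "\<gamma> \<in> keys (p * q)"
  then obtain \<alpha> \<beta> where "\<gamma> = \<alpha> + \<beta>" "\<alpha> \<in> keys p" "\<beta> \<in> keys q"
    using keys_mult[of p q] by blast
  then show "keys \<gamma> \<subseteq> I"
    using keys_add[of \<alpha> \<beta>] assms by (fastforce simp: carrier_mpoly_ring)
qed

lemma mpoly_ring_0_closed [simp]: "0 \<in> carrier (mpoly_ring I)"
  and mpoly_ring_1_closed [simp]: "1 \<in> carrier (mpoly_ring I)"
  by (simp_all add: carrier_mpoly_ring)

lemma mpoly_ring_single_closed: "keys \<alpha> \<subseteq> I \<Longrightarrow> single \<alpha> c \<in> carrier (mpoly_ring I)"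
  by (simp add: carrier_mpoly_ring)

lemma mpoly_ring_hpart_closed:
  "p \<in> carrier (mpoly_ring I) \<Longrightarrow> hpart d a p \<in> carrier (mpoly_ring I)"
  by (simp add: carrier_mpoly_ring keys_hpart)

lemma mpoly_ring_sum_closed:
  "(\<And>i. i \<in> A \<Longrightarrow> F i \<in> carrier (mpoly_ring I)) \<Longrightarrow> (\<Sum>i\<in>A. F i) \<in> carrier (mpoly_ring I)"
  by (induction A rule: infinite_finite_induct) (auto simp: mpoly_ring_add_closed)

lemma cring_mpoly_ring: "cring (mpoly_ring I)"
proof (rule cringI)
  show "abelian_group (mpoly_ring I)"
  proof (rule abelian_groupI)
    fix p assume "p \<in> carrier (mpoly_ring I)"
    then show "\<exists>q\<in>carrier (mpoly_ring I). q \<oplus>\<^bsub>mpoly_ring I\<^esub> p = \<zero>\<^bsub>mpoly_ring I\<^esub>"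
      by (intro bexI[of _ "- p"]) (auto intro: mpoly_ring_uminus_closed)
  qed (auto simp: mpoly_ring_add_closed algebra_simps)
  show "comm_monoid (mpoly_ring I)"
    by (rule comm_monoidI) (auto simp: mpoly_ring_mult_closed algebra_simps)
qed (auto simp: algebra_simps)

lemma mpoly_ring_nat_pow: "p [^]\<^bsub>mpoly_ring I\<^esub> (k::nat) = p ^ k"
  by (induction k) (auto simp: nat_pow_def algebra_simps)

lemma mpoly_ring_a_inv:
  assumes "p \<in> carrier (mpoly_ring I)"
  shows "\<ominus>\<^bsub>mpoly_ring I\<^esub> p = - p"
proof -
  interpret cring "mpoly_ring I" by (rule cring_mpoly_ring)
  show ?thesis
    by (rule minus_equality) (use assms mpoly_ring_uminus_closed in auto)
qed

lemma ideal_mpoly_ringI: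
  assumes sub: "J \<subseteq> carrier (mpoly_ring I)" and 0: "0 \<in> J"
    and add: "\<And>p q. p \<in> J \<Longrightarrow> q \<in> J \<Longrightarrow> p + q \<in> J"
    and mult: "\<And>p q. p \<in> J \<Longrightarrow> q \<in> carrier (mpoly_ring I) \<Longrightarrow> q * p \<in> J"
  shows "ideal J (mpoly_ring I)"
proof -
  interpret cring "mpoly_ring I" by (rule cring_mpoly_ring)
  have neg: "- p \<in> J" if "p \<in> J" for p
    using mult[OF that mpoly_ring_uminus_closed[OF mpoly_ring_1_closed]] by simp
  show ?thesis
  proof (rule idealI)
    show "ring (mpoly_ring I)" by (rule ring_axioms)
    show "subgroup J (add_monoid (mpoly_ring I))"
    proof (rule subgroup.intro)
      fix x assume "x \<in> J"
      then have "\<ominus>\<^bsub>mpoly_ring I\<^esub> x \<in> J"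
        using sub by (auto simp: mpoly_ring_a_inv neg)
      then show "inv\<^bsub>add_monoid (mpoly_ring I)\<^esub> x \<in> J"
        by (simp add: a_inv_def)
    qed (use sub 0 add in auto)
  qed (use mult in \<open>auto simp: mult.commute\<close>)
qed


section \<open>Weights and characters\<close>

text \<open>The variable \<open>s\<close> stands for the basis function \<open>f_s\<close>, so \<open>x^\<alpha>\<close> stands for \<open>f_(wt \<alpha>)\<close>.\<close>

definition wt :: "'n::finite mon \<Rightarrow> 'n wt" where
  "wt \<alpha> = (\<Sum>s\<in>keys \<alpha>. int (lookup \<alpha> s) * fst s, \<Sum>s\<in>keys \<alpha>. of_nat (lookup \<alpha> s) *s snd s)"

lemma wt_add: "wt (\<alpha> + \<beta>) = wt \<alpha> + wt \<beta>"
proof -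
  have "fst (wt (\<alpha> + \<beta>)) = fst (wt \<alpha>) + fst (wt \<beta>)"
    unfolding wt_def fst_conv by (rule setsum_keys_plus_distrib) (auto simp: algebra_simps)
  moreover have "snd (wt (\<alpha> + \<beta>)) = snd (wt \<alpha>) + snd (wt \<beta>)"
    unfolding wt_def snd_conv
    by (rule setsum_keys_plus_distrib) (auto simp: algebra_simps vec.scale_left_distrib)
  ultimately show ?thesis by (simp add: prod_eq_iff)
qed

lemma wt_0 [simp]: "wt 0 = 0"
  by (simp add: wt_def zero_prod_def)

lemma wt_single: "wt (single s n) = (int n * fst s, of_nat n *s snd s)"
  by (simp add: wt_def)

lemma wt_single_1 [simp]: "wt (single s 1) = s" "wt (single s (Suc 0)) = s"
  by (simp_all add: wt_single)

lemma wt_sum: "wt (\<Sum>i\<in>A. F i) = (\<Sum>i\<in>A. wt (F i))"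
  by (induction A rule: infinite_finite_induct) (auto simp: wt_add)

text \<open>The coefficient of \<open>f_s\<close> in the function that \<open>p\<close> defines on the cone.\<close>

definition wcoeff :: "('n::finite, 'k::field) mpoly \<Rightarrow> 'n wt \<Rightarrow> 'k" where
  "wcoeff p s = mpoly_eval (\<lambda>_. 1) (hpart wt s p)"

lemma mon_eval_one [simp]: "mon_eval (\<lambda>_. 1) \<alpha> = 1"
  by (simp add: mon_eval_def)

lemma wcoeff_alt: "wcoeff p s = (\<Sum>\<alpha>\<in>{\<alpha> \<in> keys p. wt \<alpha> = s}. lookup p \<alpha>)"
  by (simp add: wcoeff_def mpoly_eval_mon_eval keys_hpart lookup_hpart)

lemma wcoeff_add: "wcoeff (p + q) s = wcoeff p s + wcoeff q s"
  by (simp add: wcoeff_def hpart_add mpoly_eval_add)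

lemma wcoeff_0 [simp]: "wcoeff 0 s = 0"
  by (simp add: wcoeff_def)

lemma wcoeff_single: "wcoeff (single \<alpha> c) s = (if wt \<alpha> = s then c else 0)"
  by (simp add: wcoeff_def hpart_single)

lemma wcoeff_uminus: "wcoeff (- p) s = - wcoeff p s"
  by (metis add.inverse_unique add.right_inverse wcoeff_0 wcoeff_add)

lemma wcoeff_diff: "wcoeff (p - q) s = wcoeff p s - wcoeff q s"
  using wcoeff_add[of p "- q"] by (simp add: wcoeff_uminus)

lemma wcoeff_sum: "wcoeff (\<Sum>i\<in>A. F i) s = (\<Sum>i\<in>A. wcoeff (F i) s)"
  by (induction A rule: infinite_finite_induct) (auto simp: wcoeff_add)

lemma wcoeff_nonzero_imp: "wcoeff p s \<noteq> 0 \<Longrightarrow> s \<in> wt ` keys p"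
  unfolding wcoeff_alt by (force dest: sum.not_neutral_contains_not_neutral)

lemma wcoeff_hpart_wt: "wcoeff (hpart wt s p) s' = (if s' = s then wcoeff p s else 0)"
proof -
  have "hpart wt s' (hpart wt s p) = (if s' = s then hpart wt s p else 0)"
    by (rule poly_mapping_eqI) (auto simp: lookup_hpart)
  then show ?thesis by (simp add: wcoeff_def)
qed

lemma finite_wcoeff: "finite {s. wcoeff p s \<noteq> 0}"
  by (rule finite_subset[of _ "wt ` keys p"]) (auto dest: wcoeff_nonzero_imp)

lemma wcoeff_mult:
  assumes "finite A" "wt ` keys p \<subseteq> A" "finite B" "wt ` keys q \<subseteq> B"
  shows "wcoeff (p * q) s =
    (\<Sum>(a, b)\<in>{(a, b). a \<in> A \<and> b \<in> B \<and> a + b = s}. wcoeff p a * wcoeff q b)"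
  unfolding wcoeff_def hpart_mult[OF wt_add assms]
  by (simp add: mpoly_eval_sum mpoly_eval_mult case_prod_unfold)

lemma wcoeff_mult_nonzero:
  assumes "wcoeff (p * q) s \<noteq> 0"
  obtains a b where "s = a + b" "wcoeff p a \<noteq> 0" "wcoeff q b \<noteq> 0"
proof -
  have "(\<Sum>(a, b)\<in>{(a, b). a \<in> wt ` keys p \<and> b \<in> wt ` keys q \<and> a + b = s}.
      wcoeff p a * wcoeff q b) \<noteq> 0"
    using assms wcoeff_mult[of "wt ` keys p" p "wt ` keys q" q s] by simp
  then have "\<exists>x\<in>{(a, b). a \<in> wt ` keys p \<and> b \<in> wt ` keys q \<and> a + b = s}.
      (case x of (a, b) \<Rightarrow> wcoeff p a * wcoeff q b) \<noteq> 0"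
    by (meson sum.neutral)
  then show ?thesis using that by (auto simp: case_prod_unfold)
qed

lemma mpoly_eval_by_weight:
  assumes F: "\<And>\<alpha>. \<alpha> \<in> keys p \<Longrightarrow> mon_eval a \<alpha> = F (wt \<alpha>)"
    and A: "finite A" "{s. wcoeff p s \<noteq> 0} \<subseteq> A"
  shows "mpoly_eval a p = (\<Sum>s\<in>A. wcoeff p s * F s)"
proof -
  have "mpoly_eval a p = (\<Sum>\<alpha>\<in>keys p. lookup p \<alpha> * F (wt \<alpha>))"
    by (simp add: mpoly_eval_mon_eval F)
  also have "\<dots> = (\<Sum>s\<in>wt ` keys p. \<Sum>\<alpha>\<in>{\<alpha> \<in> keys p. wt \<alpha> = s}. lookup p \<alpha> * F (wt \<alpha>))"
    by (rule sum.image_gen) simp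
  also have "\<dots> = (\<Sum>s\<in>wt ` keys p. wcoeff p s * F s)"
    by (simp add: wcoeff_alt sum_distrib_right)
  also have "\<dots> = (\<Sum>s\<in>{s. wcoeff p s \<noteq> 0}. wcoeff p s * F s)"
    by (rule sum.mono_neutral_right) (auto dest: wcoeff_nonzero_imp)
  also have "\<dots> = (\<Sum>s\<in>A. wcoeff p s * F s)"
    by (rule sum.mono_neutral_left) (use A in auto)
  finally show ?thesis .
qed

text \<open>Dedekind's argument: evaluating at \<open>m y x\<close> and subtracting \<open>\<phi> s0 y\<close> times the relation
  removes the character \<open>s0\<close>.\<close>

lemma Dedekind_independence:
  fixes \<phi> :: "'s \<Rightarrow> 'a \<Rightarrow> 'k::field"
  assumes closed: "\<And>x y. x \<in> T \<Longrightarrow> y \<in> T \<Longrightarrow> m x y \<in> T"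
    and mult: "\<And>s x y. x \<in> T \<Longrightarrow> y \<in> T \<Longrightarrow> \<phi> s (m x y) = \<phi> s x * \<phi> s y"
    and dist: "\<And>s s'. s \<noteq> s' \<Longrightarrow> \<exists>x\<in>T. \<phi> s x \<noteq> \<phi> s' x"
    and e: "e \<in> T" "\<And>s. \<phi> s e \<noteq> 0"
    and "finite W" and "\<And>x. x \<in> T \<Longrightarrow> (\<Sum>s\<in>W. b s * \<phi> s x) = 0"
  shows "\<forall>s\<in>W. b s = 0"
  using assms(6,7)
proof (induction W arbitrary: b rule: finite_induct)
  case (insert s0 W)
  have W0: "b s = 0" if s: "s \<in> W" for s
  proof -
    have "s \<noteq> s0" using s insert.hyps by auto
    then obtain y where y: "y \<in> T" "\<phi> s y \<noteq> \<phi> s0 y" using dist by blast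
    have rel: "(\<Sum>s\<in>W. (b s * (\<phi> s y - \<phi> s0 y)) * \<phi> s x) = 0" if x: "x \<in> T" for x
    proof -
      have "0 = (\<Sum>s\<in>insert s0 W. b s * \<phi> s (m y x)) - \<phi> s0 y * (\<Sum>s\<in>insert s0 W. b s * \<phi> s x)"
        using insert.prems[OF x] insert.prems[OF closed[OF y(1) x]] by simp
      also have "\<dots> = (\<Sum>s\<in>insert s0 W. (b s * (\<phi> s y - \<phi> s0 y)) * \<phi> s x)"
        unfolding sum_distrib_left sum_subtractf[symmetric]
        by (rule sum.cong) (auto simp: mult[OF y(1) x] algebra_simps)
      also have "\<dots> = (\<Sum>s\<in>W. (b s * (\<phi> s y - \<phi> s0 y)) * \<phi> s x)"
        using insert.hyps by simp
      finally show ?thesis by simp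
    qed
    have "\<forall>s\<in>W. b s * (\<phi> s y - \<phi> s0 y) = 0"
      by (rule insert.IH[of "\<lambda>s. b s * (\<phi> s y - \<phi> s0 y)"]) (rule rel)
    then have "b s * (\<phi> s y - \<phi> s0 y) = 0" using s by blast
    with y show ?thesis by simp
  qed
  have "b s0 * \<phi> s0 e = 0"
    using insert.prems[OF e(1)] insert.hyps W0 by simp
  with e W0 show ?case by simp
qed simp

text \<open>The character of weight \<open>s\<close> of the extended torus.\<close>

definition tor :: "'k::field \<Rightarrow> 'k ^ 'n::finite \<Rightarrow> 'n wt \<Rightarrow> 'k" where
  "tor c t s = c powi fst s * character (snd s) t"

lemma character_add:
  assumes "t \<in> torus"
  shows "character (x + y) t = character x t * character y t"
  using assms by (simp add: character_def torus_def power_int_add prod.distrib)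

lemma character_nonzero: "t \<in> torus \<Longrightarrow> character x t \<noteq> 0"
  by (simp add: character_def torus_def)

lemma character_0 [simp]: "character 0 t = 1"
  by (simp add: character_def)

lemma character_minus: "character (- x) t = inverse (character x t)"
  by (simp add: character_def power_int_minus prod_inversef[symmetric] comp_def)

lemma character_mult: "character x (\<chi> i. t $ i * u $ i) = character x t * character x u"
  by (simp add: character_def power_int_mult_distrib prod.distrib)

lemma character_inverse: "character x (\<chi> i. inverse (t $ i)) = inverse (character x t)"
  by (simp add: character_def power_int_inverse prod_inversef[symmetric] comp_def)

lemma tor_add: "c \<noteq> 0 \<Longrightarrow> t \<in> torus \<Longrightarrow> tor c t (s + s') = tor c t s * tor c t s'"
  by (simp add: tor_def character_add power_int_add)

lemma tor_0 [simp]: "tor c t 0 = 1"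
  by (simp add: tor_def)

lemma tor_one [simp]: "tor 1 (\<chi> i. 1) s = 1"
  by (simp add: tor_def character_def)

lemma tor_mult: "tor (c * d) (\<chi> i. t $ i * u $ i) s = tor c t s * tor d u s"
  by (simp add: tor_def character_mult power_int_mult_distrib)

lemma tor_nat:
  "c \<noteq> 0 \<Longrightarrow> t \<in> torus \<Longrightarrow> tor c t (int n * fst s, of_nat n *s snd s) = tor c t s ^ n"
proof (induction n)
  case (Suc n)
  have "(int (Suc n) * fst s, of_nat (Suc n) *s snd s) = s + (int n * fst s, of_nat n *s snd s)"
    by (simp add: prod_eq_iff algebra_simps vec_eq_iff)
  then show ?case using Suc.IH[OF Suc.prems] tor_add[OF Suc.prems] by (metis power_Suc)
qed (simp flip: zero_prod_def)

lemma tor_wt: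
  assumes ct: "c \<noteq> 0" "t \<in> torus"
  shows "tor c t (wt \<alpha>) = mon_eval (tor c t) \<alpha>"
proof -
  have "tor c t (\<Sum>s\<in>A. F s) = (\<Prod>s\<in>A. tor c t (F s))" for A and F :: "'b wt \<Rightarrow> 'b wt"
    by (induction A rule: infinite_finite_induct) (auto simp: tor_add[OF ct])
  moreover have "wt \<alpha> = (\<Sum>s\<in>keys \<alpha>. (int (lookup \<alpha> s) * fst s, of_nat (lookup \<alpha> s) *s snd s))"
    by (simp add: wt_def prod_eq_iff fst_sum snd_sum)
  ultimately show ?thesis by (simp add: mon_eval_def tor_nat[OF ct])
qed

text \<open>In characteristic zero the powers of 2 tell the characters apart.\<close>

lemma power_int_2_inj:
  assumes "(2::'k::field_char_0) powi a = 2 powi b"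
  shows "a = b"
proof -
  have k: "k = 0" if "(2::'k) powi k = 1" for k :: int
  proof (cases k rule: int_cases2)
    case (nonneg n)
    then have "(of_nat (2 ^ n) :: 'k) = of_nat 1" using that by simp
    then have "(2::nat) ^ n = 1" by (simp only: of_nat_eq_iff)
    then show ?thesis using nonneg by simp
  next
    case (nonpos n)
    then have "(of_nat (2 ^ n) :: 'k) = of_nat 1" using that by (simp add: power_int_minus)
    then have "(2::nat) ^ n = 1" by (simp only: of_nat_eq_iff)
    then show ?thesis using nonpos by simp
  qed
  have "(2::'k) powi (a - b) = 1"
    using assms by (simp add: power_int_diff)
  then show ?thesis using k by fastforce
qed

lemma tor_separates:
  assumes "s \<noteq> s'"
  shows "\<exists>c (t :: 'k::field_char_0 ^ 'n::finite). c \<noteq> 0 \<and> t \<in> torus \<and> tor c t s \<noteq> tor c t s'"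
proof (cases "fst s = fst s'")
  case False
  then have "tor (2::'k) (\<chi> i. 1) s \<noteq> tor 2 (\<chi> i. 1) s'"
    using power_int_2_inj[where 'k = 'k] by (auto simp: tor_def character_def)
  then show ?thesis by (intro exI[of _ 2] exI[of _ "\<chi> i. 1"]) (auto simp: torus_def)
next
  case True
  then obtain j where j: "snd s $ j \<noteq> snd s' $ j"
    using assms by (auto simp: prod_eq_iff vec_eq_iff)
  have "character x (\<chi> i. if i = j then (2::'k) else 1) = 2 powi (x $ j)" for x
    by (simp add: character_def if_distrib[of "\<lambda>z. z powi _"] prod.delta cong: if_cong)
  then have "tor 1 (\<chi> i. if i = j then (2::'k) else 1) s \<noteq> tor 1 (\<chi> i. if i = j then 2 else 1) s'"
    using power_int_2_inj[where 'k = 'k] j by (auto simp: tor_def)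
  then show ?thesis
    by (intro exI[of _ 1] exI[of _ "\<chi> i. if i = j then 2 else 1"]) (auto simp: torus_def)
qed

lemma tor_independent:
  fixes b :: "'n::finite wt \<Rightarrow> 'k::field_char_0"
  assumes "finite W"
    and "\<And>c t. c \<noteq> 0 \<Longrightarrow> t \<in> torus \<Longrightarrow> (\<Sum>s\<in>W. b s * tor c t s) = 0"
  shows "\<forall>s\<in>W. b s = 0"
proof (rule Dedekind_independence[where T = "{(c, t). c \<noteq> 0 \<and> t \<in> torus}"
      and m = "\<lambda>(c, t) (d, u). (c * d, \<chi> i. t $ i * u $ i)" and \<phi> = "\<lambda>s (c, t). tor c t s"
      and e = "(1, \<chi> i. 1)"])
  show "\<exists>x\<in>{(c :: 'k, t). c \<noteq> 0 \<and> t \<in> torus}. (\<lambda>(c, t). tor c t s) x \<noteq> (\<lambda>(c, t). tor c t s') x"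
    if "s \<noteq> s'" for s s' :: "'n wt"
    using tor_separates[OF that, where 'k = 'k] by fastforce
qed (use assms in \<open>auto simp: torus_def tor_mult\<close>)

lemma mpoly_eval_tor:
  assumes "c \<noteq> 0" "t \<in> torus" "finite A" "{s. wcoeff p s \<noteq> 0} \<subseteq> A"
  shows "mpoly_eval (tor c t) p = (\<Sum>s\<in>A. wcoeff p s * tor c t s)"
  by (rule mpoly_eval_by_weight) (use assms in \<open>auto simp: tor_wt\<close>)

text \<open>On the extended torus the monomials of weight \<open>s\<close> all restrict to the character \<open>s\<close>, and
  distinct characters are linearly independent.\<close>

lemma wcoeff_eq_0_iff_tor:
  fixes p :: "('n::finite, 'k::field_char_0) mpoly"
  shows "(\<forall>s. wcoeff p s = 0) \<longleftrightarrow> (\<forall>c t. c \<noteq> 0 \<longrightarrow> t \<in> torus \<longrightarrow> mpoly_eval (tor c t) p = 0)"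
proof
  assume "\<forall>c t. c \<noteq> 0 \<longrightarrow> t \<in> torus \<longrightarrow> mpoly_eval (tor c t) p = 0"
  then have "\<forall>s\<in>{s. wcoeff p s \<noteq> 0}. wcoeff p s = 0"
    by (intro tor_independent) (auto simp: finite_wcoeff mpoly_eval_tor[OF _ _ finite_wcoeff order_refl])
  then show "\<forall>s. wcoeff p s = 0" by blast
qed (use mpoly_eval_tor[of _ _ "{}" p] in auto)


section \<open>The affine cone of a toric variety\<close>

text \<open>The coordinate ring and the graded ring both inherit the ring axioms from a polynomial ring
  that maps onto them. The image of zero is prescribed because the \<open>zero\<close> field of the target is
  not determined by its addition before the axioms are known.\<close>

lemma cring_surj_hom:
  assumes R: "cring R" and h: "h \<in> ring_hom R S" and surj: "h ` carrier R = carrier S"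
    and zero: "h \<zero>\<^bsub>R\<^esub> = \<zero>\<^bsub>S\<^esub>"
  shows "cring S"
proof -
  interpret R: cring R by (rule R)
  have "ring (S \<lparr>carrier := h ` carrier R, zero := h \<zero>\<^bsub>R\<^esub>\<rparr>)"
    by (rule R.ring_hom_imp_img_ring[OF h])
  then have S: "ring S" unfolding surj zero by simp
  have comm: "x \<otimes>\<^bsub>S\<^esub> y = y \<otimes>\<^bsub>S\<^esub> x" if xy: "x \<in> carrier S" "y \<in> carrier S" for x y
  proof -
    obtain a b where "a \<in> carrier R" "b \<in> carrier R" "x = h a" "y = h b"
      using xy unfolding surj[symmetric] by blast
    then show ?thesis
      using ring_hom_mult[OF h, of a b] ring_hom_mult[OF h, of b a] R.m_comm[of a b] by simp
  qed
  interpret S: ring S by (rule S)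
  show ?thesis
    by (intro cring.intro S comm_monoid.intro S.monoid_axioms comm_monoid_axioms.intro comm)
qed

locale character_set =
  fixes L :: "'n::finite chr set"
  assumes finite_L: "finite L" and nonempty_L: "L \<noteq> {}"
begin

abbreviation "S \<equiv> cone_monoid L"

text \<open>The orbit of the extended torus through the point with all coordinates 1.\<close>

definition tpt :: "'k::field \<Rightarrow> 'k ^ 'n \<Rightarrow> ('n, 'k) vec_V" where
  "tpt c t = (\<lambda>x. if x \<in> L then c * character x t else 0)"

lemma tor_coord: "tor c t (1, x) = c * character x t"
  by (simp add: tor_def)

lemma poly_fun_tpt:
  assumes "p \<in> carrier (mpoly_ring (coord_vars L))"
  shows "poly_fun p (tpt c t) = mpoly_eval (tor c t) p"
  unfolding poly_fun_def
proof (rule mpoly_eval_cong)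
  fix \<alpha> i assume "\<alpha> \<in> keys p" "i \<in> keys \<alpha>"
  then have "i \<in> coord_vars L" using assms by (auto simp: carrier_mpoly_ring)
  then show "tpt c t (snd i) = tor c t i" by (auto simp: tpt_def tor_coord)
qed

lemma tpt_in_vec_space: "tpt c t \<in> vec_space L"
  by (simp add: tpt_def vec_space_def)

lemma tpt_nonzero: "c \<noteq> 0 \<Longrightarrow> t \<in> torus \<Longrightarrow> tpt c t \<noteq> (\<lambda>x. 0)"
  using nonempty_L by (auto simp: tpt_def fun_eq_iff character_nonzero)

lemma torus_orbit_tpt: "torus_orbit L = {proj_pt (tpt 1 t) |t. t \<in> torus}"
  by (simp add: torus_orbit_def tpt_def cong: if_cong)

lemma proj_pt_tpt: "proj_pt (tpt 1 t) = {tpt c t |c. c \<noteq> 0}"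
proof -
  have "(\<lambda>x. c * tpt 1 t x) = tpt c t" for c
    by (auto simp: tpt_def)
  then show ?thesis by (simp add: proj_pt_def)
qed

lemma fst_wt_coord:
  assumes "keys \<alpha> \<subseteq> coord_vars L"
  shows "fst (wt \<alpha>) = int (\<Sum>i\<in>keys \<alpha>. lookup \<alpha> i)"
proof -
  have "fst (wt \<alpha>) = (\<Sum>i\<in>keys \<alpha>. int (lookup \<alpha> i))"
    unfolding wt_def fst_conv by (rule sum.cong) (use assms in auto)
  then show ?thesis by simp
qed

lemma wt_eq_0_coord:
  assumes "keys \<alpha> \<subseteq> coord_vars L" "wt \<alpha> = 0"
  shows "\<alpha> = 0"
proof -
  have "int (\<Sum>i\<in>keys \<alpha>. lookup \<alpha> i) = 0"
    unfolding fst_wt_coord[OF assms(1), symmetric] assms(2) by simp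
  then have "\<forall>i\<in>keys \<alpha>. lookup \<alpha> i = 0" by (simp only: of_nat_eq_0_iff) simp
  then have "i \<notin> keys \<alpha>" for i by (metis in_keys_iff)
  then have "keys \<alpha> = {}" by blast
  then show ?thesis by simp
qed

lemma homogeneous_weight_part:
  assumes "p \<in> carrier (mpoly_ring (coord_vars L))"
  shows "homogeneous (nat (fst s)) (hpart wt s p)"
  using assms by (auto simp: carrier_mpoly_ring homogeneous_def keys_hpart fst_wt_coord simp del: of_nat_sum)

lemma poly_fun_weight_part_ext_act:
  assumes p: "p \<in> carrier (mpoly_ring (coord_vars L))" and ct: "c \<noteq> 0" "t \<in> torus"
  shows "poly_fun (hpart wt s p) (ext_act c t v) = tor c t s * poly_fun (hpart wt s p) v"
proof -
  have "mon_eval (\<lambda>i. ext_act c t v (snd i)) \<alpha> = tor c t s * mon_eval (\<lambda>i. v (snd i)) \<alpha>"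
    if \<alpha>: "\<alpha> \<in> keys (hpart wt s p)" for \<alpha>
  proof -
    have sub: "keys \<alpha> \<subseteq> coord_vars L" and wt: "wt \<alpha> = s"
      using \<alpha> p by (auto simp: keys_hpart carrier_mpoly_ring)
    have "mon_eval (\<lambda>i. ext_act c t v (snd i)) \<alpha> = mon_eval (\<lambda>i. tor c t i * v (snd i)) \<alpha>"
      by (rule mon_eval_cong) (use sub in \<open>auto simp: ext_act_def tor_coord\<close>)
    also have "\<dots> = mon_eval (tor c t) \<alpha> * mon_eval (\<lambda>i. v (snd i)) \<alpha>"
      by (simp add: mon_eval_def power_mult_distrib prod.distrib)
    finally show ?thesis using tor_wt[OF ct, of \<alpha>] wt by simp
  qed
  then show ?thesis
    by (simp add: poly_fun_def mpoly_eval_mon_eval sum_distrib_left algebra_simps)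
qed

lemma poly_fun_sum_weight_parts:
  "poly_fun p v = (\<Sum>s\<in>wt ` keys p. poly_fun (hpart wt s p) v)"
  unfolding poly_fun_def mpoly_eval_sum[symmetric]
  using sum_hpart[of "wt ` keys p" wt p] by simp

text \<open>The vanishing ideal of the torus orbit, given by linear conditions on the coefficients.\<close>

definition toric_ideal :: "('n, 'k::field) mpoly set" where
  "toric_ideal = {p \<in> carrier (mpoly_ring (coord_vars L)). \<forall>s. wcoeff p s = 0}"

lemma toric_ideal_weight_part: "p \<in> toric_ideal \<Longrightarrow> hpart wt s p \<in> toric_ideal"
  by (auto simp: toric_ideal_def mpoly_ring_hpart_closed wcoeff_hpart_wt)

lemma proj_pt_refl: "v \<in> proj_pt v"
  unfolding proj_pt_def using zero_neq_one by (force intro: exI[of _ 1])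

text \<open>A homogeneous polynomial that vanishes on the orbit lies in the toric ideal, so every closed
  set containing the orbit contains the zero set of that ideal. Conversely this zero set is closed,
  because the ideal is spanned by its weight components, which are homogeneous.\<close>

lemma toric_variety_iff:
  fixes y :: "('n, 'k::field_char_0) vec_V set"
  shows "y \<in> toric_variety L \<longleftrightarrow>
    y \<in> proj_space L \<and> (\<forall>p\<in>toric_ideal. \<forall>v\<in>y. poly_fun p v = 0)"
proof
  let ?F = "{hpart wt s p |s p. p \<in> (toric_ideal :: ('n, 'k) mpoly set)}"
  have "zariski_closed L (proj_zeros L ?F)"
    unfolding zariski_closed_def
  proof (intro exI[of _ ?F] conjI refl ballI)
    show "?F \<subseteq> carrier (mpoly_ring (coord_vars L))"
      by (auto simp: toric_ideal_def mpoly_ring_hpart_closed)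
    show "\<exists>d. homogeneous d q" if "q \<in> ?F" for q
      using that homogeneous_weight_part by (force simp: toric_ideal_def)
  qed
  moreover have "torus_orbit L \<subseteq> proj_zeros L ?F"
  proof
    fix y :: "('n, 'k) vec_V set" assume "y \<in> torus_orbit L"
    then obtain t where t: "t \<in> torus" "y = proj_pt (tpt 1 t)"
      by (auto simp: torus_orbit_tpt)
    have "y \<in> proj_space L"
      unfolding t proj_space_def using tpt_nonzero[of 1 t] t tpt_in_vec_space by (intro imageI) simp
    moreover have "poly_fun q v = 0" if "q \<in> ?F" "v \<in> y" for q v
    proof -
      obtain c where c: "c \<noteq> 0" "v = tpt c t" using \<open>v \<in> y\<close> t proj_pt_tpt by blast
      have q: "q \<in> toric_ideal" using that toric_ideal_weight_part by blast
      then have "mpoly_eval (tor c t) q = 0"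
        using c t wcoeff_eq_0_iff_tor[of q] by (auto simp: toric_ideal_def)
      then show ?thesis using c q poly_fun_tpt[of q c t] by (auto simp: toric_ideal_def)
    qed
    ultimately show "y \<in> proj_zeros L ?F" by (auto simp: proj_zeros_def)
  qed
  ultimately have "toric_variety L \<subseteq> proj_zeros L ?F"
    unfolding toric_variety_def orbit_closure_def by (intro hull_minimal)
  moreover assume "y \<in> toric_variety L"
  ultimately have "y \<in> proj_zeros L ?F" by (rule subsetD)
  then have y: "y \<in> proj_space L" and 0: "\<And>p s v. p \<in> toric_ideal \<Longrightarrow> v \<in> y \<Longrightarrow> poly_fun (hpart wt s p) v = 0"
    by (auto simp: proj_zeros_def)
  have "poly_fun p v = 0" if "p \<in> toric_ideal" "v \<in> y" for p v
    unfolding poly_fun_sum_weight_parts[of p v] using 0[OF that] by simp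
  then show "y \<in> proj_space L \<and> (\<forall>p\<in>toric_ideal. \<forall>v\<in>y. poly_fun p v = 0)"
    by (intro conjI ballI y)
next
  assume y: "y \<in> proj_space L \<and> (\<forall>p\<in>toric_ideal. \<forall>v\<in>y. poly_fun p v = 0)"
  have "y \<in> Z" if Z: "zariski_closed L Z" "torus_orbit L \<subseteq> Z" for Z
  proof -
    obtain F where F: "F \<subseteq> carrier (mpoly_ring (coord_vars L))" "Z = proj_zeros L F"
      using Z by (auto simp: zariski_closed_def)
    have "p \<in> toric_ideal" if p: "p \<in> F" for p
    proof -
      have "mpoly_eval (tor c t) p = 0" if ct: "c \<noteq> 0" "t \<in> torus" for c t
      proof -
        have "proj_pt (tpt 1 t) \<in> proj_zeros L F"
          using ct Z F by (auto simp: torus_orbit_tpt)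
        then have "poly_fun p (tpt c t) = 0"
          using ct p by (auto simp: proj_zeros_def proj_pt_tpt)
        then show ?thesis using poly_fun_tpt[of p c t] F p by auto
      qed
      then show ?thesis using F p wcoeff_eq_0_iff_tor[of p] by (auto simp: toric_ideal_def)
    qed
    then show ?thesis using y F by (auto simp: proj_zeros_def)
  qed
  then show "y \<in> toric_variety L"
    by (auto simp: toric_variety_def orbit_closure_def hull_def)
qed

lemma toric_ideal_vanishes_ext_act:
  fixes v :: "('n, 'k::field_char_0) vec_V"
  assumes v: "\<forall>p\<in>toric_ideal. poly_fun p v = 0" and ct: "c \<noteq> 0" "t \<in> torus" and p: "p \<in> toric_ideal"
  shows "poly_fun p (ext_act c t v) = 0"
proof -
  have "poly_fun (hpart wt s p) (ext_act c t v) = 0" for s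
    using poly_fun_weight_part_ext_act[of p c t s v] ct v toric_ideal_weight_part[OF p] p
    by (auto simp: toric_ideal_def)
  then show ?thesis by (simp add: poly_fun_sum_weight_parts[of p])
qed

text \<open>The origin satisfies the equations as well: the only monomial of weight \<open>0\<close> is \<open>1\<close>, so the
  elements of the toric ideal have no constant term.\<close>

lemma affine_cone_iff:
  fixes v :: "('n, 'k::field_char_0) vec_V"
  shows "v \<in> affine_cone L \<longleftrightarrow> v \<in> vec_space L \<and> (\<forall>p\<in>toric_ideal. poly_fun p v = 0)"
proof (cases "v = (\<lambda>x. 0)")
  case True
  have "poly_fun p (\<lambda>x. 0) = 0" if p: "p \<in> toric_ideal" for p :: "('n, 'k) mpoly"
  proof -
    have mon: "mon_eval (\<lambda>_. 0 :: 'k) \<alpha> = (if \<alpha> = 0 then 1 else 0)" for \<alpha> :: "'n mon"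
    proof (cases "\<alpha> = 0")
      case False
      then obtain i where "i \<in> keys \<alpha>" by (metis all_not_in_conv keys_eq_empty)
      then show ?thesis using False by (auto simp: mon_eval_def in_keys_iff)
    qed simp
    have "{\<alpha> \<in> keys p. wt \<alpha> = 0} = (if 0 \<in> keys p then {0} else {})"
      using p wt_eq_0_coord by (auto simp: toric_ideal_def carrier_mpoly_ring)
    then have "lookup p 0 = 0"
      using p wcoeff_alt[of p 0] by (auto simp: toric_ideal_def in_keys_iff split: if_splits)
    then show ?thesis
      by (auto simp: poly_fun_def mpoly_eval_mon_eval mon intro!: sum.neutral)
  qed
  then show ?thesis using True by (auto simp: affine_cone_def vec_space_def)
next
  case False
  have "proj_pt v \<in> proj_space L" if "v \<in> vec_space L"
    using that False by (auto simp: proj_space_def)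
  moreover have "poly_fun p w = 0" if w: "w \<in> proj_pt v" and "\<forall>p\<in>toric_ideal. poly_fun p v = 0"
    "p \<in> toric_ideal" for w and p :: "('n, 'k) mpoly"
  proof -
    obtain c where "c \<noteq> 0" "w = ext_act c (\<chi> i. 1) v"
      using w by (auto simp: proj_pt_def ext_act_def character_def)
    then show ?thesis using toric_ideal_vanishes_ext_act[of v c "\<chi> i. 1" p] that by (auto simp: torus_def)
  qed
  ultimately show ?thesis
    using False proj_pt_refl[of v] by (auto simp: affine_cone_def toric_variety_iff Ball_def)
qed

lemma tpt_in_affine_cone:
  fixes t :: "'k::field_char_0 ^ 'n"
  assumes "c \<noteq> 0" "t \<in> torus"
  shows "tpt c t \<in> affine_cone L"
  unfolding affine_cone_iff
proof (intro conjI ballI tpt_in_vec_space)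
  fix p :: "('n, 'k) mpoly" assume "p \<in> toric_ideal"
  then show "poly_fun p (tpt c t) = 0"
    using assms wcoeff_eq_0_iff_tor[of p] poly_fun_tpt[of p c t] by (auto simp: toric_ideal_def)
qed

lemma ext_act_affine_cone:
  fixes t :: "'k::field_char_0 ^ 'n"
  assumes "c \<noteq> 0" "t \<in> torus" "v \<in> affine_cone L"
  shows "ext_act c t v \<in> affine_cone L"
  using assms toric_ideal_vanishes_ext_act
  by (auto simp: affine_cone_iff) (auto simp: vec_space_def ext_act_def)

lemma monomials_agree_on_cone:
  fixes v :: "('n, 'k::field_char_0) vec_V"
  assumes "keys \<alpha> \<subseteq> coord_vars L" "keys \<beta> \<subseteq> coord_vars L" "wt \<alpha> = wt \<beta>" "v \<in> affine_cone L"
  shows "mon_eval (\<lambda>i. v (snd i)) \<alpha> = mon_eval (\<lambda>i. v (snd i)) \<beta>"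
proof -
  have "single \<alpha> 1 - single \<beta> (1 :: 'k) \<in> toric_ideal"
    using assms
    by (auto simp: toric_ideal_def wcoeff_diff wcoeff_single mpoly_ring_diff_closed mpoly_ring_single_closed)
  then have "poly_fun (single \<alpha> 1 - single \<beta> (1 :: 'k)) v = 0"
    using assms affine_cone_iff by blast
  then show ?thesis by (simp add: poly_fun_def mpoly_eval_diff)
qed


section \<open>The basis of the coordinate ring\<close>

text \<open>Translates the exponent vectors used for \<open>cone_monoid\<close> and \<open>basis_fun\<close>, which are indexed by
  characters, into exponents of the variables \<open>(1,\<chi>)\<close>.\<close>

definition expo :: "('n chr \<Rightarrow> nat) \<Rightarrow> 'n mon" where
  "expo a = (\<Sum>x\<in>L. single (1, x) (a x))"

lemma lookup_expo: "lookup (expo a) i = (if i \<in> coord_vars L then a (snd i) else 0)"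
proof -
  have "lookup (expo a) i = (\<Sum>x\<in>L. if x = snd i then (if fst i = 1 then a x else 0) else 0)"
    by (auto simp: expo_def lookup_sum lookup_single when_def prod_eq_iff intro!: sum.cong)
  then show ?thesis using finite_L by (cases i) (auto simp: sum.delta)
qed

lemma keys_expo: "keys (expo a) \<subseteq> coord_vars L"
  by (auto simp: in_keys_iff lookup_expo split: if_splits)

lemma wt_expo: "wt (expo a) = (\<Sum>x\<in>L. int (a x), \<Sum>x\<in>L. of_nat (a x) *s x)"
  by (simp add: expo_def wt_sum wt_single prod_eq_iff fst_sum snd_sum)

lemma mon_eval_expo: "mon_eval (\<lambda>i. v (snd i)) (expo a) = (\<Prod>x\<in>L. v x ^ a x)"
proof -
  have "mon_eval (\<lambda>i. v (snd i)) (expo a) = (\<Prod>i\<in>coord_vars L. v (snd i) ^ lookup (expo a) i)"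
    by (rule mon_eval_superset) (use finite_L keys_expo in auto)
  also have "\<dots> = (\<Prod>i\<in>Pair (1::int) ` L. v (snd i) ^ a (snd i))"
    by (rule prod.cong) (auto simp: lookup_expo image_iff)
  also have "\<dots> = (\<Prod>x\<in>L. v x ^ a x)"
    by (subst prod.reindex) (auto simp: inj_on_def)
  finally show ?thesis .
qed

lemma expo_lookup: "keys \<alpha> \<subseteq> coord_vars L \<Longrightarrow> expo (\<lambda>x. lookup \<alpha> (1, x)) = \<alpha>"
proof (rule poly_mapping_eqI)
  fix i assume "keys \<alpha> \<subseteq> coord_vars L"
  then have "lookup \<alpha> i = 0" if "i \<notin> coord_vars L" using that by (metis in_keys_iff subsetD)
  then show "lookup (expo (\<lambda>x. lookup \<alpha> (1, x))) i = lookup \<alpha> i" by (cases i) (auto simp: lookup_expo)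
qed

lemma cone_monoid_wt: "S = wt ` {\<alpha>. keys \<alpha> \<subseteq> coord_vars L}"
proof -
  have "S = range (\<lambda>a. wt (expo a))"
    by (auto simp: cone_monoid_def wt_expo)
  also have "\<dots> = wt ` {\<alpha>. keys \<alpha> \<subseteq> coord_vars L}"
    using keys_expo expo_lookup by (auto simp: image_iff) (metis)
  finally show ?thesis .
qed

lemma cone_monoidE:
  assumes "s \<in> S" obtains \<alpha> where "keys \<alpha> \<subseteq> coord_vars L" "wt \<alpha> = s"
  using assms by (auto simp: cone_monoid_wt)

lemma cone_monoid_0 [simp]: "0 \<in> S"
  unfolding cone_monoid_wt by (rule image_eqI[of _ _ 0]) auto

lemma cone_monoid_add: "s \<in> S \<Longrightarrow> s' \<in> S \<Longrightarrow> s + s' \<in> S"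
  unfolding cone_monoid_wt
proof clarify
  fix \<alpha> \<beta> :: "'n mon" assume "keys \<alpha> \<subseteq> coord_vars L" "keys \<beta> \<subseteq> coord_vars L"
  then show "wt \<alpha> + wt \<beta> \<in> wt ` {\<alpha>. keys \<alpha> \<subseteq> coord_vars L}"
    using keys_add[of \<alpha> \<beta>] by (intro image_eqI[of _ _ "\<alpha> + \<beta>"]) (auto simp: wt_add)
qed

lemma coord_vars_subset: "coord_vars L \<subseteq> S"
proof
  fix i :: "'n wt" assume "i \<in> coord_vars L"
  then show "i \<in> S"
    unfolding cone_monoid_wt by (intro image_eqI[of _ _ "single i 1"]) auto
qed

lemma wt_in_cone_monoid:
  assumes "keys \<alpha> \<subseteq> S" shows "wt \<alpha> \<in> S"
proof -
  have mul: "(int n * fst s, of_nat n *s snd s) \<in> S" if "s \<in> S" for s n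
  proof (induction n)
    case (Suc n)
    have "(int (Suc n) * fst s, of_nat (Suc n) *s snd s) = s + (int n * fst s, of_nat n *s snd s)"
      by (simp add: prod_eq_iff algebra_simps vec_eq_iff)
    then show ?case using cone_monoid_add[OF that Suc] by simp
  qed (simp flip: zero_prod_def)
  have eq: "wt \<alpha> = (\<Sum>s\<in>keys \<alpha>. (int (lookup \<alpha> s) * fst s, of_nat (lookup \<alpha> s) *s snd s))"
    by (simp add: wt_def prod_eq_iff fst_sum snd_sum)
  have sum: "(\<Sum>s\<in>A. F s) \<in> S" if "\<And>s. s \<in> A \<Longrightarrow> F s \<in> S" for A and F :: "'n wt \<Rightarrow> 'n wt"
    using that by (induction A rule: infinite_finite_induct) (auto simp: cone_monoid_add)
  show ?thesis unfolding eq by (intro sum mul) (use assms in blast)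
qed

lemma basis_fun_wt:
  assumes "keys \<alpha> \<subseteq> coord_vars L"
  shows "basis_fun L (wt \<alpha>) = (\<lambda>v\<in>affine_cone L. mon_eval (\<lambda>i. v (snd i)) \<alpha> :: 'k::field_char_0)"
  unfolding basis_fun_def
proof (rule the_equality)
  show "\<exists>a. wt \<alpha> = (\<Sum>x\<in>L. int (a x), \<Sum>x\<in>L. of_nat (a x) *s x) \<and>
      (\<lambda>v\<in>affine_cone L. mon_eval (\<lambda>i. v (snd i)) \<alpha> :: 'k) = (\<lambda>v\<in>affine_cone L. \<Prod>x\<in>L. v x ^ a x)"
    using expo_lookup[OF assms] wt_expo[of "\<lambda>x. lookup \<alpha> (1, x)"]
    by (intro exI[of _ "\<lambda>x. lookup \<alpha> (1, x)"]) (simp flip: mon_eval_expo)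
  fix g :: "('n, 'k) func"
  assume "\<exists>a. wt \<alpha> = (\<Sum>x\<in>L. int (a x), \<Sum>x\<in>L. of_nat (a x) *s x) \<and>
    g = (\<lambda>v\<in>affine_cone L. \<Prod>x\<in>L. v x ^ a x)"
  then obtain a where a: "wt \<alpha> = wt (expo a)" "g = (\<lambda>v\<in>affine_cone L. \<Prod>x\<in>L. v x ^ a x)"
    by (auto simp: wt_expo)
  show "g = (\<lambda>v\<in>affine_cone L. mon_eval (\<lambda>i. v (snd i)) \<alpha>)"
    unfolding a(2) mon_eval_expo[symmetric]
    by (rule restrict_ext) (use monomials_agree_on_cone[OF keys_expo assms] a in auto)
qed

lemma basis_fun_add:
  assumes "s \<in> S" "s' \<in> S" "v \<in> affine_cone L"
  shows "basis_fun L (s + s') v = basis_fun L s v * (basis_fun L s' v :: 'k::field_char_0)"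
proof -
  obtain \<alpha> \<beta> where a: "keys \<alpha> \<subseteq> coord_vars L" "wt \<alpha> = s" "keys \<beta> \<subseteq> coord_vars L" "wt \<beta> = s'"
    using assms by (metis cone_monoidE)
  have "keys (\<alpha> + \<beta>) \<subseteq> coord_vars L" using a keys_add[of \<alpha> \<beta>] by blast
  moreover have "s + s' = wt (\<alpha> + \<beta>)" using a by (simp add: wt_add)
  ultimately show ?thesis
    using assms basis_fun_wt[of "\<alpha> + \<beta>", where 'k = 'k] basis_fun_wt[OF a(1), where 'k = 'k]
      basis_fun_wt[OF a(3), where 'k = 'k] a
    by (simp add: mon_eval_add)
qed

lemma basis_fun_0: "v \<in> affine_cone L \<Longrightarrow> basis_fun L 0 v = (1 :: 'k::field_char_0)"
  using basis_fun_wt[of 0, where 'k = 'k] by simp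

lemma basis_fun_coord:
  "i \<in> coord_vars L \<Longrightarrow> v \<in> affine_cone L \<Longrightarrow> basis_fun L i v = (v (snd i) :: 'k::field_char_0)"
  using basis_fun_wt[of "single i 1", where 'k = 'k] by simp

lemma basis_fun_ext_act:
  fixes v :: "('n, 'k::field_char_0) vec_V"
  assumes "s \<in> S" "v \<in> affine_cone L" and ct: "c \<noteq> 0" "t \<in> torus"
  shows "basis_fun L s (ext_act c t v) = tor c t s * basis_fun L s v"
proof -
  obtain \<alpha> where a: "keys \<alpha> \<subseteq> coord_vars L" "wt \<alpha> = s" using assms by (metis cone_monoidE)
  have "hpart wt s (single \<alpha> (1::'k)) = single \<alpha> 1" using a by (simp add: hpart_single)
  then have "poly_fun (single \<alpha> 1) (ext_act c t v) = tor c t s * poly_fun (single \<alpha> 1) v"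
    using poly_fun_weight_part_ext_act[OF mpoly_ring_single_closed[OF a(1)] ct, of s 1 v] by simp
  then show ?thesis
    using basis_fun_wt[OF a(1), where 'k = 'k] a assms ext_act_affine_cone[OF ct assms(2)]
    by (simp add: poly_fun_def)
qed

lemma basis_fun_tpt:
  fixes t :: "'k::field_char_0 ^ 'n"
  assumes "s \<in> S" "c \<noteq> 0" "t \<in> torus"
  shows "basis_fun L s (tpt c t) = tor c t s"
proof -
  obtain \<alpha> where a: "keys \<alpha> \<subseteq> coord_vars L" "wt \<alpha> = s" using assms by (metis cone_monoidE)
  have "basis_fun L s (tpt c t) = poly_fun (single \<alpha> 1) (tpt c t)"
    using basis_fun_wt[OF a(1), where 'k = 'k] a tpt_in_affine_cone[OF assms(2,3)] by (simp add: poly_fun_def)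
  also have "\<dots> = mpoly_eval (tor c t) (single \<alpha> 1)"
    by (rule poly_fun_tpt) (use a mpoly_ring_single_closed in blast)
  finally show ?thesis using a tor_wt[OF assms(2,3), of \<alpha>] by simp
qed

text \<open>Since \<open>s \<mapsto> f_s\<close> is multiplicative, substituting the \<open>f_s\<close> for the variables turns a
  monomial into the basis function of its weight.\<close>

lemma mon_eval_basis_fun:
  assumes "keys \<alpha> \<subseteq> S" and v: "v \<in> affine_cone L"
  shows "mon_eval (\<lambda>s. basis_fun L s v) \<alpha> = (basis_fun L (wt \<alpha>) v :: 'k::field_char_0)"
proof -
  have "keys \<alpha> \<subseteq> S \<and> mon_eval (\<lambda>s. basis_fun L s v) \<alpha> = (basis_fun L (wt \<alpha>) v :: 'k)"
  proof (induction \<alpha> rule: mpoly_induct)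
    case (single s n)
    then have s: "s \<in> S" using assms by blast
    have "basis_fun L s v ^ n = (basis_fun L (wt (single s n)) v :: 'k)"
    proof (induction n)
      case 0
      then show ?case using basis_fun_0[OF v] by simp
    next
      case (Suc n)
      have "single s (Suc n) = single s 1 + single s n" by (simp add: single_add[symmetric])
      moreover have "wt (single s n) \<in> S"
        using s by (intro wt_in_cone_monoid) auto
      ultimately show ?case
        using Suc s v by (simp add: wt_add basis_fun_add)
    qed
    then show ?case using s by (auto simp: keys_single)
  next
    case (add p q)
    then show ?case
      using keys_add[of p q] v wt_in_cone_monoid
      by (auto simp: mon_eval_add wt_add basis_fun_add)
  next
    case zero
    show ?case using basis_fun_0[OF v] by simp
  qed
  then show ?thesis by simp
qed


section \<open>The coordinate ring of the cone\<close>

text \<open>The morphism \<open>\<theta>\<close>, for the polynomial ring on all basis functions at once.\<close>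

definition th :: "('n, 'k::field) mpoly \<Rightarrow> ('n, 'k) func" where
  "th p = (\<lambda>v\<in>affine_cone L. mpoly_eval (\<lambda>s. basis_fun L s v) p)"

lemma th_by_weight:
  assumes p: "p \<in> carrier (mpoly_ring S)" and A: "finite A" "{s. wcoeff p s \<noteq> 0} \<subseteq> A"
    and v: "v \<in> affine_cone L"
  shows "th p v = (\<Sum>s\<in>A. wcoeff p s * (basis_fun L s v :: 'k::field_char_0))"
proof -
  have "mpoly_eval (\<lambda>s. basis_fun L s v) p = (\<Sum>s\<in>A. wcoeff p s * (basis_fun L s v :: 'k))"
    by (rule mpoly_eval_by_weight[OF _ A])
      (use p v in \<open>auto simp: carrier_mpoly_ring mon_eval_basis_fun\<close>)
  then show ?thesis using v by (simp add: th_def)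
qed

lemma wcoeff_in_cone_monoid:
  assumes "p \<in> carrier (mpoly_ring S)" "wcoeff p s \<noteq> 0" shows "s \<in> S"
  using wcoeff_nonzero_imp[OF assms(2)] assms(1) wt_in_cone_monoid by (auto simp: carrier_mpoly_ring)

lemma th_eq_iff:
  fixes p q :: "('n, 'k::field_char_0) mpoly"
  assumes p: "p \<in> carrier (mpoly_ring S)" and q: "q \<in> carrier (mpoly_ring S)"
  shows "th p = th q \<longleftrightarrow> (\<forall>s. wcoeff p s = wcoeff q s)"
proof
  assume eq: "th p = th q"
  have "mpoly_eval (tor c t) (p - q) = 0" if ct: "c \<noteq> 0" "t \<in> torus" for c and t :: "'k ^ 'n"
  proof -
    have ev: "th r (tpt c t) = mpoly_eval (tor c t) r" if "r \<in> carrier (mpoly_ring S)"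
      for r :: "('n, 'k) mpoly"
      using tpt_in_affine_cone[OF ct] that ct
      by (auto simp: th_def carrier_mpoly_ring intro!: mpoly_eval_cong basis_fun_tpt)
    show ?thesis using ev[OF p] ev[OF q] eq by (simp add: mpoly_eval_diff)
  qed
  then have "\<forall>s. wcoeff (p - q) s = 0" using wcoeff_eq_0_iff_tor by blast
  then show "\<forall>s. wcoeff p s = wcoeff q s" by (simp add: wcoeff_diff)
next
  assume eq: "\<forall>s. wcoeff p s = wcoeff q s"
  then have "{s. wcoeff p s \<noteq> 0} = {s. wcoeff q s \<noteq> 0}" by auto
  then have "th p v = th q v" if "v \<in> affine_cone L" for v
    using th_by_weight[OF p finite_wcoeff[of p] order_refl that]
      th_by_weight[OF q finite_wcoeff[of q] order_refl that] eq
    by simp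
  then show "th p = th q" unfolding th_def by (auto simp: fun_eq_iff restrict_def)
qed

lemma restr_eq_th:
  assumes "p \<in> carrier (mpoly_ring (coord_vars L))"
  shows "restr L p = (th p :: ('n, 'k::field_char_0) func)"
  unfolding restr_def th_def poly_fun_def
  by (intro restrict_ext mpoly_eval_cong)
    (use assms in \<open>auto simp: carrier_mpoly_ring subset_iff basis_fun_coord\<close>)

lemma coord_subring: "carrier (mpoly_ring (coord_vars L)) \<subseteq> carrier (mpoly_ring S)"
  by (rule carrier_mpoly_ring_mono[OF coord_vars_subset])

lemma carrier_coord_ring:
  "carrier (coord_ring L) = (th ` carrier (mpoly_ring S) :: ('n, 'k::field_char_0) func set)"
proof
  show "carrier (coord_ring L) \<subseteq> (th ` carrier (mpoly_ring S) :: ('n, 'k) func set)"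
    using restr_eq_th coord_subring by (force simp: coord_ring_def)
next
  show "(th ` carrier (mpoly_ring S) :: ('n, 'k) func set) \<subseteq> carrier (coord_ring L)"
  proof clarify
    fix p :: "('n, 'k) mpoly" assume p: "p \<in> carrier (mpoly_ring S)"
    define e where "e s = (SOME \<alpha>. keys \<alpha> \<subseteq> coord_vars L \<and> wt \<alpha> = s)" for s :: "'n wt"
    have e: "keys (e s) \<subseteq> coord_vars L" "wt (e s) = s" if "s \<in> S" for s
      unfolding e_def by (rule someI2_ex; use that cone_monoidE in blast)+
    define p' where "p' = (\<Sum>s\<in>{s. wcoeff p s \<noteq> 0}. single (e s) (wcoeff p s))"
    have p': "p' \<in> carrier (mpoly_ring (coord_vars L))"
      unfolding p'_def using wcoeff_in_cone_monoid[OF p] e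
      by (intro mpoly_ring_sum_closed mpoly_ring_single_closed) auto
    have "wcoeff p' s = wcoeff p s" for s
    proof -
      have "wcoeff p' s = (\<Sum>s'\<in>{s. wcoeff p s \<noteq> 0}. if s' = s then wcoeff p s' else 0)"
        unfolding p'_def wcoeff_sum
        by (rule sum.cong) (use wcoeff_in_cone_monoid[OF p] e in \<open>auto simp: wcoeff_single\<close>)
      then show ?thesis by (simp add: finite_wcoeff)
    qed
    then have "th p = th p'" by (simp add: th_eq_iff[OF p subsetD[OF coord_subring p']])
    then show "th p \<in> carrier (coord_ring L)"
      using imageI[OF p', of "restr L"] by (simp add: restr_eq_th[OF p'] coord_ring_def)
  qed
qed

abbreviation K :: "('n, 'k::field_char_0) func ring" where "K \<equiv> coord_ring L"

lemma coord_ring_sel: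
  "mult (coord_ring L) g h = (\<lambda>v\<in>affine_cone L. g v * h v)"
  "one (coord_ring L) = (\<lambda>v\<in>affine_cone L. 1)"
  "zero (coord_ring L) = (\<lambda>v\<in>affine_cone L. 0)"
  "add (coord_ring L) g h = (\<lambda>v\<in>affine_cone L. g v + h v)"
  by (simp_all add: coord_ring_def)

lemma th_add: "th (p + q) = th p \<oplus>\<^bsub>K\<^esub> th q"
  and th_mult: "th (p * q) = th p \<otimes>\<^bsub>K\<^esub> th q"
  and th_1: "th 1 = \<one>\<^bsub>K\<^esub>" and th_0: "th 0 = \<zero>\<^bsub>K\<^esub>"
  unfolding coord_ring_sel th_def
  by (auto simp: mpoly_eval_add mpoly_eval_mult intro!: restrict_ext)

lemma th_hom: "th \<in> ring_hom (mpoly_ring S) (coord_ring L :: ('n, 'k::field_char_0) func ring)"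
  by (rule ring_hom_memI) (auto simp: carrier_coord_ring th_add th_mult th_1)

lemma cring_coord_ring: "cring (K :: ('n, 'k::field_char_0) func ring)"
  by (rule cring_surj_hom[OF cring_mpoly_ring th_hom]) (auto simp: carrier_coord_ring th_0)

text \<open>The coefficients of a function with respect to the basis \<open>f_s\<close>, read off from any
  polynomial that represents it.\<close>

definition fcoeff :: "('n, 'k::field_char_0) func \<Rightarrow> 'n wt \<Rightarrow> 'k" where
  "fcoeff g = wcoeff (SOME p. p \<in> carrier (mpoly_ring S) \<and> g = th p)"

lemma fcoeff_th:
  fixes p :: "('n, 'k::field_char_0) mpoly"
  assumes "p \<in> carrier (mpoly_ring S)" shows "fcoeff (th p) = wcoeff p"
proof -
  let ?q = "SOME q. q \<in> carrier (mpoly_ring S) \<and> th p = th q"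
  have "?q \<in> carrier (mpoly_ring S) \<and> th p = th ?q"
    by (rule someI[of _ p]) (use assms in simp)
  then have "\<forall>s. wcoeff p s = wcoeff ?q s" using th_eq_iff[OF assms] by blast
  then show ?thesis unfolding fcoeff_def by (intro ext) (simp only:)
qed

lemma fcoeff_eqI:
  fixes g h :: "('n, 'k::field_char_0) func"
  assumes "g \<in> carrier K" "h \<in> carrier K" "\<And>s. fcoeff g s = fcoeff h s"
  shows "g = h"
  using assms by (auto simp: carrier_coord_ring fcoeff_th th_eq_iff)

lemma fcoeff_add:
  "g \<in> carrier K \<Longrightarrow> h \<in> carrier K \<Longrightarrow> fcoeff (g \<oplus>\<^bsub>K\<^esub> h) s = fcoeff g s + fcoeff h s"
  unfolding carrier_coord_ring
  by (auto simp: fcoeff_th mpoly_ring_add_closed wcoeff_add simp flip: th_add)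

lemma fcoeff_zero [simp]: "fcoeff \<zero>\<^bsub>K\<^esub> s = 0"
  by (simp flip: th_0 add: fcoeff_th)

lemma fcoeff_mult_nonzero:
  assumes "g \<in> carrier K" "h \<in> carrier K" "fcoeff (g \<otimes>\<^bsub>K\<^esub> h) s \<noteq> 0"
  obtains a b where "s = a + b" "fcoeff g a \<noteq> 0" "fcoeff h b \<noteq> 0"
proof -
  obtain p q where "p \<in> carrier (mpoly_ring S)" "q \<in> carrier (mpoly_ring S)" "g = th p" "h = th q"
    using assms by (auto simp: carrier_coord_ring)
  moreover from this have "wcoeff (p * q) s \<noteq> 0"
    using assms(3) by (simp add: fcoeff_th mpoly_ring_mult_closed flip: th_mult)
  ultimately show ?thesis
    by (elim wcoeff_mult_nonzero[of p q s]) (rule that, simp_all add: fcoeff_th)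
qed

lemma finite_fcoeff: "g \<in> carrier K \<Longrightarrow> finite {s. fcoeff g s \<noteq> 0}"
  unfolding carrier_coord_ring by (auto simp: fcoeff_th finite_wcoeff)

lemma fcoeff_in_cone_monoid: "g \<in> carrier K \<Longrightarrow> fcoeff g s \<noteq> 0 \<Longrightarrow> s \<in> S"
  unfolding carrier_coord_ring by (auto simp: fcoeff_th wcoeff_in_cone_monoid)

lemma fcoeff_nonzeroE:
  fixes g :: "('n, 'k::field_char_0) func"
  assumes "g \<in> carrier K" "g \<noteq> \<zero>\<^bsub>K\<^esub>" obtains s where "fcoeff g s \<noteq> 0"
proof -
  interpret cring "K :: ('n, 'k) func ring" by (rule cring_coord_ring)
  show ?thesis using that assms fcoeff_eqI[of g "\<zero>\<^bsub>K\<^esub>"] by auto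
qed

lemma fcoeff_by_weight:
  fixes g :: "('n, 'k::field_char_0) func"
  assumes "g \<in> carrier K" "finite A" "{s. fcoeff g s \<noteq> 0} \<subseteq> A" "v \<in> affine_cone L"
  shows "g v = (\<Sum>s\<in>A. fcoeff g s * basis_fun L s v)"
  using assms th_by_weight by (auto simp: carrier_coord_ring fcoeff_th)

text \<open>The element \<open>c f_s\<close>.\<close>

definition elt :: "'n wt \<Rightarrow> 'k::field_char_0 \<Rightarrow> ('n, 'k) func" where
  "elt s c = th (single (single s 1) c)"

lemma elt_closed: "s \<in> S \<Longrightarrow> elt s c \<in> carrier K"
  unfolding elt_def carrier_coord_ring by (auto intro!: imageI mpoly_ring_single_closed)

lemma fcoeff_elt: "s \<in> S \<Longrightarrow> fcoeff (elt s c) s' = (if s' = s then c else 0)"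
  unfolding elt_def
  by (subst fcoeff_th) (auto intro!: mpoly_ring_single_closed simp: wcoeff_single)

lemma basis_fun_elt: "s \<in> S \<Longrightarrow> basis_fun L s = (elt s 1 :: ('n, 'k::field_char_0) func)"
proof -
  assume s: "s \<in> S"
  then obtain \<alpha> where a: "keys \<alpha> \<subseteq> coord_vars L" "wt \<alpha> = s" by (metis cone_monoidE)
  show ?thesis
    unfolding elt_def th_def using basis_fun_wt[OF a(1), where 'k = 'k] a by (auto simp: restrict_def)
qed

lemma th_single:
  assumes "keys \<alpha> \<subseteq> S" shows "th (single \<alpha> c) = (elt (wt \<alpha>) c :: ('n, 'k::field_char_0) func)"
  unfolding elt_def
  by (subst th_eq_iff)
    (use assms wt_in_cone_monoid in \<open>auto intro!: mpoly_ring_single_closed simp: wcoeff_single\<close>)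

lemma const_elt: "(\<lambda>v\<in>affine_cone L. c) = (elt 0 c :: ('n, 'k::field_char_0) func)"
  unfolding elt_def th_def by (auto simp: basis_fun_0 intro!: restrict_ext)


section \<open>Eigenfunctions and weight components\<close>

text \<open>Comparing the values of an eigenfunction along the open orbit gives a linear relation between
  characters, which leaves only the coefficient at \<open>- \<mu>\<close>.\<close>

lemma eigenfunction_iff:
  fixes g :: "('n, 'k::field_char_0) func"
  shows "eigenfunction L g \<mu> \<longleftrightarrow>
    g \<in> carrier K \<and> g \<noteq> \<zero>\<^bsub>K\<^esub> \<and> (\<forall>s. fcoeff g s \<noteq> 0 \<longrightarrow> s = - \<mu>)"
proof (cases "g \<in> carrier K")
  case g: True
  let ?W = "insert (- \<mu>) {s. fcoeff g s \<noteq> 0}"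
  have W: "finite ?W" using finite_fcoeff[OF g] by simp
  have inv: "inverse c \<noteq> 0" "(\<chi> i. inverse (t $ i)) \<in> torus" if "c \<noteq> 0" "t \<in> torus"
    for c :: 'k and t :: "'k ^ 'n" using that by (auto simp: torus_def)
  have torinv: "tor (inverse c) (\<chi> i. inverse (t $ i)) (- \<mu>) = c powi fst \<mu> * character (snd \<mu>) t"
    for c :: 'k and t :: "'k ^ 'n"
    by (simp add: tor_def character_inverse character_minus power_int_minus power_int_inverse)
  show ?thesis
  proof
    assume eig: "eigenfunction L g \<mu>"
    let ?e = "tpt 1 (\<chi> i. (1::'k))"
    have e: "?e \<in> affine_cone L" by (rule tpt_in_affine_cone) (auto simp: torus_def)
    have tp: "ext_act c t ?e = tpt c t" for c t
      by (auto simp: ext_act_def tpt_def character_def)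
    have rel: "(\<Sum>s\<in>?W. (fcoeff g s - (if s = - \<mu> then g ?e else 0)) * tor c t s) = 0"
      if ct: "c \<noteq> 0" "t \<in> torus" for c t
    proof -
      let ?c = "inverse c" and ?t = "\<chi> i. inverse (t $ i)"
      have ct': "?c \<noteq> 0" "?t \<in> torus" using inv[OF ct] by auto
      have ii: "inverse ?c = c" "(\<chi> i. inverse (?t $ i)) = t" by (auto simp: vec_eq_iff)
      have "g (ext_act (inverse ?c) (\<chi> i. inverse (?t $ i)) ?e) =
          ?c powi fst \<mu> * character (snd \<mu>) ?t * g ?e"
        using eig ct' e unfolding eigenfunction_def by blast
      then have "g (tpt c t) = tor c t (- \<mu>) * g ?e"
        unfolding torinv[of ?c ?t, symmetric] ii tp .
      moreover have "g (tpt c t) = (\<Sum>s\<in>?W. fcoeff g s * tor c t s)"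
      proof -
        have "g (tpt c t) = (\<Sum>s\<in>?W. fcoeff g s * basis_fun L s (tpt c t))"
          by (rule fcoeff_by_weight[OF g W]) (auto intro: tpt_in_affine_cone[OF ct])
        also have "\<dots> = (\<Sum>s\<in>?W. fcoeff g s * tor c t s)"
          using basis_fun_tpt[OF _ ct] fcoeff_in_cone_monoid[OF g]
          by (intro sum.cong refl) (metis mult_zero_left)
        finally show ?thesis .
      qed
      moreover have "(\<Sum>s\<in>?W. (if s = - \<mu> then g ?e else 0) * tor c t s) = g ?e * tor c t (- \<mu>)"
        using W by (simp add: if_distrib[of "\<lambda>z. z * _"] sum.delta cong: if_cong)
      ultimately show ?thesis by (simp add: left_diff_distrib sum_subtractf)
    qed
    have "\<forall>s\<in>?W. fcoeff g s - (if s = - \<mu> then g ?e else 0) = 0"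
      by (rule tor_independent[OF W]) (rule rel)
    then have "fcoeff g s = 0" if "s \<noteq> - \<mu>" for s
      using that by (cases "fcoeff g s = 0") auto
    then show "g \<in> carrier K \<and> g \<noteq> \<zero>\<^bsub>K\<^esub> \<and> (\<forall>s. fcoeff g s \<noteq> 0 \<longrightarrow> s = - \<mu>)"
      using eig unfolding eigenfunction_def by blast
  next
    assume *: "g \<in> carrier K \<and> g \<noteq> \<zero>\<^bsub>K\<^esub> \<and> (\<forall>s. fcoeff g s \<noteq> 0 \<longrightarrow> s = - \<mu>)"
    then have S: "- \<mu> \<in> S" using fcoeff_nonzeroE fcoeff_in_cone_monoid by metis
    have gv: "g v = fcoeff g (- \<mu>) * basis_fun L (- \<mu>) v" if "v \<in> affine_cone L" for v
      using fcoeff_by_weight[OF g, of "{- \<mu>}" v] * that by auto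
    show "eigenfunction L g \<mu>"
      unfolding eigenfunction_def
    proof (intro conjI allI impI)
      fix c :: 'k and t :: "'k ^ 'n" and v :: "('n, 'k) vec_V"
      assume a: "c \<noteq> 0 \<and> t \<in> torus \<and> v \<in> affine_cone L"
      then have ct': "inverse c \<noteq> 0" "(\<chi> i. inverse (t $ i)) \<in> torus" using inv by auto
      show "g (ext_act (inverse c) (\<chi> i. inverse (t $ i)) v) = c powi fst \<mu> * character (snd \<mu>) t * g v"
        using a gv ext_act_affine_cone[OF ct'] basis_fun_ext_act[OF S _ ct', of v] torinv[of c t]
        by simp
    qed (use * in auto)
  qed
qed (auto simp: eigenfunction_def)

lemma fcoeff_finsum:
  fixes h :: "'i \<Rightarrow> ('n, 'k::field_char_0) func"
  assumes "finite A" "h \<in> A \<rightarrow> carrier K"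
  shows "fcoeff (finsum K h A) s = (\<Sum>i\<in>A. fcoeff (h i) s)"
proof -
  interpret cring "K :: ('n, 'k) func ring" by (rule cring_coord_ring)
  show ?thesis using assms
  proof (induction A rule: finite_induct)
    case (insert i A)
    then show ?case using fcoeff_add[of "h i" "finsum K h A"] by (simp add: Pi_iff)
  qed simp
qed

text \<open>The components are determined by the coefficients of \<open>g\<close>: a family as in the definition has
  \<open>fcoeff g (- \<mu>)\<close> as the only coefficient of its member at \<open>\<mu>\<close>.\<close>

lemma weight_components_nonzero:
  fixes g :: "('n, 'k::field_char_0) func"
  assumes g: "g \<in> carrier K"
  shows "weight_components L g \<mu> \<noteq> \<zero>\<^bsub>K\<^esub> \<longleftrightarrow> fcoeff g (- \<mu>) \<noteq> 0"
proof -
  interpret cring "K :: ('n, 'k) func ring" by (rule cring_coord_ring)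
  define h0 where "h0 \<mu> = (if fcoeff g (- \<mu>) = 0 then \<zero>\<^bsub>K\<^esub> else elt (- \<mu>) (fcoeff g (- \<mu>)))" for \<mu>
  let ?D = "\<lambda>h. finite {\<mu>. h \<mu> \<noteq> \<zero>\<^bsub>K\<^esub>} \<and> (\<forall>\<mu>. h \<mu> = \<zero>\<^bsub>K\<^esub> \<or> eigenfunction L (h \<mu>) \<mu>) \<and>
    g = finsum K h {\<mu>. h \<mu> \<noteq> \<zero>\<^bsub>K\<^esub>}"
  have S: "- \<mu> \<in> S" if "fcoeff g (- \<mu>) \<noteq> 0" for \<mu>
    using that fcoeff_in_cone_monoid[OF g] by blast
  have nz: "elt s c \<noteq> \<zero>\<^bsub>K\<^esub>" if "s \<in> S" "c \<noteq> 0" for s c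
    using fcoeff_elt[OF that(1), of c s] that(2) by auto
  have h0c: "h0 \<mu> \<in> carrier K" for \<mu> using S by (auto simp: h0_def elt_closed)
  have h0nz: "h0 \<mu> \<noteq> \<zero>\<^bsub>K\<^esub> \<longleftrightarrow> fcoeff g (- \<mu>) \<noteq> 0" for \<mu>
    using S[of \<mu>] nz[of "- \<mu>" "fcoeff g (- \<mu>)"] by (simp add: h0_def)
  have fin: "finite {\<mu>. h0 \<mu> \<noteq> \<zero>\<^bsub>K\<^esub>}"
  proof -
    have "{\<mu>. h0 \<mu> \<noteq> \<zero>\<^bsub>K\<^esub>} = uminus ` {s. fcoeff g s \<noteq> 0}"
      unfolding h0nz by (force simp: image_iff)
    then show ?thesis using finite_fcoeff[OF g] by simp
  qed
  have coeff: "fcoeff (h \<mu>) s = (if s = - \<mu> then fcoeff g s else 0)" if D: "?D h" for h \<mu> s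
  proof -
    have hc: "h \<mu> \<in> carrier K" for \<mu> using D by (metis eigenfunction_iff zero_closed)
    have z: "fcoeff (h \<mu>) s = 0" if "s \<noteq> - \<mu>" for s \<mu>
      using D that by (metis eigenfunction_iff fcoeff_zero)
    have "fcoeff g (- \<mu>) = (\<Sum>\<mu>'\<in>{\<mu>. h \<mu> \<noteq> \<zero>\<^bsub>K\<^esub>}. fcoeff (h \<mu>') (- \<mu>))"
      using fcoeff_finsum[of "{\<mu>. h \<mu> \<noteq> \<zero>\<^bsub>K\<^esub>}" h "- \<mu>"] D hc by auto
    also have "\<dots> = (\<Sum>\<mu>'\<in>{\<mu>. h \<mu> \<noteq> \<zero>\<^bsub>K\<^esub>}. if \<mu>' = \<mu> then fcoeff (h \<mu>) (- \<mu>) else 0)"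
      by (rule sum.cong) (use z in auto)
    also have "\<dots> = fcoeff (h \<mu>) (- \<mu>)"
      using D by (auto simp: sum.delta)
    finally show ?thesis using z by auto
  qed
  have D0: "?D h0"
  proof (intro conjI allI)
    fix \<mu> show "h0 \<mu> = \<zero>\<^bsub>K\<^esub> \<or> eigenfunction L (h0 \<mu>) \<mu>"
    proof (cases "fcoeff g (- \<mu>) = 0")
      case False
      then have "h0 \<mu> = elt (- \<mu>) (fcoeff g (- \<mu>))" by (simp add: h0_def)
      then show ?thesis
        using S[OF False] nz[OF S[OF False] False] by (simp add: eigenfunction_iff elt_closed fcoeff_elt)
    qed (simp add: h0_def)
  next
    show "g = finsum K h0 {\<mu>. h0 \<mu> \<noteq> \<zero>\<^bsub>K\<^esub>}"
    proof (rule fcoeff_eqI[OF g])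
      show "finsum K h0 {\<mu>. h0 \<mu> \<noteq> \<zero>\<^bsub>K\<^esub>} \<in> carrier K" using h0c by (intro finsum_closed) auto
      fix s
      have "fcoeff (finsum K h0 {\<mu>. h0 \<mu> \<noteq> \<zero>\<^bsub>K\<^esub>}) s = (\<Sum>\<mu>\<in>{\<mu>. h0 \<mu> \<noteq> \<zero>\<^bsub>K\<^esub>}. fcoeff (h0 \<mu>) s)"
        by (rule fcoeff_finsum[OF fin]) (use h0c in auto)
      also have "\<dots> = (\<Sum>\<mu>\<in>{\<mu>. h0 \<mu> \<noteq> \<zero>\<^bsub>K\<^esub>}. if \<mu> = - s then fcoeff g s else 0)"
        by (rule sum.cong) (use S in \<open>auto simp: h0_def fcoeff_elt\<close>)
      also have "\<dots> = fcoeff g s" using fin h0nz[of "- s"] by (auto simp: sum.delta)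
      finally show "fcoeff g s = fcoeff (finsum K h0 {\<mu>. h0 \<mu> \<noteq> \<zero>\<^bsub>K\<^esub>}) s" by simp
    qed
  qed (rule fin)
  have "weight_components L g = h0"
    unfolding weight_components_def
  proof (rule the_equality)
    fix h assume D: "?D h"
    show "h = h0"
    proof
      fix \<mu>
      have "h \<mu> \<in> carrier K" using D by (metis eigenfunction_iff zero_closed)
      then show "h \<mu> = h0 \<mu>"
        by (rule fcoeff_eqI[OF _ h0c]) (simp only: coeff[OF D] coeff[OF D0])
    qed
  qed (rule D0)
  then show ?thesis by (simp only: h0nz)
qed

end


section \<open>The lexicographic order\<close>

locale face_order =
  fixes P :: "'n::finite face" and R :: "'n face rel"
  assumes lin: "linear_order_on (faces P) R" and finite_faces: "finite (faces P)"
begin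

lemma R_refl: "\<sigma> \<in> faces P \<Longrightarrow> (\<sigma>, \<sigma>) \<in> R"
  using lin by (auto simp: linear_order_on_def partial_order_on_def preorder_on_def dest: refl_onD)

lemma R_antisym: "(\<sigma>, \<tau>) \<in> R \<Longrightarrow> (\<tau>, \<sigma>) \<in> R \<Longrightarrow> \<sigma> = \<tau>"
  using lin by (auto simp: linear_order_on_def partial_order_on_def dest: antisymD)

lemma R_trans: "(\<sigma>, \<tau>) \<in> R \<Longrightarrow> (\<tau>, \<rho>) \<in> R \<Longrightarrow> (\<sigma>, \<rho>) \<in> R"
  using lin by (auto simp: linear_order_on_def partial_order_on_def preorder_on_def dest: transD)

lemma R_total: "\<sigma> \<in> faces P \<Longrightarrow> \<tau> \<in> faces P \<Longrightarrow> (\<sigma>, \<tau>) \<in> R \<or> (\<tau>, \<sigma>) \<in> R"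
  using lin R_refl by (cases "\<sigma> = \<tau>") (auto simp: linear_order_on_def total_on_def)

lemma finite_has_R_max:
  assumes "finite D" "D \<noteq> {}" "D \<subseteq> faces P"
  obtains m where "m \<in> D" "\<forall>x\<in>D. (x, m) \<in> R"
proof -
  have "\<exists>m\<in>D. \<forall>x\<in>D. (x, m) \<in> R" using assms
  proof (induction D rule: finite_ne_induct)
    case (singleton x)
    then show ?case using R_refl by auto
  next
    case (insert x F)
    then obtain m where m: "m \<in> F" "\<forall>x\<in>F. (x, m) \<in> R" by auto
    show ?case
    proof (cases "(x, m) \<in> R")
      case False
      then have "(m, x) \<in> R" using R_total[of x m] insert.prems m by auto
      then show ?thesis using m R_trans R_refl insert.prems by blast
    qed (use m in blast)
  qed
  then show ?thesis using that by blast
qed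

text \<open>The position at which the lexicographic comparison of \<open>a\<close> and \<open>b\<close> is decided.\<close>

lemma largest_difference:
  assumes "a \<noteq> b" "\<forall>\<sigma>. \<sigma> \<notin> faces P \<longrightarrow> a \<sigma> = b \<sigma>"
  obtains \<rho> where "\<rho> \<in> faces P" "a \<rho> \<noteq> b \<rho>" "\<forall>\<tau>\<in>faces P. (\<rho>, \<tau>) \<in> R \<and> \<tau> \<noteq> \<rho> \<longrightarrow> a \<tau> = b \<tau>"
proof -
  let ?D = "{\<sigma> \<in> faces P. a \<sigma> \<noteq> b \<sigma>}"
  have "?D \<noteq> {}" using assms by (auto simp: fun_eq_iff)
  then obtain m where m: "m \<in> ?D" "\<forall>x\<in>?D. (x, m) \<in> R"
    using finite_has_R_max[of ?D] finite_faces by auto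
  then have "\<forall>\<tau>\<in>faces P. (m, \<tau>) \<in> R \<and> \<tau> \<noteq> m \<longrightarrow> a \<tau> = b \<tau>"
    using R_antisym by blast
  then show ?thesis using that m by blast
qed

lemma lex_le_refl [simp]: "lex_le P R a a"
  by (simp add: lex_le_def)

lemma lex_leI:
  "\<sigma> \<in> faces P \<Longrightarrow> a \<sigma> < b \<sigma> \<Longrightarrow>
    (\<And>\<tau>. \<tau> \<in> faces P \<Longrightarrow> (\<sigma>, \<tau>) \<in> R \<Longrightarrow> \<tau> \<noteq> \<sigma> \<Longrightarrow> a \<tau> = b \<tau>) \<Longrightarrow> lex_le P R a b"
  unfolding lex_le_def by (intro disjI2 bexI[of _ \<sigma>] conjI ballI impI) auto

lemma lex_leE:
  assumes "lex_le P R a b" "a \<noteq> b"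
  obtains \<sigma> where "\<sigma> \<in> faces P" "a \<sigma> < b \<sigma>"
    "\<And>\<tau>. \<tau> \<in> faces P \<Longrightarrow> (\<sigma>, \<tau>) \<in> R \<Longrightarrow> \<tau> \<noteq> \<sigma> \<Longrightarrow> a \<tau> = b \<tau>"
proof -
  have "\<exists>\<sigma>\<in>faces P. a \<sigma> < b \<sigma> \<and> (\<forall>\<tau>\<in>faces P. (\<sigma>, \<tau>) \<in> R \<and> \<tau> \<noteq> \<sigma> \<longrightarrow> a \<tau> = b \<tau>)"
    using assms by (simp add: lex_le_def)
  then show ?thesis using that by blast
qed

lemma lex_le_total:
  assumes "\<forall>\<sigma>. \<sigma> \<notin> faces P \<longrightarrow> a \<sigma> = b \<sigma>"
  shows "lex_le P R a b \<or> lex_le P R b a"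
proof (cases "a = b")
  case False
  then obtain \<rho> where r: "\<rho> \<in> faces P" "a \<rho> \<noteq> b \<rho>"
    "\<forall>\<tau>\<in>faces P. (\<rho>, \<tau>) \<in> R \<and> \<tau> \<noteq> \<rho> \<longrightarrow> a \<tau> = b \<tau>"
    using largest_difference assms by blast
  show ?thesis
  proof (cases "a \<rho> < b \<rho>")
    case True
    have "lex_le P R a b" by (rule lex_leI[of \<rho>]) (use r True in blast)+
    then show ?thesis ..
  next
    case False
    then have lt: "b \<rho> < a \<rho>" using r(2) by linarith
    have "lex_le P R b a" by (rule lex_leI[of \<rho>]) (use r lt in auto)
    then show ?thesis ..
  qed
qed simp

lemma lex_le_antisym:
  assumes "lex_le P R a b" "lex_le P R b a" shows "a = b"
proof (rule ccontr)
  assume ne: "a \<noteq> b"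
  obtain \<sigma> where s: "\<sigma> \<in> faces P" "a \<sigma> < b \<sigma>"
    "\<And>\<tau>. \<tau> \<in> faces P \<Longrightarrow> (\<sigma>, \<tau>) \<in> R \<Longrightarrow> \<tau> \<noteq> \<sigma> \<Longrightarrow> a \<tau> = b \<tau>"
    by (rule lex_leE[OF assms(1) ne]) (rule that, assumption+)
  obtain \<tau> where t: "\<tau> \<in> faces P" "b \<tau> < a \<tau>"
    "\<And>\<rho>. \<rho> \<in> faces P \<Longrightarrow> (\<tau>, \<rho>) \<in> R \<Longrightarrow> \<rho> \<noteq> \<tau> \<Longrightarrow> b \<rho> = a \<rho>"
    by (rule lex_leE[OF assms(2) ne[symmetric]]) (rule that, assumption+)
  have ne': "\<sigma> \<noteq> \<tau>" using s t by auto
  show False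
    using R_total[OF s(1) t(1)]
  proof
    assume "(\<sigma>, \<tau>) \<in> R"
    then show False using s(3)[OF t(1) _ ne'[symmetric]] t(2) by simp
  next
    assume "(\<tau>, \<sigma>) \<in> R"
    then show False using t(3)[OF s(1) _ ne'] s(2) by simp
  qed
qed

lemma lex_le_trans:
  assumes "lex_le P R a b" "lex_le P R b c" shows "lex_le P R a c"
proof (cases "a = b \<or> b = c")
  case False
  then have ne: "a \<noteq> b" "b \<noteq> c" by auto
  obtain \<sigma> where s: "\<sigma> \<in> faces P" "a \<sigma> < b \<sigma>"
    "\<And>\<tau>. \<tau> \<in> faces P \<Longrightarrow> (\<sigma>, \<tau>) \<in> R \<Longrightarrow> \<tau> \<noteq> \<sigma> \<Longrightarrow> a \<tau> = b \<tau>"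
    by (rule lex_leE[OF assms(1) ne(1)]) (rule that, assumption+)
  obtain \<tau> where t: "\<tau> \<in> faces P" "b \<tau> < c \<tau>"
    "\<And>\<rho>. \<rho> \<in> faces P \<Longrightarrow> (\<tau>, \<rho>) \<in> R \<Longrightarrow> \<rho> \<noteq> \<tau> \<Longrightarrow> b \<rho> = c \<rho>"
    by (rule lex_leE[OF assms(2) ne(2)]) (rule that, assumption+)
  consider "\<sigma> = \<tau>" | "(\<tau>, \<sigma>) \<in> R" "\<sigma> \<noteq> \<tau>" | "(\<sigma>, \<tau>) \<in> R" "\<sigma> \<noteq> \<tau>"
    using R_total[OF s(1) t(1)] by blast
  then show ?thesis
  proof cases
    case 1
    show ?thesis by (rule lex_leI[of \<sigma>]) (use s t 1 in auto)
  next
    case 2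
    show ?thesis
    proof (rule lex_leI[of \<sigma>, OF s(1)])
      show "a \<sigma> < c \<sigma>" using s(2) t(3)[OF s(1) 2] by simp
      fix \<rho> assume r: "\<rho> \<in> faces P" "(\<sigma>, \<rho>) \<in> R" "\<rho> \<noteq> \<sigma>"
      have "\<rho> \<noteq> \<tau>" using r 2 R_antisym by blast
      then show "a \<rho> = c \<rho>" using s(3)[OF r] t(3)[OF r(1) R_trans[OF 2(1) r(2)]] by simp
    qed
  next
    case 3
    show ?thesis
    proof (rule lex_leI[of \<tau>, OF t(1)])
      show "a \<tau> < c \<tau>" using t(2) s(3)[OF t(1) 3(1)] 3(2) by simp
      fix \<rho> assume r: "\<rho> \<in> faces P" "(\<tau>, \<rho>) \<in> R" "\<rho> \<noteq> \<tau>"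
      have "\<rho> \<noteq> \<sigma>" using r 3 R_antisym by blast
      then show "a \<rho> = c \<rho>" using t(3)[OF r] s(3)[OF r(1) R_trans[OF 3(1) r(2)]] by simp
    qed
  qed
qed (use assms in auto)

lemma lex_le_add: "lex_le P R a b \<Longrightarrow> lex_le P R (a + c) (b + c)"
  unfolding lex_le_def by (fastforce simp: fun_eq_iff)

lemma lex_le_add_mono:
  assumes "lex_le P R a b" "lex_le P R c d" shows "lex_le P R (a + c) (b + d)"
  using lex_le_trans[OF lex_le_add[OF assms(1), of c]] lex_le_add[OF assms(2), of b]
  by (simp add: add.commute)

text \<open>Makes the strict part of the filtration absorb products: one strict inequality in a sum
  keeps the sum strict.\<close>

lemma lex_le_add_eqD:
  assumes "lex_le P R a b" "lex_le P R c d" "a + c = b + d" shows "a = b \<and> c = d"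
proof -
  have "lex_le P R (b + c) (b + d)" using lex_le_add[OF assms(2), of b] by (simp add: add.commute)
  then have "lex_le P R (b + c) (a + c)" using assms(3) by simp
  then have "lex_le P R b a" using lex_le_add[of "b + c" "a + c" "- c"] by simp
  then have "a = b" using lex_le_antisym assms(1) by blast
  then show ?thesis using assms(3) by simp
qed

lemma nonneg_imp_lex_le_0:
  assumes "\<And>\<sigma>. 0 \<le> a \<sigma>" "\<And>\<sigma>. \<sigma> \<notin> faces P \<Longrightarrow> a \<sigma> = 0" shows "lex_le P R 0 a"
proof (cases "0 = a")
  case False
  then obtain \<rho> where "\<rho> \<in> faces P" "0 \<rho> \<noteq> a \<rho>" "\<forall>\<tau>\<in>faces P. (\<rho>, \<tau>) \<in> R \<and> \<tau> \<noteq> \<rho> \<longrightarrow> 0 \<tau> = a \<tau>"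
    using largest_difference[of 0 a] assms by auto
  then show ?thesis unfolding lex_le_def using assms(1)[of \<rho>] by (auto simp: less_le)
qed simp

lemma lex_min_eqI: "m \<in> A \<Longrightarrow> (\<And>b. b \<in> A \<Longrightarrow> lex_le P R m b) \<Longrightarrow> lex_min P R A = m"
  unfolding lex_min_def by (rule the_equality) (use lex_le_antisym in blast)+

lemma lex_min_exists:
  assumes "finite A" "A \<noteq> {}" "\<And>a \<sigma>. a \<in> A \<Longrightarrow> \<sigma> \<notin> faces P \<Longrightarrow> a \<sigma> = 0"
  shows "lex_min P R A \<in> A \<and> (\<forall>b\<in>A. lex_le P R (lex_min P R A) b)"
proof -
  have "\<exists>m\<in>A. \<forall>b\<in>A. lex_le P R m b" using assms
  proof (induction A rule: finite_ne_induct)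
    case (insert x F)
    then obtain m where m: "m \<in> F" "\<forall>b\<in>F. lex_le P R m b" by blast
    have "lex_le P R x m \<or> lex_le P R m x"
      using insert.prems[of x] insert.prems[of m] m by (intro lex_le_total) simp
    then show ?case using m lex_le_trans lex_le_refl by blast
  qed auto
  then show ?thesis using lex_min_eqI by blast
qed

end


section \<open>The triangulation of the polytope\<close>

text \<open>A full-dimensional polytope with a lattice point in the relative interior of every face. The
  simplices spanned by the points of the chains of faces form a generalised barycentric
  subdivision.\<close>

locale marked_polytope = face_order P R
  for P :: "'n::finite face" and R :: "'n face rel" +
  fixes pt :: "'n face \<Rightarrow> 'n chr"
  assumes polytope_P: "polytope P" and full_dim: "aff_dim P = int CARD('n)"
    and refines: "\<And>\<sigma> \<tau>. \<sigma> \<in> faces P \<Longrightarrow> \<tau> \<in> faces P \<Longrightarrow> \<sigma> \<subseteq> \<tau> \<Longrightarrow> (\<sigma>, \<tau>) \<in> R"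
    and pt: "\<And>\<sigma>. \<sigma> \<in> faces P \<Longrightarrow> rvec (pt \<sigma>) \<in> rel_interior \<sigma>"
begin

abbreviation chn :: "'n face set \<Rightarrow> bool" where "chn \<equiv> subset.chain (faces P)"

lemma chn_iff: "chn C \<longleftrightarrow> C \<subseteq> faces P \<and> (\<forall>\<sigma>\<in>C. \<forall>\<tau>\<in>C. \<sigma> \<subseteq> \<tau> \<or> \<tau> \<subseteq> \<sigma>)"
  by (auto simp: subset_chain_def)

lemma chn_subset: "chn C \<Longrightarrow> D \<subseteq> C \<Longrightarrow> chn D"
  unfolding chn_iff by blast

lemma chn_finite: "chn C \<Longrightarrow> finite C"
  using finite_faces finite_subset by (auto simp: chn_iff)

lemma max_chain_iff: "C \<in> max_chains P \<longleftrightarrow> chn C \<and> (\<forall>D. chn D \<longrightarrow> C \<subseteq> D \<longrightarrow> D = C)"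
  unfolding mem_Collect_eq subset.maxchain_def by blast

lemma max_chain_chn: "C \<in> max_chains P \<Longrightarrow> chn C"
  by (subst (asm) max_chain_iff) blast

lemma finite_max_chains: "finite (max_chains P)"
  by (rule finite_subset[of _ "Pow (faces P)"]) (use max_chain_chn chn_iff finite_faces in blast)+

lemma chain_extends_to_max_chain:
  assumes "chn D" obtains C where "C \<in> max_chains P" "D \<subseteq> C"
proof -
  have "finite {C. chn C}"
    by (rule finite_subset[of _ "Pow (faces P)"]) (auto simp: finite_faces chn_iff)
  then obtain C where "D \<subseteq> C" "C \<in> {C. chn C}" "\<forall>B\<in>{C. chn C}. C \<subseteq> B \<longrightarrow> C = B"
    using finite_has_maximal2[of "{C. chn C}" D] assms by auto
  then have "C \<in> max_chains P" by (subst max_chain_iff) blast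
  then show ?thesis using that \<open>D \<subseteq> C\<close> by blast
qed

lemma face_polyhedron: "\<sigma> \<in> faces P \<Longrightarrow> polyhedron \<sigma>"
  and face_polytope: "\<sigma> \<in> faces P \<Longrightarrow> polytope \<sigma>"
  using polytope_P face_of_polytope_polytope polytope_imp_polyhedron by (auto simp: faces_def)

lemma face_subset: "\<sigma> \<in> faces P \<Longrightarrow> \<sigma> \<subseteq> P"
  by (simp add: faces_def face_of_imp_subset)

lemma face_of_face: "\<tau> face_of \<sigma> \<Longrightarrow> \<sigma> \<in> faces P \<Longrightarrow> \<tau> \<noteq> {} \<Longrightarrow> \<tau> \<in> faces P"
  by (auto simp: faces_def intro: face_of_trans)

lemma face_of_subset_face: "\<sigma> \<in> faces P \<Longrightarrow> \<tau> \<in> faces P \<Longrightarrow> \<tau> \<subseteq> \<sigma> \<Longrightarrow> \<tau> face_of \<sigma>"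
  using face_of_subset[of \<tau> P \<sigma>] by (auto simp: faces_def face_of_imp_subset)

lemma pt_in_face: "\<sigma> \<in> faces P \<Longrightarrow> rvec (pt \<sigma>) \<in> \<sigma>"
  using pt rel_interior_subset by blast

lemma P_in_faces: "P \<in> faces P"
  using full_dim polytope_P by (auto simp: faces_def face_of_refl polytope_imp_convex)

text \<open>Every face of a polytope is exposed: some affine form is nonnegative on the polytope and
  vanishes exactly on the face. The empty face is exposed by the constant \<open>1\<close>.\<close>

lemma exposing_form:
  assumes "\<tau> face_of P"
  obtains a b where "\<And>x. x \<in> P \<Longrightarrow> 0 \<le> b - a \<bullet> x" "\<And>x. x \<in> P \<Longrightarrow> b - a \<bullet> x = 0 \<longleftrightarrow> x \<in> \<tau>"
proof -
  have "\<tau> exposed_face_of P"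
    using assms polytope_P by (simp add: exposed_face_of_polyhedron polytope_imp_polyhedron)
  then obtain a b where "P \<subseteq> {x. a \<bullet> x \<le> b}" "\<tau> = P \<inter> {x. a \<bullet> x = b}"
    by (auto simp: exposed_face_of_def)
  then show ?thesis using that[where a = a and b = b] by auto
qed

text \<open>Let \<open>u \<ge> 0\<close> and \<open>w\<close> be coefficients of the same combination of the points
  \<open>(1, pt \<sigma>)\<close>, where \<open>w\<close> lives on a chain \<open>C\<close>. At the largest face \<open>\<rho>\<close> where they differ, the
  affine form exposing the next face \<open>\<tau>\<close> of \<open>C\<close> below \<open>\<rho>\<close> kills what remains of \<open>w\<close> except for
  \<open>w \<rho>\<close>, and is nonnegative on what remains of \<open>u\<close>. It does not kill \<open>pt \<rho>\<close>, since \<open>\<rho>\<close> is not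
  contained in \<open>\<tau>\<close>.\<close>

lemma chain_coefficients_dominate:
  fixes u w :: "'n face \<Rightarrow> real"
  assumes C: "chn C" and w: "\<And>\<sigma>. \<sigma> \<notin> C \<Longrightarrow> w \<sigma> = 0" and u: "\<And>\<sigma>. 0 \<le> u \<sigma>"
    and eq1: "(\<Sum>\<sigma>\<in>faces P. u \<sigma>) = (\<Sum>\<sigma>\<in>faces P. w \<sigma>)"
    and eq2: "(\<Sum>\<sigma>\<in>faces P. u \<sigma> *\<^sub>R rvec (pt \<sigma>)) = (\<Sum>\<sigma>\<in>faces P. w \<sigma> *\<^sub>R rvec (pt \<sigma>))"
    and \<rho>: "\<rho> \<in> faces P" "\<forall>\<tau>\<in>faces P. (\<rho>, \<tau>) \<in> R \<and> \<tau> \<noteq> \<rho> \<longrightarrow> u \<tau> = w \<tau>"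
  shows "u \<rho> \<le> w \<rho>"
proof (rule ccontr)
  assume gt: "\<not> u \<rho> \<le> w \<rho>"
  let ?B = "{\<tau> \<in> C. (\<tau>, \<rho>) \<in> R \<and> \<tau> \<noteq> \<rho>}"
  have Cf: "C \<subseteq> faces P" using C by (simp add: chn_iff)
  have "\<exists>\<tau>. \<tau> face_of P \<and> (\<forall>\<sigma>\<in>?B. \<sigma> \<subseteq> \<tau>) \<and> (\<tau> = {} \<or> \<tau> \<in> ?B)"
  proof (cases "?B = {}")
    case False
    then obtain \<tau> where t: "\<tau> \<in> ?B" "\<forall>\<sigma>\<in>?B. (\<sigma>, \<tau>) \<in> R"
      using finite_has_R_max[of ?B] chn_finite[OF C] Cf by auto
    have "\<sigma> \<subseteq> \<tau>" if "\<sigma> \<in> ?B" for \<sigma>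
    proof -
      have "\<sigma> \<subseteq> \<tau> \<or> \<tau> \<subseteq> \<sigma>" using C that t by (auto simp: chn_iff)
      moreover have "\<sigma> = \<tau>" if "\<tau> \<subseteq> \<sigma>"
        using refines[of \<tau> \<sigma>] R_antisym[of \<sigma> \<tau>] t \<open>\<sigma> \<in> ?B\<close> that Cf by blast
      ultimately show ?thesis by blast
    qed
    moreover have "\<tau> face_of P" using t Cf by (auto simp: faces_def)
    ultimately show ?thesis using t(1) by blast
  next
    case True
    then show ?thesis by (intro exI[of _ "{}"]) auto
  qed
  then obtain \<tau> where t: "\<tau> face_of P" "\<forall>\<sigma>\<in>?B. \<sigma> \<subseteq> \<tau>" "\<tau> = {} \<or> \<tau> \<in> ?B" by blast
  obtain a b where l: "\<And>x. x \<in> P \<Longrightarrow> 0 \<le> b - a \<bullet> x" "\<And>x. x \<in> P \<Longrightarrow> b - a \<bullet> x = 0 \<longleftrightarrow> x \<in> \<tau>"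
    using exposing_form[OF t(1)] by metis
  define l where "l \<sigma> = b - a \<bullet> rvec (pt \<sigma>)" for \<sigma>
  have lnn: "0 \<le> l \<sigma>" if "\<sigma> \<in> faces P" for \<sigma>
    using l(1) pt_in_face[OF that] face_subset[OF that] by (auto simp: l_def)
  have l0: "l \<sigma> = 0 \<longleftrightarrow> rvec (pt \<sigma>) \<in> \<tau>" if "\<sigma> \<in> faces P" for \<sigma>
    using l(2) pt_in_face[OF that] face_subset[OF that] by (auto simp: l_def)
  have form: "(\<Sum>\<sigma>\<in>faces P. v \<sigma> * l \<sigma>) = b * (\<Sum>\<sigma>\<in>faces P. v \<sigma>) - a \<bullet> (\<Sum>\<sigma>\<in>faces P. v \<sigma> *\<^sub>R rvec (pt \<sigma>))"
    for v
    by (simp add: l_def inner_sum_right sum_distrib_left right_diff_distrib sum_subtractf mult.commute)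
  have "0 = (\<Sum>\<sigma>\<in>faces P. (u \<sigma> - w \<sigma>) * l \<sigma>)"
    using form[of u] form[of w] eq1 eq2 by (simp add: left_diff_distrib sum_subtractf)
  also have "\<dots> \<ge> (\<Sum>\<sigma>\<in>faces P. if \<sigma> = \<rho> then (u \<rho> - w \<rho>) * l \<rho> else 0)"
  proof (rule sum_mono)
    fix \<sigma> assume s: "\<sigma> \<in> faces P"
    show "(if \<sigma> = \<rho> then (u \<rho> - w \<rho>) * l \<rho> else 0) \<le> (u \<sigma> - w \<sigma>) * l \<sigma>"
    proof (cases "\<sigma> = \<rho> \<or> (\<rho>, \<sigma>) \<in> R")
      case False
      then have "(\<sigma>, \<rho>) \<in> R" using R_total s \<rho> by blast
      then have "w \<sigma> * l \<sigma> = 0"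
        using w[of \<sigma>] t(2) False l0[OF s] pt_in_face[OF s] by (cases "\<sigma> \<in> C") auto
      then have e: "(u \<sigma> - w \<sigma>) * l \<sigma> = u \<sigma> * l \<sigma>" by (simp only: left_diff_distrib diff_zero)
      show ?thesis unfolding e using False u[of \<sigma>] lnn[OF s] by simp
    qed (use \<rho> s in auto)
  qed
  finally have "(u \<rho> - w \<rho>) * l \<rho> \<le> 0" using finite_faces \<rho> by (simp add: sum.delta)
  then have "l \<rho> = 0" using gt lnn[OF \<rho>(1)] by (auto simp: mult_le_0_iff)
  then have in\<tau>: "rvec (pt \<rho>) \<in> \<tau>" using l0 \<rho> by blast
  then have "\<rho> \<subseteq> \<tau>"
    using subset_of_face_of[OF t(1) face_subset[OF \<rho>(1)]] pt[OF \<rho>(1)] by blast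
  moreover have "\<tau> \<in> ?B" using t(3) in\<tau> by auto
  ultimately show False using refines[of \<rho> \<tau>] R_antisym[of \<rho> \<tau>] \<rho> Cf by auto
qed

lemma chain_points_independent:
  fixes d :: "'n face \<Rightarrow> real"
  assumes C: "chn C" and d: "\<And>\<sigma>. \<sigma> \<notin> C \<Longrightarrow> d \<sigma> = 0"
    and eq: "(\<Sum>\<sigma>\<in>faces P. d \<sigma>) = 0" "(\<Sum>\<sigma>\<in>faces P. d \<sigma> *\<^sub>R rvec (pt \<sigma>)) = 0"
  shows "d = (\<lambda>_. 0)"
proof (rule ccontr)
  assume ne: "d \<noteq> (\<lambda>_. 0)"
  have "\<forall>\<sigma>. \<sigma> \<notin> faces P \<longrightarrow> d \<sigma> = 0" using C d by (auto simp: chn_iff)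
  then obtain \<rho> where r: "\<rho> \<in> faces P" "d \<rho> \<noteq> 0" "\<forall>\<tau>\<in>faces P. (\<rho>, \<tau>) \<in> R \<and> \<tau> \<noteq> \<rho> \<longrightarrow> d \<tau> = 0"
    using largest_difference[OF ne] by blast
  have "0 \<le> d \<rho>"
    by (rule chain_coefficients_dominate[where u = "\<lambda>_. 0" and w = d, OF C d _ _ _ r(1)])
      (use r(3) eq in auto)
  moreover have "0 \<le> - d \<rho>"
    by (rule chain_coefficients_dominate[where u = "\<lambda>_. 0" and w = "\<lambda>\<sigma>. - d \<sigma>", OF C _ _ _ _ r(1)])
      (use r(3) eq d in \<open>auto simp: sum_negf\<close>)
  ultimately show False using r(2) by simp
qed

text \<open>The faces of a maximal chain have all dimensions from \<open>0\<close> to \<open>n\<close>: a gap could be filled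
  by a facet, or by a vertex at the bottom.\<close>

lemma max_chain_dims:
  assumes C: "C \<in> max_chains P" and d: "d \<le> CARD('n)"
  shows "\<exists>\<sigma>\<in>C. aff_dim \<sigma> = int d"
proof -
  have ch: "chn C" and mx: "\<And>D. chn D \<Longrightarrow> C \<subseteq> D \<Longrightarrow> D = C"
    using C by (subst (asm) max_chain_iff, blast)+
  have Cf: "C \<subseteq> faces P" and comp: "\<And>\<sigma> \<tau>. \<sigma> \<in> C \<Longrightarrow> \<tau> \<in> C \<Longrightarrow> \<sigma> \<subseteq> \<tau> \<or> \<tau> \<subseteq> \<sigma>"
    using ch by (auto simp: chn_iff)
  have add: "H \<in> C" if "H \<in> faces P" "\<And>\<tau>. \<tau> \<in> C \<Longrightarrow> H \<subseteq> \<tau> \<or> \<tau> \<subseteq> H" for H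
  proof -
    have "chn (insert H C)" using that ch by (auto simp: chn_iff)
    then show ?thesis using mx by blast
  qed
  have PC: "P \<in> C" by (rule add) (use P_in_faces face_subset Cf in auto)
  let ?U = "{\<sigma> \<in> C. int d \<le> aff_dim \<sigma>}"
  have "P \<in> ?U" using PC d full_dim by simp
  then obtain \<sigma> where s: "\<sigma> \<in> ?U" "\<forall>\<tau>\<in>?U. \<tau> \<subseteq> \<sigma> \<longrightarrow> \<sigma> = \<tau>"
    using finite_has_minimal[of ?U] chn_finite[OF ch] by auto
  have sf: "\<sigma> \<in> faces P" using s Cf by auto
  have above: "\<sigma> \<subseteq> \<tau>" if "\<tau> \<in> ?U" for \<tau> using s that comp by blast
  have cvx: "convex \<sigma>" using face_polyhedron[OF sf] polyhedron_imp_convex by blast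
  let ?D = "{\<tau> \<in> C. aff_dim \<tau> < int d}"
  have below: "\<tau> \<subseteq> \<sigma> \<and> \<tau> \<noteq> \<sigma>" if "\<tau> \<in> ?D" for \<tau>
    using comp[of \<tau> \<sigma>] that s aff_dim_subset[of \<sigma> \<tau>] by auto
  have "aff_dim \<sigma> = int d"
  proof (rule ccontr)
    assume "aff_dim \<sigma> \<noteq> int d"
    then have big: "int d < aff_dim \<sigma>" using s by auto
    have "\<exists>H. H face_of \<sigma> \<and> H \<noteq> {} \<and> H \<noteq> \<sigma> \<and> (\<forall>\<tau>\<in>?D. \<tau> \<subseteq> H) \<and> H \<notin> ?D"
    proof (cases "?D = {}")
      case True
      obtain x where x: "x extreme_point_of \<sigma>"
        using extreme_point_exists_convex[of \<sigma>] face_polytope[OF sf] polytope_imp_compact cvx sf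
        by (auto simp: faces_def)
      then have "{x} \<noteq> \<sigma>" using big by (metis aff_dim_sing le_less_trans less_irrefl of_nat_0_le_iff)
      then show ?thesis using x True by (intro exI[of _ "{x}"]) (auto simp: face_of_singleton)
    next
      case False
      then obtain \<tau> where t: "\<tau> \<in> ?D" "\<forall>\<rho>\<in>?D. \<tau> \<subseteq> \<rho> \<longrightarrow> \<tau> = \<rho>"
        using finite_has_maximal[of ?D] chn_finite[OF ch] by auto
      have top: "\<rho> \<subseteq> \<tau>" if "\<rho> \<in> ?D" for \<rho> using t that comp by blast
      have tf: "\<tau> \<in> faces P" using t Cf by auto
      obtain H where H: "H facet_of \<sigma>" "\<tau> \<subseteq> H"
        using face_of_polyhedron_subset_facet[OF face_polyhedron[OF sf], of \<tau>]
          face_of_subset_face[OF sf tf] below[OF t(1)] tf by (auto simp: faces_def)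
      then have "int d \<le> aff_dim H" using big by (simp add: facet_of_def)
      then show ?thesis
        using H top big by (intro exI[of _ H]) (auto simp: facet_of_def)
    qed
    then obtain H where H: "H face_of \<sigma>" "H \<noteq> {}" "H \<noteq> \<sigma>" "\<forall>\<tau>\<in>?D. \<tau> \<subseteq> H" "H \<notin> ?D" by blast
    have "H \<in> C"
    proof (rule add)
      show "H \<in> faces P" using H sf face_of_face by blast
      fix \<tau> assume "\<tau> \<in> C"
      then show "H \<subseteq> \<tau> \<or> \<tau> \<subseteq> H"
        using above[of \<tau>] H face_of_imp_subset[OF H(1)] by (cases "\<tau> \<in> ?D") auto
    qed
    then have "\<sigma> \<subseteq> H" using above[of H] H by auto
    then show False using H face_of_imp_subset by blast
  qed
  then show ?thesis using s by blast
qed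

lemma card_max_chain:
  assumes C: "C \<in> max_chains P" shows "CARD('n) + 1 \<le> card C"
proof -
  have "int ` {0..CARD('n)} \<subseteq> aff_dim ` C"
    using max_chain_dims[OF C] by (force simp: image_iff)
  then have "card (int ` {0..CARD('n)}) \<le> card (aff_dim ` C)"
    using chn_finite[OF max_chain_chn[OF C]] by (intro card_mono) auto
  also have "\<dots> \<le> card C" using chn_finite[OF max_chain_chn[OF C]] by (rule card_image_le)
  finally show ?thesis by (simp add: card_image)
qed

text \<open>The coefficient functions \<open>u\<close> with \<open>s = \<Sum> u \<sigma> (1, pt \<sigma>)\<close>.\<close>

definition combo :: "('n face \<Rightarrow> rat) \<Rightarrow> 'n wt \<Rightarrow> bool" where
  "combo u s \<longleftrightarrow> (\<forall>\<sigma>. \<sigma> \<notin> faces P \<longrightarrow> u \<sigma> = 0) \<and> of_int (fst s) = (\<Sum>\<sigma>\<in>faces P. u \<sigma>) \<and>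
    (\<forall>i. of_int (snd s $ i) = (\<Sum>\<sigma>\<in>faces P. u \<sigma> * of_int (pt \<sigma> $ i)))"

lemma combo_real:
  assumes "combo u s"
  shows "(\<Sum>\<sigma>\<in>faces P. real_of_rat (u \<sigma>)) = of_int (fst s)"
    and "(\<Sum>\<sigma>\<in>faces P. real_of_rat (u \<sigma>) *\<^sub>R rvec (pt \<sigma>)) = rvec (snd s)"
proof -
  have "real_of_rat (of_int (fst s)) = (\<Sum>\<sigma>\<in>faces P. real_of_rat (u \<sigma>))"
    using assms unfolding combo_def by (simp add: of_rat_sum)
  then show "(\<Sum>\<sigma>\<in>faces P. real_of_rat (u \<sigma>)) = of_int (fst s)" by simp
  have "real_of_rat (of_int (snd s $ i)) = (\<Sum>\<sigma>\<in>faces P. real_of_rat (u \<sigma>) * of_int (pt \<sigma> $ i))" for i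
    using assms unfolding combo_def by (simp add: of_rat_sum of_rat_mult)
  then show "(\<Sum>\<sigma>\<in>faces P. real_of_rat (u \<sigma>) *\<^sub>R rvec (pt \<sigma>)) = rvec (snd s)"
    by (simp add: vec_eq_iff rvec_def)
qed

lemma combo_support: "combo u s \<Longrightarrow> \<sigma> \<notin> faces P \<Longrightarrow> u \<sigma> = 0"
  by (simp add: combo_def)

lemma combo_add: "combo u s \<Longrightarrow> combo w s' \<Longrightarrow> combo (u + w) (s + s')"
  by (simp add: combo_def sum.distrib algebra_simps)

lemma combo_0 [simp]: "combo 0 0"
  by (simp add: combo_def)

lemma combo_unique_weight: "combo u s \<Longrightarrow> combo u s' \<Longrightarrow> s = s'"
  unfolding combo_def by (metis of_int_eq_iff prod_eq_iff vec_eq_iff)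

text \<open>Of all nonnegative coefficients of \<open>s\<close>, those on a chain are lexicographically largest; in
  particular they are unique. They are also smallest among the coordinates of \<open>s\<close> on arbitrary
  chains.\<close>

lemma combo_lex_le:
  assumes u: "combo u s" "\<And>\<sigma>. 0 \<le> u \<sigma>" and w: "combo w s" and C: "chn C" "\<And>\<sigma>. \<sigma> \<notin> C \<Longrightarrow> w \<sigma> = 0"
  shows "lex_le P R u w"
proof (cases "u = w")
  case False
  obtain \<rho> where r: "\<rho> \<in> faces P" "u \<rho> \<noteq> w \<rho>" "\<forall>\<tau>\<in>faces P. (\<rho>, \<tau>) \<in> R \<and> \<tau> \<noteq> \<rho> \<longrightarrow> u \<tau> = w \<tau>"
    using largest_difference[OF False] combo_support[OF u(1)] combo_support[OF w] by auto
  have "real_of_rat (u \<rho>) \<le> real_of_rat (w \<rho>)"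
    by (rule chain_coefficients_dominate[OF C(1) _ _ _ _ r(1)])
      (use C u r in \<open>auto simp: combo_real[OF u(1)] combo_real[OF w]\<close>)
  then show ?thesis using r unfolding lex_le_def by (auto simp: of_rat_less_eq intro!: bexI[of _ \<rho>])
qed simp

lemma combo_chain_unique_real:
  fixes d :: "'n face \<Rightarrow> real"
  assumes C: "chn C" and w: "combo w s" "\<And>\<sigma>. \<sigma> \<notin> C \<Longrightarrow> w \<sigma> = 0" and d: "\<And>\<sigma>. \<sigma> \<notin> C \<Longrightarrow> d \<sigma> = 0"
    and eq: "(\<Sum>\<sigma>\<in>faces P. d \<sigma>) = of_int (fst s)"
      "(\<Sum>\<sigma>\<in>faces P. d \<sigma> *\<^sub>R rvec (pt \<sigma>)) = rvec (snd s)"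
  shows "d \<sigma> = real_of_rat (w \<sigma>)"
proof -
  have "(\<lambda>\<sigma>. d \<sigma> - real_of_rat (w \<sigma>)) = (\<lambda>_. 0)"
    by (rule chain_points_independent[OF C])
      (use w d in \<open>auto simp: eq combo_real[OF w(1)] sum_subtractf scaleR_diff_left\<close>)
  then show ?thesis by (metis diff_eq_diff_eq diff_self)
qed

lemma combo_chain_unique:
  assumes "chn C" "combo w s" "\<And>\<sigma>. \<sigma> \<notin> C \<Longrightarrow> w \<sigma> = 0" "combo w' s" "\<And>\<sigma>. \<sigma> \<notin> C \<Longrightarrow> w' \<sigma> = 0"
  shows "w' = w"
proof
  fix \<sigma>
  have "real_of_rat (w' \<sigma>) = real_of_rat (w \<sigma>)"
    by (rule combo_chain_unique_real[OF assms(1,2)])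
      (use assms in \<open>auto simp: combo_real[OF assms(4)]\<close>)
  then show "w' \<sigma> = w \<sigma>" by simp
qed

text \<open>A maximal chain gives \<open>n + 1\<close> independent points \<open>(1, pt \<sigma>)\<close>, hence a basis of
  \<open>\<rat> \<oplus> M\<^sub>\<rat>\<close>, realised here as vectors indexed by an option type.\<close>

lemma max_chain_spans:
  assumes C: "C \<in> max_chains P"
  shows "\<exists>w. combo w s \<and> (\<forall>\<sigma>. \<sigma> \<notin> C \<longrightarrow> w \<sigma> = 0)"
proof -
  have ch: "chn C" using max_chain_chn[OF C] .
  have Cf: "C \<subseteq> faces P" and fin: "finite C" using ch chn_finite by (auto simp: chn_iff)
  define V :: "'n wt \<Rightarrow> rat ^ ('n option)"
    where "V s = (\<chi> j. case j of None \<Rightarrow> of_int (fst s) | Some i \<Rightarrow> of_int (snd s $ i))" for s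
  let ?W = "\<lambda>\<sigma>. V (1, pt \<sigma>)"
  have combo_iff: "combo w s \<longleftrightarrow> V s = (\<Sum>\<sigma>\<in>C. w \<sigma> *s ?W \<sigma>)"
    if w: "\<forall>\<sigma>. \<sigma> \<notin> C \<longrightarrow> w \<sigma> = 0" for w s
  proof -
    have sums: "(\<Sum>\<sigma>\<in>faces P. w \<sigma> * F \<sigma>) = (\<Sum>\<sigma>\<in>C. w \<sigma> * F \<sigma>)" for F :: "'n face \<Rightarrow> rat"
      by (rule sum.mono_neutral_right) (use Cf finite_faces w in auto)
    have all: "(\<forall>j. Q j) \<longleftrightarrow> Q None \<and> (\<forall>i. Q (Some i))" for Q :: "'n option \<Rightarrow> bool"
      by (metis option.exhaust)
    show ?thesis
      unfolding combo_def vec_eq_iff all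
      using w Cf sums[of "\<lambda>_. 1"] sums by (auto simp: V_def)
  qed
  have indep: "w = (\<lambda>_. 0)" if "\<forall>\<sigma>. \<sigma> \<notin> C \<longrightarrow> w \<sigma> = 0" "(\<Sum>\<sigma>\<in>C. w \<sigma> *s ?W \<sigma>) = 0" for w
  proof -
    have "V 0 = 0" by (auto simp: V_def vec_eq_iff split: option.split)
    then have "combo w 0" using combo_iff[OF that(1)] that(2) by simp
    then have "w = 0" using combo_chain_unique[OF ch combo_0] that(1) by simp
    then show ?thesis by (simp add: zero_fun_def)
  qed
  have inj: "inj_on ?W C"
  proof (rule inj_onI, rule ccontr)
    fix \<sigma> \<tau> assume st: "\<sigma> \<in> C" "\<tau> \<in> C" "?W \<sigma> = ?W \<tau>" "\<sigma> \<noteq> \<tau>"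
    let ?w = "\<lambda>\<rho>. (if \<rho> = \<sigma> then 1 else 0) - (if \<rho> = \<tau> then 1 else 0) :: rat"
    have "(\<Sum>\<rho>\<in>C. ?w \<rho> *s ?W \<rho>) = 0"
      using st fin
      by (simp add: vec.scale_left_diff_distrib sum_subtractf if_distrib[of "\<lambda>z. z *s _"]
          sum.delta cong: if_cong)
    then have "?w = (\<lambda>_. 0)" using indep[of ?w] st by auto
    from fun_cong[OF this, of \<sigma>] show False using st by simp
  qed
  have "vec.independent (?W ` C)"
  proof
    assume "vec.dependent (?W ` C)"
    then obtain u where u: "\<exists>v\<in>?W ` C. u v \<noteq> 0" "(\<Sum>v\<in>?W ` C. u v *s v) = 0"
      using vec.dependent_finite[of "?W ` C"] fin by auto
    let ?w = "\<lambda>\<sigma>. if \<sigma> \<in> C then u (?W \<sigma>) else 0"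
    have "(\<Sum>\<sigma>\<in>C. ?w \<sigma> *s ?W \<sigma>) = (\<Sum>v\<in>?W ` C. u v *s v)"
      by (simp add: sum.reindex[OF inj])
    then have "?w = (\<lambda>_. 0)" using indep[of ?w] u(2) by auto
    then have z: "?w \<sigma> = (\<lambda>_. 0) \<sigma>" for \<sigma> by (rule fun_cong)
    have "u (?W \<sigma>) = 0" if "\<sigma> \<in> C" for \<sigma> using z[of \<sigma>] that by simp
    then show False using u(1) by blast
  qed
  moreover have "vec.dim (UNIV :: (rat ^ ('n option)) set) \<le> card (?W ` C)"
  proof -
    have "CARD('n option) = Suc CARD('n)" by (simp add: UNIV_option_conv card_image)
    then show ?thesis unfolding vec_dim_card using card_max_chain[OF C] card_image[OF inj] by simp
  qed
  ultimately have "V s \<in> vec.span (?W ` C)"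
    using vec.card_ge_dim_independent[of "?W ` C" UNIV] by blast
  then obtain u where u: "V s = (\<Sum>v\<in>?W ` C. u v *s v)"
    using vec.span_finite[of "?W ` C"] fin by auto
  let ?w = "\<lambda>\<sigma>. if \<sigma> \<in> C then u (?W \<sigma>) else 0"
  have "(\<Sum>\<sigma>\<in>C. ?w \<sigma> *s ?W \<sigma>) = V s"
    unfolding u by (simp add: sum.reindex[OF inj])
  then have "combo ?w s" using combo_iff[of ?w s] by simp
  then show ?thesis by (intro exI[of _ ?w]) auto
qed

text \<open>The simplices of chains cover every face: the ray from \<open>pt \<sigma>\<close> through a point of
  \<open>\<sigma>\<close> leaves \<open>\<sigma>\<close> through a facet, whose chains are extended by \<open>\<sigma>\<close>.\<close>

lemma chains_cover:
  assumes "\<sigma> \<in> faces P" "z \<in> \<sigma>"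
  shows "\<exists>D u. chn D \<and> (\<forall>\<tau>\<in>D. \<tau> \<subseteq> \<sigma>) \<and> (\<forall>\<tau>\<in>D. 0 \<le> u \<tau>) \<and> (\<Sum>\<tau>\<in>D. u \<tau>) = (1::real) \<and>
    (\<Sum>\<tau>\<in>D. u \<tau> *\<^sub>R rvec (pt \<tau>)) = z"
  using assms
proof (induction "nat (aff_dim \<sigma> + 1)" arbitrary: \<sigma> z rule: less_induct)
  case less
  have conv: "convex \<sigma>" and bd: "bounded \<sigma>"
    using face_polytope[OF less.prems(1)] by (auto simp: polytope_imp_convex polytope_imp_bounded)
  show ?case
  proof (cases "z = rvec (pt \<sigma>)")
    case True
    then show ?thesis
      using less.prems by (intro exI[of _ "{\<sigma>}"] exI[of _ "\<lambda>_. 1"]) (auto simp: chn_iff)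
  next
    case False
    then obtain y where y: "y \<in> rel_frontier \<sigma>" "z \<in> closed_segment (rvec (pt \<sigma>)) y"
      using segment_to_rel_frontier_aux[OF conv bd pt[OF less.prems(1)] less.prems(2)] by metis
    obtain t where t: "0 \<le> t" "t \<le> 1" "z = (1 - t) *\<^sub>R rvec (pt \<sigma>) + t *\<^sub>R y"
      using y(2) by (auto simp: closed_segment_def)
    obtain F where F: "F facet_of \<sigma>" "y \<in> F"
      using y(1) rel_frontier_of_polyhedron[OF face_polyhedron[OF less.prems(1)]] by auto
    have Ff: "F face_of \<sigma>" "F \<noteq> {}" and dim: "aff_dim F = aff_dim \<sigma> - 1"
      using F by (auto simp: facet_of_def)
    have FP: "F \<in> faces P" using Ff face_of_face less.prems by blast
    have "0 \<le> aff_dim F" using Ff(2) aff_dim_geq[of F] by (simp add: aff_dim_negative_iff not_less[symmetric])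
    then have "nat (aff_dim F + 1) < nat (aff_dim \<sigma> + 1)" using dim by simp
    from less.hyps[OF this FP F(2)] obtain D u where D: "chn D" "\<forall>\<tau>\<in>D. \<tau> \<subseteq> F" "\<forall>\<tau>\<in>D. 0 \<le> u \<tau>"
      "(\<Sum>\<tau>\<in>D. u \<tau>) = (1::real)" "(\<Sum>\<tau>\<in>D. u \<tau> *\<^sub>R rvec (pt \<tau>)) = y" by auto
    have sub: "F \<subseteq> \<sigma>" "F \<noteq> \<sigma>" using face_of_imp_subset[OF Ff(1)] dim by auto
    then have nin: "\<sigma> \<notin> D" using D(2) by blast
    let ?u = "\<lambda>\<tau>. if \<tau> = \<sigma> then 1 - t else t * u \<tau>"
    have eqs: "(\<Sum>\<tau>\<in>D. ?u \<tau>) = (\<Sum>\<tau>\<in>D. t * u \<tau>)"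
      "(\<Sum>\<tau>\<in>D. ?u \<tau> *\<^sub>R rvec (pt \<tau>)) = (\<Sum>\<tau>\<in>D. t *\<^sub>R (u \<tau> *\<^sub>R rvec (pt \<tau>)))"
      by (rule sum.cong; use nin in auto)+
    have A: "(\<Sum>\<tau>\<in>insert \<sigma> D. ?u \<tau>) = 1"
      using nin chn_finite[OF D(1)] eqs(1) D(4) by (simp add: sum_distrib_left[symmetric])
    have B: "(\<Sum>\<tau>\<in>insert \<sigma> D. ?u \<tau> *\<^sub>R rvec (pt \<tau>)) = z"
      using nin chn_finite[OF D(1)] eqs(2) t(3) by (simp add: scaleR_sum_right flip: D(5))
    have E: "chn (insert \<sigma> D)"
      using D(1,2) sub less.prems by (auto simp: chn_iff)
    have F': "\<forall>\<tau>\<in>insert \<sigma> D. \<tau> \<subseteq> \<sigma>" using D(2) sub by auto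
    have G: "\<forall>\<tau>\<in>insert \<sigma> D. 0 \<le> ?u \<tau>" using D(3) t by auto
    show ?thesis
      by (intro exI[of _ "insert \<sigma> D"] exI[of _ ?u] conjI E F' G A B)
  qed
qed


section \<open>The quasi-valuation of a basis element\<close>

definition supp :: "('n face \<Rightarrow> rat) \<Rightarrow> 'n face set" where
  "supp u = {\<sigma>. u \<sigma> \<noteq> 0}"

text \<open>The coordinates of \<open>s\<close> on a chain whose cone contains \<open>s\<close>.\<close>

definition val :: "'n wt \<Rightarrow> ('n face \<Rightarrow> rat)" where
  "val s = (THE u. combo u s \<and> (\<forall>\<sigma>. 0 \<le> u \<sigma>) \<and> chn (supp u))"

lemma val_eqI:
  assumes "combo u s" "\<And>\<sigma>. 0 \<le> u \<sigma>" "chn (supp u)" shows "val s = u"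
  unfolding val_def
proof (rule the_equality)
  fix w assume w: "combo w s \<and> (\<forall>\<sigma>. 0 \<le> w \<sigma>) \<and> chn (supp w)"
  have "lex_le P R u w" "lex_le P R w u"
    by (rule combo_lex_le[where C = "supp w"] combo_lex_le[where C = "supp u"];
        use w assms in \<open>auto simp: supp_def\<close>)+
  then show "w = u" using lex_le_antisym by blast
qed (use assms in auto)

lemma val_of_max_chain:
  assumes C: "C \<in> max_chains P" and w: "combo w s" "\<forall>\<sigma>. \<sigma> \<notin> C \<longrightarrow> w \<sigma> = 0" and "\<forall>\<sigma>. 0 \<le> w \<sigma>"
  shows "val s = w"
  by (rule val_eqI) (use assms chn_subset[OF max_chain_chn[OF C], of "supp w"] in \<open>auto simp: supp_def\<close>)

lemma cone_point_in_polytope: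
  assumes "s \<in> cone_monoid (lattice_points P)" "s \<noteq> 0"
  shows "0 < fst s" "(1 / of_int (fst s)) *\<^sub>R rvec (snd s) \<in> P"
proof -
  let ?L = "lattice_points P"
  obtain a :: "'n chr \<Rightarrow> nat" where a: "s = (\<Sum>x\<in>?L. int (a x), \<Sum>x\<in>?L. of_nat (a x) *s x)"
    using assms by (auto simp: cone_monoid_def)
  then have f: "fst s = (\<Sum>x\<in>?L. int (a x))" and g: "snd s = (\<Sum>x\<in>?L. of_nat (a x) *s x)" by simp_all
  have nn: "0 \<le> fst s" unfolding f by (simp add: sum_nonneg)
  have fin: "finite ?L" if "fst s \<noteq> 0"
    by (rule ccontr) (use that in \<open>simp add: f\<close>)
  have "fst s \<noteq> 0"
  proof
    assume 0: "fst s = 0"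
    have "snd s = 0"
    proof (cases "finite ?L")
      case True
      then have "\<forall>x\<in>?L. a x = 0" using 0 unfolding f by (subst (asm) sum_nonneg_eq_0_iff) auto
      then show ?thesis unfolding g by simp
    qed (simp add: g)
    then show False using 0 assms(2) by (simp add: prod_eq_iff)
  qed
  with nn show pos: "0 < fst s" by simp
  have "(\<Sum>x\<in>?L. (real (a x) / of_int (fst s)) *\<^sub>R rvec x) \<in> P"
  proof (rule convex_sum[OF fin])
    show "convex P" using polytope_P polytope_imp_convex by blast
    show "(\<Sum>x\<in>?L. real (a x) / of_int (fst s)) = 1"
    proof -
      have "(\<Sum>x\<in>?L. real (a x)) = of_int (fst s)" by (simp add: f)
      then show ?thesis using pos by (simp add: sum_divide_distrib[symmetric])
    qed
  qed (use pos in \<open>auto simp: lattice_points_def\<close>)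
  moreover have "(\<Sum>x\<in>?L. (real (a x) / of_int (fst s)) *\<^sub>R rvec x) = (1 / of_int (fst s)) *\<^sub>R rvec (snd s)"
    by (simp add: g vec_eq_iff rvec_def sum_divide_distrib)
  ultimately show "(1 / of_int (fst s)) *\<^sub>R rvec (snd s) \<in> P" by simp
qed

text \<open>The cones over the simplices cover the cone over the polytope. The real coordinates found this
  way agree with the rational ones on a maximal chain.\<close>

lemma val_props:
  assumes "s \<in> cone_monoid (lattice_points P)"
  shows "combo (val s) s" "0 \<le> val s \<sigma>" "chn (supp (val s))"
proof -
  have "\<exists>u. combo u s \<and> (\<forall>\<sigma>. 0 \<le> u \<sigma>) \<and> chn (supp u)"
  proof (cases "s = 0")
    case True
    then show ?thesis by (intro exI[of _ 0]) (auto simp: supp_def chn_iff)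
  next
    case False
    note pos = cone_point_in_polytope[OF assms False]
    let ?m = "of_int (fst s) :: real"
    obtain D u where D: "chn D" "\<forall>\<tau>\<in>D. 0 \<le> u \<tau>" "(\<Sum>\<tau>\<in>D. u \<tau>) = (1::real)"
      "(\<Sum>\<tau>\<in>D. u \<tau> *\<^sub>R rvec (pt \<tau>)) = (1 / ?m) *\<^sub>R rvec (snd s)"
      using chains_cover[OF P_in_faces pos(2)] by blast
    obtain C where C: "C \<in> max_chains P" "D \<subseteq> C" using chain_extends_to_max_chain[OF D(1)] .
    obtain w where w: "combo w s" "\<forall>\<sigma>. \<sigma> \<notin> C \<longrightarrow> w \<sigma> = 0" using max_chain_spans[OF C(1)] by blast
    let ?d = "\<lambda>\<sigma>. if \<sigma> \<in> D then ?m * u \<sigma> else 0"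
    have Df: "D \<subseteq> faces P" using D(1) by (simp add: chn_iff)
    have "(\<Sum>\<sigma>\<in>faces P. ?d \<sigma>) = (\<Sum>\<sigma>\<in>D. ?m * u \<sigma>)"
      using finite_faces Df by (simp add: sum.If_cases Int_absorb1)
    then have e1: "(\<Sum>\<sigma>\<in>faces P. ?d \<sigma>) = ?m" using D(3) by (simp add: sum_distrib_left[symmetric])
    have e: "(\<Sum>\<sigma>\<in>faces P. ?d \<sigma> *\<^sub>R rvec (pt \<sigma>)) = (\<Sum>\<sigma>\<in>D. ?m *\<^sub>R (u \<sigma> *\<^sub>R rvec (pt \<sigma>)))"
      by (rule sum.mono_neutral_cong_right) (use finite_faces Df in auto)
    have e2: "(\<Sum>\<sigma>\<in>faces P. ?d \<sigma> *\<^sub>R rvec (pt \<sigma>)) = rvec (snd s)"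
    proof -
      have "rvec (snd s) = ?m *\<^sub>R (\<Sum>\<tau>\<in>D. u \<tau> *\<^sub>R rvec (pt \<tau>))" using D(4) pos(1) by simp
      with e show ?thesis by (simp add: scaleR_sum_right)
    qed
    have "?d \<sigma> = real_of_rat (w \<sigma>)" for \<sigma>
      by (rule combo_chain_unique_real[OF max_chain_chn[OF C(1)] w(1) _ _ e1 e2])
        (use w C in auto)
    then have "0 \<le> real_of_rat (w \<sigma>)" for \<sigma>
      using D(2) pos(1) by (metis less_imp_le mult_nonneg_nonneg of_int_0_le_iff order_refl)
    then have "\<forall>\<sigma>. 0 \<le> w \<sigma>" by simp
    then show ?thesis
      using w chn_subset[OF max_chain_chn[OF C(1)], of "supp w"] by (auto simp: supp_def)
  qed
  then obtain u where u: "combo u s" "\<And>\<sigma>. 0 \<le> u \<sigma>" "chn (supp u)" by blast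
  then have "val s = u" by (rule val_eqI)
  then show "combo (val s) s" "0 \<le> val s \<sigma>" "chn (supp (val s))" using u by auto
qed

lemma val_inj: "s \<in> cone_monoid (lattice_points P) \<Longrightarrow> s' \<in> cone_monoid (lattice_points P) \<Longrightarrow> val s = val s' \<Longrightarrow> s = s'"
  using val_props(1) combo_unique_weight by metis

lemma val_support: "s \<in> cone_monoid (lattice_points P) \<Longrightarrow> \<sigma> \<notin> faces P \<Longrightarrow> val s \<sigma> = 0"
  using val_props(1) combo_support by blast

lemma val_0 [simp]: "val 0 = 0"
  by (rule val_eqI) (auto simp: supp_def chn_iff)

lemma val_lex_le:
  assumes "s \<in> cone_monoid (lattice_points P)" "combo w s" "chn C" "\<And>\<sigma>. \<sigma> \<notin> C \<Longrightarrow> w \<sigma> = 0"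
  shows "lex_le P R (val s) w"
  by (rule combo_lex_le[OF val_props(1)[OF assms(1)] val_props(2)[OF assms(1)] assms(2-4)])

text \<open>The next facts decide which products survive in the graded ring: the sum of the values of the
  factors is a nonnegative combination for the product, hence at most its value, and it is this
  value exactly when the supports fit into one chain.\<close>

lemma nonneg_combo_le_val:
  assumes "s \<in> cone_monoid (lattice_points P)" "combo u s" "\<And>\<sigma>. 0 \<le> u \<sigma>" shows "lex_le P R u (val s)"
  by (rule combo_lex_le[OF assms(2,3) val_props(1)[OF assms(1)] val_props(3)[OF assms(1)]])
    (simp add: supp_def)

lemma val_add:
  assumes "s \<in> cone_monoid (lattice_points P)" "s' \<in> cone_monoid (lattice_points P)" "s + s' \<in> cone_monoid (lattice_points P)" shows "lex_le P R (val s + val s') (val (s + s'))"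
  by (rule nonneg_combo_le_val[OF assms(3) combo_add])
    (use assms val_props in \<open>auto intro: add_nonneg_nonneg\<close>)

lemma nonneg_combo_eq_val_iff:
  assumes "s \<in> cone_monoid (lattice_points P)" "combo u s" "\<And>\<sigma>. 0 \<le> u \<sigma>" shows "u = val s \<longleftrightarrow> chn (supp u)"
  using assms val_eqI val_props by metis

end


section \<open>Cosets of ideals\<close>

lemma coset_absorb:
  assumes "ideal I A" "y \<in> carrier A" "r \<in> I"
  shows "I +>\<^bsub>A\<^esub> (r \<oplus>\<^bsub>A\<^esub> y) = I +>\<^bsub>A\<^esub> y"
proof -
  interpret ideal I A by (rule assms(1))
  have "r \<oplus>\<^bsub>A\<^esub> y \<in> I +>\<^bsub>A\<^esub> y" using assms by (auto simp: a_r_coset_def')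
  then show ?thesis using a_repr_independence' assms by blast
qed

text \<open>In the graded ring, components of degrees \<open>a\<close> and \<open>b\<close> are cosets of different subgroups \<open>B\<close>
  and \<open>C\<close>, and their product is formed modulo a third one, \<open>I\<close>.\<close>

lemma rcoset_mult_mixed:
  fixes A (structure)
  assumes A: "cring A" and I: "ideal I A" and g: "g \<in> carrier A" and h: "h \<in> carrier A"
    and B: "B \<subseteq> carrier A" "\<zero>\<^bsub>A\<^esub> \<in> B" and C: "C \<subseteq> carrier A" "\<zero>\<^bsub>A\<^esub> \<in> C"
    and BI: "\<And>x. x \<in> B \<Longrightarrow> x \<otimes>\<^bsub>A\<^esub> h \<in> I" and CI: "\<And>y. y \<in> C \<Longrightarrow> g \<otimes>\<^bsub>A\<^esub> y \<in> I"
    and BC: "\<And>x y. x \<in> B \<Longrightarrow> y \<in> C \<Longrightarrow> x \<otimes>\<^bsub>A\<^esub> y \<in> I"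
  shows "rcoset_mult A I (B +>\<^bsub>A\<^esub> g) (C +>\<^bsub>A\<^esub> h) = I +>\<^bsub>A\<^esub> (g \<otimes>\<^bsub>A\<^esub> h)"
proof -
  interpret cring A by (rule A)
  interpret I: ideal I A by (rule I)
  have eq: "I +> ((x \<oplus> g) \<otimes> (y \<oplus> h)) = I +> (g \<otimes> h)" if xy: "x \<in> B" "y \<in> C" for x y
  proof -
    have c: "x \<in> carrier A" "y \<in> carrier A" using xy B C by auto
    have "(x \<oplus> g) \<otimes> (y \<oplus> h) = (x \<otimes> y \<oplus> x \<otimes> h \<oplus> g \<otimes> y) \<oplus> g \<otimes> h"
      using c g h by algebra
    moreover have "x \<otimes> y \<oplus> x \<otimes> h \<oplus> g \<otimes> y \<in> I"
      using BI CI BC xy by (intro I.a_closed)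
    ultimately show ?thesis using coset_absorb[OF I] g h by simp
  qed
  have sets: "B +> g = (\<lambda>x. x \<oplus> g) ` B" "C +> h = (\<lambda>y. y \<oplus> h) ` C"
    by (auto simp: a_r_coset_def')
  show ?thesis
    unfolding rcoset_mult_def sets using eq B(2) C(2) by auto
qed


section \<open>The quasi-valuation on the coordinate ring\<close>

text \<open>Here \<open>pt \<sigma>\<close> is the point \<open>- \<mu>\<^sub>\<sigma> / deg f\<^sub>\<sigma>\<close>, a lattice point because the degree is one.\<close>

locale degree_one_stratification = marked_polytope P R pt
  for P :: "'n::finite face" and R :: "'n face rel" and pt :: "'n face \<Rightarrow> 'n chr" +
  fixes f :: "'n face \<Rightarrow> ('n, 'k::field_char_0) func"
  assumes weight_f: "\<And>\<sigma>. \<sigma> \<in> faces P \<Longrightarrow> weight (lattice_points P) (f \<sigma>) = (- 1, - pt \<sigma>)"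
    and hom_deg_f: "\<And>\<sigma>. \<sigma> \<in> faces P \<Longrightarrow> hom_deg (lattice_points P) (f \<sigma>) = 1"
begin

abbreviation "\<Lambda> \<equiv> lattice_points P"

lemma pt_lattice: "\<sigma> \<in> faces P \<Longrightarrow> pt \<sigma> \<in> \<Lambda>"
  using pt_in_face face_subset by (auto simp: lattice_points_def)

lemma finite_lattice_points: "finite \<Lambda>"
proof -
  obtain B where B: "\<And>x. x \<in> P \<Longrightarrow> norm x \<le> B"
    using polytope_imp_bounded[OF polytope_P] by (auto simp: bounded_iff)
  have "\<Lambda> \<subseteq> vec_lambda ` (PiE UNIV (\<lambda>_. {- \<lceil>B\<rceil>..\<lceil>B\<rceil>}))"
  proof
    fix x :: "'n chr" assume "x \<in> \<Lambda>"
    then have "norm (rvec x) \<le> B" using B by (simp add: lattice_points_def)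
    then have le: "\<bar>real_of_int (x $ i)\<bar> \<le> B" for i
      using component_le_norm_cart[of "rvec x" i] by (simp add: rvec_def)
    have "x $ i \<in> {- \<lceil>B\<rceil>..\<lceil>B\<rceil>}" for i
      using le[of i] by (simp add: abs_le_iff) linarith
    then show "x \<in> vec_lambda ` (PiE UNIV (\<lambda>_. {- \<lceil>B\<rceil>..\<lceil>B\<rceil>}))"
      by (intro image_eqI[of _ _ "vec_nth x"]) (auto simp: vec_nth_inverse)
  qed
  then show ?thesis by (rule finite_subset) (auto intro!: finite_imageI finite_PiE)
qed

sublocale character_set "lattice_points P"
  by unfold_locales (use finite_lattice_points pt_lattice[OF P_in_faces] in auto)

lemma chain_coords_combo:
  assumes C: "C \<in> max_chains P"
  shows "combo (chain_coords P f C (- s)) s \<and> (\<forall>\<sigma>. \<sigma> \<notin> C \<longrightarrow> chain_coords P f C (- s) \<sigma> = 0)"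
proof -
  have Cf: "C \<subseteq> faces P" using max_chain_chn[OF C] by (simp add: chn_iff)
  have iff: "((\<forall>\<sigma>. \<sigma> \<notin> C \<longrightarrow> a \<sigma> = 0) \<and>
       rat_of_int (fst (- s)) = (\<Sum>\<sigma>\<in>C. a \<sigma> * rat_of_int (fst (weight \<Lambda> (f \<sigma>)))) \<and>
       (\<forall>i. rat_of_int (snd (- s) $ i) = (\<Sum>\<sigma>\<in>C. a \<sigma> * rat_of_int (snd (weight \<Lambda> (f \<sigma>)) $ i))))
    \<longleftrightarrow> combo a s \<and> (\<forall>\<sigma>. \<sigma> \<notin> C \<longrightarrow> a \<sigma> = 0)" for a
  proof (cases "\<forall>\<sigma>. \<sigma> \<notin> C \<longrightarrow> a \<sigma> = 0")
    case True
    have sums: "(\<Sum>\<sigma>\<in>faces P. a \<sigma> * F \<sigma>) = (\<Sum>\<sigma>\<in>C. a \<sigma> * F \<sigma>)" for F :: "'n face \<Rightarrow> rat"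
      by (rule sum.mono_neutral_right) (use Cf finite_faces True in auto)
    have w: "(\<Sum>\<sigma>\<in>C. a \<sigma> * rat_of_int (fst (weight \<Lambda> (f \<sigma>)))) = - (\<Sum>\<sigma>\<in>C. a \<sigma>)"
      "(\<Sum>\<sigma>\<in>C. a \<sigma> * rat_of_int (snd (weight \<Lambda> (f \<sigma>)) $ i)) = - (\<Sum>\<sigma>\<in>C. a \<sigma> * rat_of_int (pt \<sigma> $ i))" for i
      unfolding sum_negf[symmetric] by (rule sum.cong; use Cf weight_f in auto)+
    have sum1: "(\<Sum>\<sigma>\<in>faces P. a \<sigma>) = (\<Sum>\<sigma>\<in>C. a \<sigma>)" using sums[of "\<lambda>_. 1"] by simp
    show ?thesis
      unfolding combo_def w sum1 sums using True Cf by auto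
  qed auto
  obtain w where w: "combo w s" "\<forall>\<sigma>. \<sigma> \<notin> C \<longrightarrow> w \<sigma> = 0" using max_chain_spans[OF C] by blast
  have "chain_coords P f C (- s) = w"
    unfolding chain_coords_def iff
  proof (rule the_equality)
    show "combo w s \<and> (\<forall>\<sigma>. \<sigma> \<notin> C \<longrightarrow> w \<sigma> = 0)" using w by simp
    fix a assume a: "combo a s \<and> (\<forall>\<sigma>. \<sigma> \<notin> C \<longrightarrow> a \<sigma> = 0)"
    show "a = w"
      by (rule combo_chain_unique[OF max_chain_chn[OF C] w(1)]) (simp_all only: a w(2)[rule_format] simp_thms a[THEN conjunct2, rule_format])
  qed
  then show ?thesis using w by simp
qed

lemma chain_val_eq:
  fixes g :: "('n, 'k) func"
  assumes C: "C \<in> max_chains P" and g: "g \<in> carrier K" "g \<noteq> \<zero>\<^bsub>K\<^esub>"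
  shows "\<exists>s. fcoeff g s \<noteq> 0 \<and> chain_val P f R C g = chain_coords P f C (- s)"
    and "\<And>s. fcoeff g s \<noteq> 0 \<Longrightarrow> lex_le P R (chain_val P f R C g) (chain_coords P f C (- s))"
proof -
  let ?A = "(\<lambda>s. chain_coords P f C (- s)) ` {s. fcoeff g s \<noteq> 0}"
  have "{chain_coords P f C \<mu> |\<mu>. weight_components \<Lambda> g \<mu> \<noteq> \<zero>\<^bsub>K\<^esub>} = ?A"
    unfolding weight_components_nonzero[OF g(1)]
  proof (intro equalityI subsetI)
    fix a assume "a \<in> {chain_coords P f C \<mu> |\<mu>. fcoeff g (- \<mu>) \<noteq> 0}"
    then obtain \<mu> where "a = chain_coords P f C \<mu>" "fcoeff g (- \<mu>) \<noteq> 0" by blast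
    then show "a \<in> ?A" by (intro image_eqI[of _ _ "- \<mu>"]) auto
  next
    fix a assume "a \<in> ?A"
    then obtain s where "a = chain_coords P f C (- s)" "fcoeff g s \<noteq> 0" by blast
    then show "a \<in> {chain_coords P f C \<mu> |\<mu>. fcoeff g (- \<mu>) \<noteq> 0}"
      by (intro CollectI exI[of _ "- s"]) auto
  qed
  then have eq: "chain_val P f R C g = lex_min P R ?A" by (simp only: chain_val_def)
  have "lex_min P R ?A \<in> ?A \<and> (\<forall>b\<in>?A. lex_le P R (lex_min P R ?A) b)"
  proof (rule lex_min_exists)
    show "finite ?A" using finite_fcoeff[OF g(1)] by simp
    show "?A \<noteq> {}" using fcoeff_nonzeroE[OF g] by blast
  qed (use chain_coords_combo[OF C] combo_support in blast)
  then show "\<exists>s. fcoeff g s \<noteq> 0 \<and> chain_val P f R C g = chain_coords P f C (- s)"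
    "\<And>s. fcoeff g s \<noteq> 0 \<Longrightarrow> lex_le P R (chain_val P f R C g) (chain_coords P f C (- s))"
    unfolding eq by blast+
qed

lemma val_le_chain_coords:
  assumes "C \<in> max_chains P" "s \<in> S" shows "lex_le P R (val s) (chain_coords P f C (- s))"
  using val_lex_le[OF assms(2) _ max_chain_chn[OF assms(1)]] chain_coords_combo[OF assms(1)] by blast

lemma val_eq_chain_coords:
  assumes "s \<in> S" obtains C where "C \<in> max_chains P" "val s = chain_coords P f C (- s)"
proof -
  obtain C where C: "C \<in> max_chains P" "supp (val s) \<subseteq> C"
    using chain_extends_to_max_chain[OF val_props(3)[OF assms]] .
  have "chain_coords P f C (- s) = val s"
    by (rule combo_chain_unique[OF max_chain_chn[OF C(1)] val_props(1)[OF assms]])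
      (use C chain_coords_combo[OF C(1)] in \<open>auto simp: supp_def\<close>)
  then show ?thesis using that C by simp
qed

text \<open>The quasi-valuation of \<open>g\<close> is the least valuation of a basis element that occurs in \<open>g\<close>:
  on each such element the minimum over the chains is attained where the coordinates are
  nonnegative.\<close>

lemma quasi_val_eq:
  fixes g :: "('n, 'k) func"
  assumes g: "g \<in> carrier K" "g \<noteq> \<zero>\<^bsub>K\<^esub>"
  shows "\<exists>s. fcoeff g s \<noteq> 0 \<and> quasi_val P f R g = val s"
    and "\<And>s. fcoeff g s \<noteq> 0 \<Longrightarrow> lex_le P R (quasi_val P f R g) (val s)"
proof -
  let ?V = "(\<lambda>C. chain_val P f R C g) ` max_chains P"
  have inS: "s \<in> S" if "fcoeff g s \<noteq> 0" for s using fcoeff_in_cone_monoid[OF g(1) that] .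
  have eq: "quasi_val P f R g = lex_min P R ?V"
    unfolding quasi_val_def by (rule arg_cong[of _ _ "lex_min P R"]) blast
  have ne: "max_chains P \<noteq> {}"
    using chain_extends_to_max_chain[of "{}"] by (metis chn_iff empty_iff empty_subsetI)
  have min: "lex_min P R ?V \<in> ?V \<and> (\<forall>b\<in>?V. lex_le P R (lex_min P R ?V) b)"
  proof (rule lex_min_exists)
    show "finite ?V" using finite_max_chains by simp
    show "?V \<noteq> {}" using ne by blast
    fix a \<sigma> assume "a \<in> ?V" "\<sigma> \<notin> faces P"
    then obtain C where "C \<in> max_chains P" "a = chain_val P f R C g" by blast
    then show "a \<sigma> = 0"
      using chain_val_eq(1)[OF _ g] chain_coords_combo combo_support[OF _ \<open>\<sigma> \<notin> faces P\<close>] by metis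
  qed
  have le: "lex_le P R (quasi_val P f R g) (val s)" if s: "fcoeff g s \<noteq> 0" for s
  proof -
    obtain C where C: "C \<in> max_chains P" "val s = chain_coords P f C (- s)"
      using val_eq_chain_coords[OF inS[OF s]] .
    have "lex_le P R (quasi_val P f R g) (chain_val P f R C g)" using min C(1) unfolding eq by blast
    then show ?thesis using chain_val_eq(2)[OF C(1) g s] lex_le_trans C(2) by metis
  qed
  then show "\<And>s. fcoeff g s \<noteq> 0 \<Longrightarrow> lex_le P R (quasi_val P f R g) (val s)" .
  obtain C where C: "C \<in> max_chains P" "quasi_val P f R g = chain_val P f R C g"
    using min unfolding eq by blast
  obtain s where s: "fcoeff g s \<noteq> 0" "chain_val P f R C g = chain_coords P f C (- s)"
    using chain_val_eq(1)[OF C(1) g] by blast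
  have "lex_le P R (val s) (quasi_val P f R g)"
    using val_le_chain_coords[OF C(1) inS[OF s(1)]] s C by simp
  then have "quasi_val P f R g = val s" using le[OF s(1)] lex_le_antisym by blast
  then show "\<exists>s. fcoeff g s \<noteq> 0 \<and> quasi_val P f R g = val s" using s(1) by blast
qed

lemma elt_nonzero: "s \<in> S \<Longrightarrow> c \<noteq> 0 \<Longrightarrow> elt s c \<noteq> \<zero>\<^bsub>K\<^esub>"
  using fcoeff_elt[of s c s] by auto

lemma quasi_val_basis_fun:
  assumes s: "s \<in> S" shows "quasi_val P f R (basis_fun \<Lambda> s) = val s"
proof -
  have "(elt s 1 :: ('n, 'k) func) \<in> carrier K" "(elt s 1 :: ('n, 'k) func) \<noteq> \<zero>\<^bsub>K\<^esub>"
    by (simp_all add: s elt_closed elt_nonzero)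
  from quasi_val_eq(1)[OF this] show ?thesis
    unfolding basis_fun_elt[OF s] by (auto simp: fcoeff_elt[OF s] split: if_splits)
qed

lemma val_image_eq: "val_image P f R = val ` S"
proof
  show "val_image P f R \<subseteq> val ` S"
    using quasi_val_eq(1) fcoeff_in_cone_monoid unfolding val_image_def by blast
  show "val ` S \<subseteq> val_image P f R"
  proof
    fix a assume "a \<in> val ` S"
    then obtain s where s: "s \<in> S" "a = val s" by blast
    show "a \<in> val_image P f R"
      unfolding val_image_def
      by (rule image_eqI[of _ _ "basis_fun \<Lambda> s"])
        (use s quasi_val_basis_fun in \<open>auto simp: basis_fun_elt elt_closed elt_nonzero\<close>)
  qed
qed

lemma filt_ge_iff:
  "g \<in> filt_ge P f R a \<longleftrightarrow> g \<in> carrier K \<and> (\<forall>s. fcoeff g s \<noteq> 0 \<longrightarrow> lex_le P R a (val s))"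
proof (cases "g \<in> carrier K \<and> g \<noteq> \<zero>\<^bsub>K\<^esub>")
  case True
  then have g: "g \<in> carrier K" "g \<noteq> \<zero>\<^bsub>K\<^esub>" by auto
  have "lex_le P R a (quasi_val P f R g) \<longleftrightarrow> (\<forall>s. fcoeff g s \<noteq> 0 \<longrightarrow> lex_le P R a (val s))"
    using quasi_val_eq[OF g] lex_le_trans by metis
  then show ?thesis using g by (simp add: filt_ge_def)
qed (auto simp: filt_ge_def)

lemma filt_gt_iff:
  "g \<in> filt_gt P f R a \<longleftrightarrow>
    g \<in> carrier K \<and> (\<forall>s. fcoeff g s \<noteq> 0 \<longrightarrow> lex_le P R a (val s) \<and> val s \<noteq> a)"
proof (cases "g \<in> carrier K \<and> g \<noteq> \<zero>\<^bsub>K\<^esub>")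
  case True
  then have g: "g \<in> carrier K" "g \<noteq> \<zero>\<^bsub>K\<^esub>" by auto
  have "lex_le P R a (quasi_val P f R g) \<and> quasi_val P f R g \<noteq> a \<longleftrightarrow>
      (\<forall>s. fcoeff g s \<noteq> 0 \<longrightarrow> lex_le P R a (val s) \<and> val s \<noteq> a)"
    using quasi_val_eq[OF g] lex_le_trans lex_le_antisym by metis
  then show ?thesis using g by (simp add: filt_gt_def)
qed (auto simp: filt_gt_def)

lemma filt_gt_subset: "filt_gt P f R a \<subseteq> filt_ge P f R a"
  by (auto simp: filt_gt_iff filt_ge_iff)

lemma filt_gt_carrier: "filt_gt P f R a \<subseteq> carrier K"
  by (auto simp: filt_gt_iff)

lemma filt_ge_carrier: "filt_ge P f R a \<subseteq> carrier K"
  by (auto simp: filt_ge_iff)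

lemma filt_gt_zero: "\<zero>\<^bsub>K\<^esub> \<in> filt_gt P f R a"
proof -
  interpret K: cring "K :: ('n, 'k) func ring" by (rule cring_coord_ring)
  show ?thesis by (simp add: filt_gt_iff)
qed

text \<open>Superadditivity of \<open>val\<close> makes the filtration multiplicative.\<close>

lemma filt_mult_gt:
  assumes g: "g \<in> filt_ge P f R a" and h: "h \<in> filt_gt P f R b"
  shows "g \<otimes>\<^bsub>K\<^esub> h \<in> filt_gt P f R (a + b)"
proof -
  interpret K: cring "K :: ('n, 'k) func ring" by (rule cring_coord_ring)
  have c: "g \<in> carrier K" "h \<in> carrier K" using g h by (auto simp: filt_ge_iff filt_gt_iff)
  have "lex_le P R (a + b) (val s) \<and> val s \<noteq> a + b" if nz: "fcoeff (g \<otimes>\<^bsub>K\<^esub> h) s \<noteq> 0" for s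
  proof -
    obtain s1 s2 where s: "s = s1 + s2" "fcoeff g s1 \<noteq> 0" "fcoeff h s2 \<noteq> 0"
      using fcoeff_mult_nonzero[OF c nz] .
    have inS: "s1 \<in> S" "s2 \<in> S" "s1 + s2 \<in> S"
      using s fcoeff_in_cone_monoid c cone_monoid_add by blast+
    have l: "lex_le P R a (val s1)" "lex_le P R b (val s2)" "val s2 \<noteq> b"
      using s g h by (auto simp: filt_ge_iff filt_gt_iff)
    have m: "lex_le P R (a + b) (val s1 + val s2)" by (rule lex_le_add_mono[OF l(1,2)])
    then have "lex_le P R (a + b) (val s)" unfolding s(1) by (rule lex_le_trans[OF _ val_add[OF inS]])
    moreover have "val s \<noteq> a + b"
    proof
      assume "val s = a + b"
      then have "lex_le P R (val s1 + val s2) (a + b)" using val_add[OF inS] s(1) by simp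
      then have "a + b = val s1 + val s2" using m lex_le_antisym by blast
      then show False using lex_le_add_eqD[OF l(1,2)] l(3) by simp
    qed
    ultimately show ?thesis ..
  qed
  then show ?thesis using c by (auto simp: filt_gt_iff)
qed

lemma filt_ge_0: "filt_ge P f R 0 = carrier K"
proof -
  have "lex_le P R 0 (val s)" if "s \<in> S" for s
    by (rule nonneg_imp_lex_le_0) (use that val_props(2) val_support in blast)+
  then show ?thesis using fcoeff_in_cone_monoid unfolding set_eq_iff filt_ge_iff by blast
qed

lemma filt_gt_ideal: "ideal (filt_gt P f R a) (K :: ('n, 'k) func ring)"
proof -
  interpret K: cring "K :: ('n, 'k) func ring" by (rule cring_coord_ring)
  have mult: "x \<otimes>\<^bsub>K\<^esub> g \<in> filt_gt P f R a" if "g \<in> filt_gt P f R a" "x \<in> carrier K" for g x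
    using filt_mult_gt[of x 0 g a] that by (simp add: filt_ge_0)
  have add: "g \<oplus>\<^bsub>K\<^esub> h \<in> filt_gt P f R a" if "g \<in> filt_gt P f R a" "h \<in> filt_gt P f R a" for g h
  proof -
    have c: "g \<in> carrier K" "h \<in> carrier K" using that filt_gt_carrier by blast+
    have "fcoeff g s \<noteq> 0 \<or> fcoeff h s \<noteq> 0" if "fcoeff (g \<oplus>\<^bsub>K\<^esub> h) s \<noteq> 0" for s
      using that c by (auto simp: fcoeff_add)
    then show ?thesis using that c unfolding filt_gt_iff by (metis K.add.m_closed)
  qed
  show ?thesis
  proof (rule idealI)
    show "subgroup (filt_gt P f R a) (add_monoid K)"
    proof (rule subgroup.intro)
      fix g assume g: "g \<in> filt_gt P f R a"
      then have "(\<ominus>\<^bsub>K\<^esub> \<one>\<^bsub>K\<^esub>) \<otimes>\<^bsub>K\<^esub> g \<in> filt_gt P f R a" by (rule mult) simp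
      moreover have "(\<ominus>\<^bsub>K\<^esub> \<one>\<^bsub>K\<^esub>) \<otimes>\<^bsub>K\<^esub> g = \<ominus>\<^bsub>K\<^esub> g"
        using subsetD[OF filt_gt_carrier g] by (simp add: K.l_minus)
      ultimately show "inv\<^bsub>add_monoid K\<^esub> g \<in> filt_gt P f R a" by (simp add: a_inv_def)
    qed (use filt_gt_carrier filt_gt_zero add in auto)
    show "ring (K :: ('n, 'k) func ring)" by (rule K.ring_axioms)
    fix g x :: "('n, 'k) func" assume gx: "g \<in> filt_gt P f R a" "x \<in> carrier K"
    show "x \<otimes>\<^bsub>K\<^esub> g \<in> filt_gt P f R a" using mult gx .
    then show "g \<otimes>\<^bsub>K\<^esub> x \<in> filt_gt P f R a"
      using gx filt_gt_carrier K.m_comm[of g x] by (auto simp: subset_iff)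
  qed
qed


section \<open>The associated graded ring as a quotient of a polynomial ring\<close>

text \<open>The degree of a monomial in \<open>\<rat>^A\<close>: the variable \<open>s\<close> has degree \<open>val s\<close>.\<close>

definition dv :: "'n mon \<Rightarrow> ('n face \<Rightarrow> rat)" where
  "dv \<alpha> = (\<lambda>\<sigma>. \<Sum>s\<in>keys \<alpha>. of_nat (lookup \<alpha> s) * val s \<sigma>)"

lemma dv_add: "dv (\<alpha> + \<beta>) = dv \<alpha> + dv \<beta>"
  unfolding dv_def plus_fun_def
  by (rule ext, rule setsum_keys_plus_distrib) (auto simp: algebra_simps)

lemma dv_0 [simp]: "dv 0 = 0"
  by (simp add: dv_def zero_fun_def)

lemma dv_single: "dv (single s n) = (\<lambda>\<sigma>. of_nat n * val s \<sigma>)"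
  by (simp add: dv_def)

lemma dv_single_1 [simp]: "dv (single s 1) = val s" "dv (single s (Suc 0)) = val s"
  by (simp_all add: dv_single)

lemma dv_nonneg: "keys \<alpha> \<subseteq> S \<Longrightarrow> 0 \<le> dv \<alpha> \<sigma>"
  unfolding dv_def using val_props(2) by (auto intro!: sum_nonneg mult_nonneg_nonneg)

lemma combo_dv:
  assumes "keys \<alpha> \<subseteq> S" shows "combo (dv \<alpha>) (wt \<alpha>)"
proof -
  have "keys \<alpha> \<subseteq> S \<and> combo (dv \<alpha>) (wt \<alpha>)"
  proof (induction \<alpha> rule: mpoly_induct)
    case (single s n)
    then have s: "s \<in> S" using assms by blast
    have "combo (dv (single s n)) (wt (single s n))"
    proof (induction n)
      case 0
      show ?case using combo_0 by (simp only: single_zero dv_0 wt_0)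
    next
      case (Suc n)
      have "single s (Suc n) = single s 1 + single s n" by (simp add: single_add[symmetric])
      then have "dv (single s (Suc n)) = val s + dv (single s n)" "wt (single s (Suc n)) = s + wt (single s n)"
        by (simp_all only: dv_add wt_add dv_single_1 wt_single_1)
      then show ?case using combo_add[OF val_props(1)[OF s] Suc] by (simp only:)
    qed
    then show ?case using s by auto
  next
    case (add p q)
    then show ?case
      using keys_add[of p q] combo_add[of "dv p" "wt p" "dv q" "wt q"] unfolding dv_add wt_add by blast
  next
    case zero
    show ?case using combo_0 by (simp only: dv_0 wt_0 keys_zero empty_subsetI simp_thms)
  qed
  then show ?thesis by simp
qed

lemma dv_le_val: "keys \<alpha> \<subseteq> S \<Longrightarrow> lex_le P R (dv \<alpha>) (val (wt \<alpha>))"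
  by (rule nonneg_combo_le_val) (auto intro: wt_in_cone_monoid combo_dv dv_nonneg)

lemma dv_eq_val_iff: "keys \<alpha> \<subseteq> S \<Longrightarrow> dv \<alpha> = val (wt \<alpha>) \<longleftrightarrow> chn (supp (dv \<alpha>))"
  by (rule nonneg_combo_eq_val_iff) (auto intro: wt_in_cone_monoid combo_dv dv_nonneg)

lemma th_hpart_filt_ge:
  fixes p :: "('n, 'k) mpoly"
  assumes p: "p \<in> carrier (mpoly_ring S)" shows "th (hpart dv a p) \<in> filt_ge P f R a"
proof -
  have hp: "hpart dv a p \<in> carrier (mpoly_ring S)" using p by (rule mpoly_ring_hpart_closed)
  have "lex_le P R a (val s)" if nz: "wcoeff (hpart dv a p) s \<noteq> 0" for s
  proof -
    obtain \<alpha> where "\<alpha> \<in> keys p" "dv \<alpha> = a" "wt \<alpha> = s"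
      using wcoeff_nonzero_imp[OF nz] by (auto simp: keys_hpart)
    then show ?thesis using dv_le_val[of \<alpha>] p by (auto simp: carrier_mpoly_ring)
  qed
  then show ?thesis using hp by (auto simp: filt_ge_iff fcoeff_th carrier_coord_ring)
qed

lemma th_hpart_filt_gt_iff:
  fixes p :: "('n, 'k) mpoly"
  assumes p: "p \<in> carrier (mpoly_ring S)"
  shows "th (hpart dv a p) \<in> filt_gt P f R a \<longleftrightarrow> (\<forall>s\<in>S. val s = a \<longrightarrow> wcoeff (hpart dv a p) s = 0)"
proof -
  have hp: "hpart dv a p \<in> carrier (mpoly_ring S)" using p by (rule mpoly_ring_hpart_closed)
  have "th (hpart dv a p) \<in> carrier K" using hp by (simp add: carrier_coord_ring)
  moreover have "lex_le P R a (val s)" if "wcoeff (hpart dv a p) s \<noteq> 0" for s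
    using th_hpart_filt_ge[OF p, of a] that hp by (auto simp: filt_ge_iff fcoeff_th)
  ultimately show ?thesis
    using wcoeff_in_cone_monoid[OF hp] unfolding filt_gt_iff fcoeff_th[OF hp] by blast
qed

text \<open>The map that should be \<open>\<theta>\<close>-bar, written down component by component: in degree \<open>a\<close> it is
  the class of the part of \<open>p\<close> of degree \<open>a\<close>. It is a surjective homomorphism, which makes the
  graded ring a ring; only then do the sums and products in the definition of \<open>theta_bar\<close> compute.\<close>

definition gr_map :: "('n, 'k) mpoly \<Rightarrow> (('n face \<Rightarrow> rat) \<Rightarrow> ('n, 'k) func set)" where
  "gr_map p = (\<lambda>a\<in>val_image P f R. filt_gt P f R a +>\<^bsub>K\<^esub> th (hpart dv a p))"

lemma coset_eq_filt_gt_iff: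
  assumes "g \<in> carrier K"
  shows "filt_gt P f R a +>\<^bsub>K\<^esub> g = filt_gt P f R a \<longleftrightarrow> g \<in> filt_gt P f R a"
proof -
  interpret K: cring "K :: ('n, 'k) func ring" by (rule cring_coord_ring)
  show ?thesis using ideal.rcos_const_imp_mem[OF filt_gt_ideal assms] K.a_rcos_zero[OF filt_gt_ideal] by blast
qed

lemma th_hpart_closed:
  "p \<in> carrier (mpoly_ring S) \<Longrightarrow> th (hpart dv a p) \<in> carrier (K :: ('n, 'k) func ring)"
  by (simp add: carrier_coord_ring mpoly_ring_hpart_closed)

lemma gr_support_map:
  assumes "p \<in> carrier (mpoly_ring S)"
  shows "gr_support P f R (gr_map p) =
    {a \<in> val_image P f R. th (hpart dv a p) \<notin> filt_gt P f R a}"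
  unfolding gr_support_def gr_map_def
  using coset_eq_filt_gt_iff[OF th_hpart_closed[OF assms]] by auto

lemma gr_support_map_subset:
  assumes "p \<in> carrier (mpoly_ring S)" shows "gr_support P f R (gr_map p) \<subseteq> dv ` keys p"
proof
  fix a assume "a \<in> gr_support P f R (gr_map p)"
  then have nz: "th (hpart dv a p) \<notin> filt_gt P f R a" using gr_support_map[OF assms] by simp
  have "hpart dv a p \<noteq> 0" using nz filt_gt_zero by (auto simp: th_0)
  then show "a \<in> dv ` keys p" using hpart_eq_0[of p dv a] by blast
qed

lemma gr_ring_sel:
  "carrier (gr_ring P f R) =
    {u \<in> (\<Pi>\<^sub>E a\<in>val_image P f R. (\<lambda>g. filt_gt P f R a +>\<^bsub>K\<^esub> g) ` filt_ge P f R a).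
      finite (gr_support P f R u)}"
  "mult (gr_ring P f R) u w = (\<lambda>c\<in>val_image P f R.
     finsum (K Quot (filt_gt P f R c)) (\<lambda>(a, b). rcoset_mult K (filt_gt P f R c) (u a) (w b))
       {(a, b). a \<in> gr_support P f R u \<and> b \<in> gr_support P f R w \<and> a + b = c})"
  "one (gr_ring P f R) = (\<lambda>c\<in>val_image P f R. if c = 0 then filt_gt P f R c +>\<^bsub>K\<^esub> \<one>\<^bsub>K\<^esub> else filt_gt P f R c)"
  "zero (gr_ring P f R) = (\<lambda>c\<in>val_image P f R. filt_gt P f R c)"
  "add (gr_ring P f R) u w = (\<lambda>c\<in>val_image P f R. u c <+>\<^bsub>K\<^esub> w c)"
  by (simp_all add: gr_ring_def Let_def plus_fun_def zero_fun_def)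

lemma gr_map_closed:
  assumes "p \<in> carrier (mpoly_ring S)" shows "gr_map p \<in> carrier (gr_ring P f R)"
proof -
  have "finite (gr_support P f R (gr_map p))"
    by (rule finite_subset[OF gr_support_map_subset[OF assms]]) simp
  moreover have "gr_map p \<in> (\<Pi>\<^sub>E a\<in>val_image P f R. (\<lambda>g. filt_gt P f R a +>\<^bsub>K\<^esub> g) ` filt_ge P f R a)"
    unfolding gr_map_def using th_hpart_filt_ge[OF assms] by (intro restrict_PiE_iff[THEN iffD2]) auto
  ultimately show ?thesis by (simp add: gr_ring_sel)
qed

lemma gr_map_add:
  assumes "p \<in> carrier (mpoly_ring S)" "q \<in> carrier (mpoly_ring S)"
  shows "gr_map (p + q) = gr_map p \<oplus>\<^bsub>gr_ring P f R\<^esub> gr_map q"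
  unfolding gr_ring_sel gr_map_def
  by (rule restrict_ext)
    (use th_hpart_closed[OF assms(1)] th_hpart_closed[OF assms(2)] in
      \<open>simp add: hpart_add th_add ideal.a_rcos_sum[OF filt_gt_ideal]\<close>)

lemma gr_map_0: "gr_map 0 = \<zero>\<^bsub>gr_ring P f R\<^esub>"
  unfolding gr_ring_sel gr_map_def
  by (rule restrict_ext)
    (use coset_eq_filt_gt_iff[of "\<zero>\<^bsub>K\<^esub>"] filt_gt_zero filt_gt_carrier in \<open>auto simp: th_0\<close>)

lemma gr_map_single:
  assumes "keys \<alpha> \<subseteq> S"
  shows "gr_map (single \<alpha> c) = gr_hom_elem P f R (dv \<alpha>) (elt (wt \<alpha>) c)"
  unfolding gr_hom_elem_def gr_map_def
  by (rule restrict_ext)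
    (use coset_eq_filt_gt_iff[of "\<zero>\<^bsub>K\<^esub>"] filt_gt_zero filt_gt_carrier in
      \<open>auto simp: hpart_single th_0 th_single[OF assms]\<close>)

lemma gr_map_1: "gr_map 1 = \<one>\<^bsub>gr_ring P f R\<^esub>"
proof -
  have "gr_map 1 = gr_hom_elem P f R 0 (elt 0 1)"
    using gr_map_single[of 0 1] by simp
  moreover have "elt 0 1 = (\<one>\<^bsub>K\<^esub> :: ('n, 'k) func)"
    by (simp add: const_elt[symmetric] coord_ring_sel)
  ultimately show ?thesis by (simp add: gr_hom_elem_def gr_ring_sel)
qed

lemma th_sum:
  fixes F :: "'i \<Rightarrow> ('n, 'k) mpoly"
  assumes "finite A" "\<And>i. i \<in> A \<Longrightarrow> F i \<in> carrier (mpoly_ring S)"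
  shows "th (\<Sum>i\<in>A. F i) = finsum K (\<lambda>i. th (F i)) A"
proof -
  interpret K: cring "K :: ('n, 'k) func ring" by (rule cring_coord_ring)
  show ?thesis using assms
    by (induction A rule: finite_induct) (auto simp: th_0 th_add carrier_coord_ring)
qed

lemma finsum_in_ideal:
  assumes "ideal I A" "finite B" "\<And>i. i \<in> B \<Longrightarrow> F i \<in> I"
  shows "finsum A F B \<in> I"
proof -
  interpret ideal I A by (rule assms(1))
  show ?thesis using assms(2,3)
    by (induction B rule: finite_induct) (auto simp: Icarr Pi_iff)
qed

text \<open>The product in the graded ring sums over the supports of the factors only. The other pairs of
  degrees contribute elements of \<open>filt_gt c\<close>, which the coset absorbs.\<close>

lemma gr_map_mult:
  assumes p: "p \<in> carrier (mpoly_ring S)" and q: "q \<in> carrier (mpoly_ring S)"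
  shows "gr_map (p * q) = gr_map p \<otimes>\<^bsub>gr_ring P f R\<^esub> gr_map q"
  unfolding gr_ring_sel gr_map_def[of "p * q"]
proof (rule restrict_ext)
  fix c assume c: "c \<in> val_image P f R"
  interpret K: cring "K :: ('n, 'k) func ring" by (rule cring_coord_ring)
  let ?N = "filt_gt P f R" and ?p = "\<lambda>a. th (hpart dv a p)" and ?q = "\<lambda>a. th (hpart dv a q)"
  interpret I: ideal "?N c" "K :: ('n, 'k) func ring" by (rule filt_gt_ideal)
  interpret Q: ring_hom_cring "K :: ('n, 'k) func ring" "K Quot (?N c)" "(+>\<^bsub>K\<^esub>) (?N c)"
    by (rule I.rcos_ring_hom_cring) (rule K.cring_axioms)
  let ?B = "{(a, b). a \<in> dv ` keys p \<and> b \<in> dv ` keys q \<and> a + b = c}"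
  let ?A = "{(a, b). a \<in> gr_support P f R (gr_map p) \<and> b \<in> gr_support P f R (gr_map q) \<and> a + b = c}"
  let ?F = "\<lambda>x. ?p (fst x) \<otimes>\<^bsub>K\<^esub> ?q (snd x)"
  have AB: "?A \<subseteq> ?B" using gr_support_map_subset[OF p] gr_support_map_subset[OF q] by blast
  have finB: "finite ?B"
    by (rule finite_subset[of _ "dv ` keys p \<times> dv ` keys q"]) auto
  have finA: "finite ?A" using AB finB finite_subset by blast
  have pc: "?p a \<in> carrier K" and qc: "?q a \<in> carrier K" for a
    using th_hpart_closed[OF p] th_hpart_closed[OF q] by auto
  have small_p: "?p a \<in> ?N a" if "a \<notin> gr_support P f R (gr_map p)" for a
    using that gr_support_map[OF p] th_hpart_filt_gt_iff[OF p, of a] val_image_eq by blast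
  have small_q: "?q a \<in> ?N a" if "a \<notin> gr_support P f R (gr_map q)" for a
    using that gr_support_map[OF q] th_hpart_filt_gt_iff[OF q, of a] val_image_eq by blast
  have rest: "?F x \<in> ?N c" if "x \<in> ?B - ?A" for x
  proof -
    obtain a b where x: "x = (a, b)" "a + b = c"
      "a \<notin> gr_support P f R (gr_map p) \<or> b \<notin> gr_support P f R (gr_map q)"
      using \<open>x \<in> ?B - ?A\<close> by blast
    from x(3) show ?thesis
    proof
      assume "a \<notin> gr_support P f R (gr_map p)"
      then have "?q b \<otimes>\<^bsub>K\<^esub> ?p a \<in> ?N (b + a)"
        using filt_mult_gt[OF th_hpart_filt_ge[OF q] small_p] by blast
      then show ?thesis using x K.m_comm[OF qc pc] by (simp add: add.commute)
    next
      assume "b \<notin> gr_support P f R (gr_map q)"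
      then have "?p a \<otimes>\<^bsub>K\<^esub> ?q b \<in> ?N (a + b)"
        using filt_mult_gt[OF th_hpart_filt_ge[OF p] small_q] by blast
      then show ?thesis using x by simp
    qed
  qed
  have prod: "rcoset_mult K (?N c) (gr_map p a) (gr_map q b) = ?N c +>\<^bsub>K\<^esub> (?p a \<otimes>\<^bsub>K\<^esub> ?q b)"
    if ab: "(a, b) \<in> ?A" for a b
  proof -
    have v: "a \<in> val_image P f R" "b \<in> val_image P f R" and c': "a + b = c"
      using ab by (auto simp: gr_support_def)
    have "rcoset_mult K (?N c) (?N a +>\<^bsub>K\<^esub> ?p a) (?N b +>\<^bsub>K\<^esub> ?q b) = ?N c +>\<^bsub>K\<^esub> (?p a \<otimes>\<^bsub>K\<^esub> ?q b)"
    proof (rule rcoset_mult_mixed[OF K.cring_axioms filt_gt_ideal pc qc filt_gt_carrier filt_gt_zero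
          filt_gt_carrier filt_gt_zero])
      fix x assume x: "x \<in> ?N a"
      then have "?q b \<otimes>\<^bsub>K\<^esub> x \<in> ?N (b + a)" using filt_mult_gt[OF th_hpart_filt_ge[OF q]] by blast
      moreover have "x \<in> carrier K" using x filt_gt_carrier by blast
      ultimately show "x \<otimes>\<^bsub>K\<^esub> ?q b \<in> ?N c" using c' K.m_comm[OF qc] by (simp add: add.commute)
    next
      fix y assume "y \<in> ?N b"
      then show "?p a \<otimes>\<^bsub>K\<^esub> y \<in> ?N c" using filt_mult_gt[OF th_hpart_filt_ge[OF p]] c' by blast
    next
      fix x y assume "x \<in> ?N a" "y \<in> ?N b"
      then show "x \<otimes>\<^bsub>K\<^esub> y \<in> ?N c" using filt_mult_gt filt_gt_subset c' by blast
    qed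
    then show ?thesis using v by (simp add: gr_map_def)
  qed
  have Fc: "?F \<in> X \<rightarrow> carrier K" for X using pc qc by auto
  have restN: "finsum K ?F (?B - ?A) \<in> ?N c"
    by (rule finsum_in_ideal[OF filt_gt_ideal finite_Diff[OF finB] rest])
  have "finsum (K Quot (?N c)) (\<lambda>(a, b). rcoset_mult K (?N c) (gr_map p a) (gr_map q b)) ?A =
      finsum (K Quot (?N c)) ((+>\<^bsub>K\<^esub>) (?N c) \<circ> ?F) ?A"
    by (rule Q.S.finsum_cong') (use prod pc qc in \<open>auto simp: Pi_iff intro!: Q.hom_closed K.m_closed\<close>)
  also have "\<dots> = ?N c +>\<^bsub>K\<^esub> finsum K ?F ?A" by (rule Q.hom_finsum[symmetric]) (rule Fc)
  also have "\<dots> = ?N c +>\<^bsub>K\<^esub> (finsum K ?F (?B - ?A) \<oplus>\<^bsub>K\<^esub> finsum K ?F ?A)"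
    by (rule coset_absorb[symmetric, OF filt_gt_ideal K.finsum_closed[OF Fc] restN])
  also have "finsum K ?F (?B - ?A) \<oplus>\<^bsub>K\<^esub> finsum K ?F ?A = finsum K ?F ?B"
  proof -
    have "finsum K ?F ((?B - ?A) \<union> ?A) = finsum K ?F (?B - ?A) \<oplus>\<^bsub>K\<^esub> finsum K ?F ?A"
      by (rule K.finsum_Un_disjoint) (use finA finB Fc in auto)
    then show ?thesis using AB by (simp add: Un_absorb2)
  qed
  also have "finsum K ?F ?B = th (\<Sum>x\<in>?B. hpart dv (fst x) p * hpart dv (snd x) q)"
    unfolding th_mult[symmetric]
    by (rule th_sum[symmetric, OF finB]) (auto intro!: mpoly_ring_mult_closed mpoly_ring_hpart_closed p q)
  also have "(\<Sum>x\<in>?B. hpart dv (fst x) p * hpart dv (snd x) q) = hpart dv c (p * q)"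
    using hpart_mult[OF dv_add, of "dv ` keys p" p "dv ` keys q" q c] by (simp add: case_prod_unfold)
  finally show "?N c +>\<^bsub>K\<^esub> th (hpart dv c (p * q)) =
      finsum (K Quot (?N c)) (\<lambda>(a, b). rcoset_mult K (?N c) (gr_map p a) (gr_map q b)) ?A" by (rule sym)
qed

lemma gr_map_hom: "gr_map \<in> ring_hom (mpoly_ring S) (gr_ring P f R)"
  by (rule ring_hom_memI) (auto simp: gr_map_closed gr_map_mult gr_map_add gr_map_1)

text \<open>Since \<open>val\<close> is injective, \<open>f_s\<close> is the only basis function of value \<open>val s\<close>, and its class
  spans the component.\<close>

lemma graded_component:
  assumes "s \<in> S" "g \<in> filt_ge P f R (val s)"
  shows "filt_gt P f R (val s) +>\<^bsub>K\<^esub> g = filt_gt P f R (val s) +>\<^bsub>K\<^esub> elt s (fcoeff g s)"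
proof -
  interpret K: cring "K :: ('n, 'k) func ring" by (rule cring_coord_ring)
  have g: "g \<in> carrier K" using assms(2) filt_ge_carrier by blast
  let ?e = "elt s (fcoeff g s)" let ?m = "elt s (- fcoeff g s)"
  have e: "?e \<in> carrier K" "?m \<in> carrier K" by (simp_all add: elt_closed[OF assms(1)])
  have "val s' \<noteq> val s" if "s' \<noteq> s" "fcoeff g s' \<noteq> 0" for s'
    using val_inj[OF fcoeff_in_cone_monoid[OF g that(2)] assms(1)] that by blast
  then have r: "g \<oplus>\<^bsub>K\<^esub> ?m \<in> filt_gt P f R (val s)"
    using assms(2) g e by (auto simp: filt_gt_iff filt_ge_iff fcoeff_add fcoeff_elt[OF assms(1)] split: if_splits)
  have "g = (g \<oplus>\<^bsub>K\<^esub> ?m) \<oplus>\<^bsub>K\<^esub> ?e"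
    by (rule fcoeff_eqI) (use g e in \<open>auto simp: fcoeff_add fcoeff_elt[OF assms(1)]\<close>)
  then show ?thesis using coset_absorb[OF filt_gt_ideal e(1) r] by simp
qed

lemma gr_map_surj: "gr_map ` carrier (mpoly_ring S) = carrier (gr_ring P f R)"
proof
  show "gr_map ` carrier (mpoly_ring S) \<subseteq> carrier (gr_ring P f R)" using gr_map_closed by blast
  show "carrier (gr_ring P f R) \<subseteq> gr_map ` carrier (mpoly_ring S)"
  proof
    fix u assume u: "u \<in> carrier (gr_ring P f R)"
    let ?G = "gr_support P f R u"
    have fin: "finite ?G" using u by (simp add: gr_ring_sel)
    have "\<exists>s k. s \<in> S \<and> val s = a \<and> u a = filt_gt P f R a +>\<^bsub>K\<^esub> elt s k" if a: "a \<in> val_image P f R" for a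
    proof -
      obtain s where s: "s \<in> S" "a = val s" using a val_image_eq by blast
      obtain g where "g \<in> filt_ge P f R a" "u a = filt_gt P f R a +>\<^bsub>K\<^esub> g"
        using u a unfolding gr_ring_sel by (blast dest: PiE_mem)
      then show ?thesis using graded_component s by blast
    qed
    then obtain w k where w: "\<And>a. a \<in> val_image P f R \<Longrightarrow>
        w a \<in> S \<and> val (w a) = a \<and> u a = filt_gt P f R a +>\<^bsub>K\<^esub> elt (w a) (k a)" by metis
    define p :: "('n, 'k) mpoly" where "p = (\<Sum>a\<in>?G. single (single (w a) 1) (k a))"
    have Gv: "?G \<subseteq> val_image P f R" by (auto simp: gr_support_def)
    have p: "p \<in> carrier (mpoly_ring S)"
      unfolding p_def by (intro mpoly_ring_sum_closed mpoly_ring_single_closed) (use w Gv in auto)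
    have hp: "hpart dv c p = (if c \<in> ?G then single (single (w c) 1) (k c) else 0)" for c
    proof -
      have "hpart dv c p = (\<Sum>a\<in>?G. if a = c then single (single (w a) 1) (k a) else 0)"
        unfolding p_def hpart_sum by (rule sum.cong) (use w Gv in \<open>auto simp: hpart_single\<close>)
      then show ?thesis using fin by (simp add: sum.delta)
    qed
    have "gr_map p c = u c" for c
    proof (cases "c \<in> val_image P f R")
      case True
      have z: "filt_gt P f R c +>\<^bsub>K\<^esub> \<zero>\<^bsub>K\<^esub> = filt_gt P f R c"
        using coset_eq_filt_gt_iff[of "\<zero>\<^bsub>K\<^esub>"] filt_gt_zero filt_gt_carrier by blast
      show ?thesis
      proof (cases "c \<in> ?G")
        case inG: True
        then show ?thesis using True w[OF True] by (simp add: gr_map_def hp elt_def)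
      next
        case False
        then have "u c = filt_gt P f R c" using True by (simp add: gr_support_def)
        then show ?thesis using False True z by (simp add: gr_map_def hp th_0)
      qed
    next
      case False
      have "u \<in> (\<Pi>\<^sub>E a\<in>val_image P f R. (\<lambda>g. filt_gt P f R a +>\<^bsub>K\<^esub> g) ` filt_ge P f R a)"
        using u unfolding gr_ring_sel by blast
      from PiE_arb[OF this False] show ?thesis using False by (simp add: gr_map_def)
    qed
    then show "u \<in> gr_map ` carrier (mpoly_ring S)" using p by blast
  qed
qed

lemma cring_gr_ring: "cring (gr_ring P f R)"
  by (rule cring_surj_hom[OF cring_mpoly_ring gr_map_hom gr_map_surj]) (simp add: gr_map_0)

lemma finsum_mpoly_ring:
  assumes "finite A" "\<And>i. i \<in> A \<Longrightarrow> F i \<in> carrier (mpoly_ring I)"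
  shows "finsum (mpoly_ring I) F A = (\<Sum>i\<in>A. F i)"
proof -
  interpret M: cring "mpoly_ring I" by (rule cring_mpoly_ring)
  show ?thesis using assms by (induction A rule: finite_induct) (auto simp: Pi_iff)
qed

lemma finprod_mpoly_ring:
  assumes "finite A" "\<And>i. i \<in> A \<Longrightarrow> F i \<in> carrier (mpoly_ring I)"
  shows "finprod (mpoly_ring I) F A = (\<Prod>i\<in>A. F i)"
proof -
  interpret M: cring "mpoly_ring I" by (rule cring_mpoly_ring)
  show ?thesis using assms by (induction A rule: finite_induct) (auto simp: Pi_iff)
qed

lemma single_power: "single \<alpha> (c :: 'k) ^ n = single (\<Sum>i<n. \<alpha>) (c ^ n)"
  by (induction n) (auto simp: mult_single algebra_simps)

lemma prod_single: "(\<Prod>i\<in>A. single (F i) (1 :: 'k)) = single (\<Sum>i\<in>A. F i) 1"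
  by (induction A rule: infinite_finite_induct) (auto simp: mult_single)

lemma monomial_as_product:
  fixes \<alpha> :: "'n mon"
  shows "(\<Prod>s\<in>keys \<alpha>. single (single s 1) (1 :: 'k) ^ lookup \<alpha> s) = single \<alpha> 1"
proof -
  have mul: "(\<Sum>i<n. single s (1::nat)) = single s n" for s :: "'n wt" and n
    by (induction n) (simp_all add: single_add[symmetric] del: sum_constant)
  have "(\<Prod>s\<in>keys \<alpha>. single (single s 1) (1 :: 'k) ^ lookup \<alpha> s) =
      (\<Prod>s\<in>keys \<alpha>. single (single s (lookup \<alpha> s)) 1)"
    by (simp only: single_power mul power_one)
  also have "\<dots> = single \<alpha> 1"
    unfolding prod_single using mpoly_sum_monomials[of "keys \<alpha>" \<alpha>] by simp
  finally show ?thesis .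
qed

lemma theta_bar_eq_gr_map:
  assumes p: "p \<in> carrier (mpoly_ring S)" shows "theta_bar P f R p = gr_map p"
proof -
  interpret M: cring "mpoly_ring S :: ('n, 'k) mpoly ring" by (rule cring_mpoly_ring)
  interpret Gr: cring "gr_ring P f R" by (rule cring_gr_ring)
  interpret h: ring_hom_cring "mpoly_ring S :: ('n, 'k) mpoly ring" "gr_ring P f R" gr_map
    by (rule ring_hom_cringI[OF M.cring_axioms Gr.cring_axioms gr_map_hom])
  have pow: "gr_map (x [^]\<^bsub>mpoly_ring S\<^esub> k) = gr_map x [^]\<^bsub>gr_ring P f R\<^esub> k"
    if x: "x \<in> carrier (mpoly_ring S)" for x and k :: nat
    by (induction k) (use x in \<open>auto simp: gr_map_1 gr_map_mult\<close>)
  let ?X = "\<lambda>s. single (single s 1) (1 :: 'k)"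
  have cst: "gr_const P f R c = gr_map (single 0 c)" for c
    unfolding gr_const_def const_elt using gr_map_single[of 0 c] by (simp add: zero_fun_def)
  have cls: "gr_class P f R (basis_fun \<Lambda> s) = gr_map (?X s)" if "s \<in> S" for s
    unfolding gr_class_def quasi_val_basis_fun[OF that]
    using gr_map_single[of "single s 1" 1] that by (simp add: basis_fun_elt[OF that])
  have Xc: "?X s \<in> carrier (mpoly_ring S)" if "s \<in> S" for s
    using that by (intro mpoly_ring_single_closed) auto
  have mon: "finprod (gr_ring P f R)
      (\<lambda>s. gr_class P f R (basis_fun \<Lambda> s) [^]\<^bsub>gr_ring P f R\<^esub> lookup \<alpha> s) (keys \<alpha>) = gr_map (single \<alpha> 1)"
    if \<alpha>: "\<alpha> \<in> keys p" for \<alpha>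
  proof -
    have sub: "keys \<alpha> \<subseteq> S" using p \<alpha> by (auto simp: carrier_mpoly_ring)
    let ?Y = "\<lambda>s. ?X s [^]\<^bsub>mpoly_ring S\<^esub> lookup \<alpha> s"
    have Yc: "?Y s \<in> carrier (mpoly_ring S)" if "s \<in> keys \<alpha>" for s
      by (rule M.nat_pow_closed[OF Xc]) (use sub that in blast)
    have "finprod (gr_ring P f R)
        (\<lambda>s. gr_class P f R (basis_fun \<Lambda> s) [^]\<^bsub>gr_ring P f R\<^esub> lookup \<alpha> s) (keys \<alpha>) =
      finprod (gr_ring P f R) (gr_map \<circ> ?Y) (keys \<alpha>)"
    proof (rule Gr.finprod_cong')
      show "gr_map \<circ> ?Y \<in> keys \<alpha> \<rightarrow> carrier (gr_ring P f R)" using Yc by auto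
      fix s assume "s \<in> keys \<alpha>"
      then show "gr_class P f R (basis_fun \<Lambda> s) [^]\<^bsub>gr_ring P f R\<^esub> lookup \<alpha> s = (gr_map \<circ> ?Y) s"
        using sub cls[of s] pow[OF Xc, of s "lookup \<alpha> s"] by (simp add: subset_iff)
    qed simp
    also have "\<dots> = gr_map (finprod (mpoly_ring S) ?Y (keys \<alpha>))"
      by (rule h.hom_finprod[symmetric]) (use Yc in auto)
    also have "finprod (mpoly_ring S) ?Y (keys \<alpha>) = single \<alpha> 1"
      using finprod_mpoly_ring[of "keys \<alpha>" ?Y S] Yc monomial_as_product[of \<alpha>]
      by (simp add: mpoly_ring_nat_pow)
    finally show ?thesis .
  qed
  let ?T = "\<lambda>\<alpha>. single \<alpha> (lookup p \<alpha>)"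
  have Tc: "?T \<alpha> \<in> carrier (mpoly_ring S)" if "\<alpha> \<in> keys p" for \<alpha>
    using p that by (intro mpoly_ring_single_closed) (auto simp: carrier_mpoly_ring)
  have "theta_bar P f R p = finsum (gr_ring P f R) (gr_map \<circ> ?T) (keys p)"
    unfolding theta_bar_def
  proof (rule Gr.finsum_cong')
    show "gr_map \<circ> ?T \<in> keys p \<rightarrow> carrier (gr_ring P f R)" using Tc by auto
    fix \<alpha> assume \<alpha>: "\<alpha> \<in> keys p"
    then have c: "single \<alpha> 1 \<in> carrier (mpoly_ring S)" "single 0 (lookup p \<alpha>) \<in> carrier (mpoly_ring S)"
      using p by (auto intro!: mpoly_ring_single_closed simp: carrier_mpoly_ring)
    show "gr_const P f R (lookup p \<alpha>) \<otimes>\<^bsub>gr_ring P f R\<^esub> finprod (gr_ring P f R)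
        (\<lambda>s. gr_class P f R (basis_fun \<Lambda> s) [^]\<^bsub>gr_ring P f R\<^esub> lookup \<alpha> s) (keys \<alpha>) = (gr_map \<circ> ?T) \<alpha>"
      unfolding mon[OF \<alpha>] cst gr_map_mult[OF c(2,1), symmetric] by (simp add: mult_single)
  qed simp
  also have "\<dots> = gr_map (finsum (mpoly_ring S) ?T (keys p))"
    by (rule h.hom_finsum[symmetric]) (use Tc in auto)
  also have "finsum (mpoly_ring S) ?T (keys p) = p"
    using finsum_mpoly_ring[of "keys p" ?T S] Tc mpoly_sum_monomials[of "keys p" p] by simp
  finally show ?thesis .
qed

text \<open>Only the monomials whose degree \<open>dv\<close> is the valuation of their weight survive in the
  graded ring.\<close>

lemma ker_theta_bar_iff:
  assumes "G \<subseteq> S"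
  shows "p \<in> ker_theta_bar P f R G \<longleftrightarrow>
    p \<in> carrier (mpoly_ring G) \<and> (\<forall>s\<in>S. wcoeff (hpart dv (val s) p) s = 0)"
proof (cases "p \<in> carrier (mpoly_ring G)")
  case True
  then have p: "p \<in> carrier (mpoly_ring S)" using carrier_mpoly_ring_mono[OF assms] by blast
  have "gr_map p = \<zero>\<^bsub>gr_ring P f R\<^esub> \<longleftrightarrow> (\<forall>a\<in>val_image P f R. th (hpart dv a p) \<in> filt_gt P f R a)"
    unfolding gr_ring_sel gr_map_def
    using coset_eq_filt_gt_iff[OF th_hpart_closed[OF p]] by (auto simp: restrict_def fun_eq_iff)
  also have "\<dots> \<longleftrightarrow> (\<forall>s\<in>S. wcoeff (hpart dv (val s) p) s = 0)"
    unfolding val_image_eq th_hpart_filt_gt_iff[OF p] using val_inj by blast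
  finally show ?thesis
    using True by (simp add: ker_theta_bar_def a_kernel_def' theta_bar_eq_gr_map[OF p])
qed (simp add: ker_theta_bar_def a_kernel_def')

end


section \<open>The kernel of the map to the graded ring\<close>

text \<open>In the binomial expansion every term contains \<open>x ^ m\<close> or \<open>y ^ n\<close>. Here \<open>B\<close> is the ring in
  which \<open>J\<close> is an ideal, as a subset of the type.\<close>

lemma binomial_sum_power_in_ideal:
  fixes x y :: "'a::comm_ring_1"
  assumes add: "\<And>p q. p \<in> J \<Longrightarrow> q \<in> J \<Longrightarrow> p + q \<in> J" and 0: "0 \<in> J"
    and mult: "\<And>p q. p \<in> J \<Longrightarrow> q \<in> B \<Longrightarrow> q * p \<in> J"
    and B: "x \<in> B" "y \<in> B" "1 \<in> B" "\<And>p q. p \<in> B \<Longrightarrow> q \<in> B \<Longrightarrow> p + q \<in> B"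
      "\<And>p q. p \<in> B \<Longrightarrow> q \<in> B \<Longrightarrow> p * q \<in> B"
    and m: "x ^ m \<in> J" and n: "y ^ n \<in> J"
  shows "(x + y) ^ (m + n) \<in> J"
proof -
  have pow: "z ^ k \<in> B" if "z \<in> B" for z k using that B by (induction k) auto
  have nat: "of_nat k * p \<in> J" if "p \<in> J" for k p
    using that by (induction k) (auto simp: distrib_right add 0)
  have up: "x ^ k \<in> J" if "m \<le> k" for k
  proof -
    have "x ^ (k - m) * x ^ m \<in> J" using mult m pow B by blast
    then show ?thesis using that by (simp flip: power_add)
  qed
  have uq: "y ^ k \<in> J" if "n \<le> k" for k
  proof -
    have "y ^ (k - n) * y ^ n \<in> J" using mult n pow B by blast
    then show ?thesis using that by (simp flip: power_add)
  qed
  have trm: "of_nat ((m + n) choose k) * x ^ k * y ^ (m + n - k) \<in> J" if "k \<le> m + n" for k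
  proof (cases "m \<le> k")
    case True
    then have "y ^ (m + n - k) * x ^ k \<in> J" using mult up pow B by blast
    then have "x ^ k * y ^ (m + n - k) \<in> J" by (simp only: mult.commute)
    from nat[OF this] show ?thesis by (simp only: mult.assoc)
  next
    case False
    then have "n \<le> m + n - k" using that by linarith
    then have "x ^ k * y ^ (m + n - k) \<in> J" using mult uq pow B by blast
    from nat[OF this] show ?thesis by (simp only: mult.assoc)
  qed
  have "(\<Sum>k\<in>A. of_nat ((m + n) choose k) * x ^ k * y ^ (m + n - k)) \<in> J" if "A \<subseteq> {..m + n}" for A
    using finite_subset[OF that] that by (induction A rule: finite_induct) (auto simp: 0 add trm)
  then show ?thesis unfolding binomial_ring by blast
qed

lemma single_sum: "single k (\<Sum>i\<in>A. c i) = (\<Sum>i\<in>A. single k (c i :: 'b::comm_monoid_add))"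
  by (induction A rule: infinite_finite_induct) (auto simp: single_add)

lemma lookup_initial_form:
  "lookup (initial_form cmp d g) \<gamma> =
    (if \<gamma> \<in> keys g \<and> (\<forall>\<beta>\<in>keys g. cmp (d \<beta>) (d \<gamma>)) then lookup g \<gamma> else 0)"
proof -
  let ?M = "{\<alpha> \<in> keys g. \<forall>\<beta>\<in>keys g. cmp (d \<beta>) (d \<alpha>)}"
  have "lookup (initial_form cmp d g) \<gamma> = (\<Sum>\<alpha>\<in>?M. if \<alpha> = \<gamma> then lookup g \<alpha> else 0)"
    by (auto simp: initial_form_def lookup_sum lookup_single when_def intro!: sum.cong)
  then show ?thesis by (auto simp: sum.delta)
qed

lemma keys_initial_form:
  "keys (initial_form cmp d g) = {\<alpha> \<in> keys g. \<forall>\<beta>\<in>keys g. cmp (d \<beta>) (d \<alpha>)}"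
  by (auto simp: in_keys_iff lookup_initial_form split: if_splits)

lemma initial_form_closed:
  "g \<in> carrier (mpoly_ring I) \<Longrightarrow> initial_form cmp d g \<in> carrier (mpoly_ring I)"
  by (simp add: carrier_mpoly_ring keys_initial_form)

lemma initial_form_binomial:
  fixes d :: "'n::finite mon \<Rightarrow> int"
  assumes "\<alpha> \<noteq> \<beta>"
  shows "initial_form (\<le>) d (single \<alpha> (1 :: 'k::field) - single \<beta> 1) =
    (if d \<beta> \<le> d \<alpha> then single \<alpha> 1 else 0) - (if d \<alpha> \<le> d \<beta> then single \<beta> 1 else 0)"
proof -
  have k: "keys (single \<alpha> (1 :: 'k) - single \<beta> 1) = {\<alpha>, \<beta>}"
    using assms by (auto simp: in_keys_iff lookup_minus lookup_single when_def split: if_splits)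
  show ?thesis
    by (rule poly_mapping_eqI)
      (use assms in \<open>auto simp: lookup_initial_form k lookup_minus lookup_single when_def\<close>)
qed

context degree_one_stratification
begin

text \<open>The coefficient of the class of \<open>f_s\<close> in the image of \<open>p\<close> in the graded ring.\<close>

definition ccoeff :: "('n, 'k) mpoly \<Rightarrow> 'n wt \<Rightarrow> 'k" where
  "ccoeff p s = wcoeff (hpart dv (val s) p) s"

lemma ccoeff_add: "ccoeff (p + q) s = ccoeff p s + ccoeff q s"
  by (simp add: ccoeff_def hpart_add wcoeff_add)

lemma ccoeff_single:
  "ccoeff (single \<alpha> c) s = (if wt \<alpha> = s \<and> dv \<alpha> = val s then c else 0)"
  by (auto simp: ccoeff_def hpart_single wcoeff_single)

lemma ccoeff_uminus: "ccoeff (- p) s = - ccoeff p s"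
proof -
  have "ccoeff (- p) s + ccoeff p s = 0"
    unfolding ccoeff_add[symmetric] by (simp add: ccoeff_def)
  then show ?thesis by (simp add: eq_neg_iff_add_eq_0)
qed

lemma ccoeff_diff: "ccoeff (p - q) s = ccoeff p s - ccoeff q s"
  using ccoeff_add[of p "- q"] by (simp add: ccoeff_uminus)

lemma ccoeff_alt: "ccoeff p s = (\<Sum>\<alpha>\<in>{\<alpha> \<in> keys p. dv \<alpha> = val s \<and> wt \<alpha> = s}. lookup p \<alpha>)"
  unfolding ccoeff_def wcoeff_alt by (rule sum.cong) (auto simp: keys_hpart lookup_hpart)

definition gr_ker :: "('n, 'k) mpoly set" where
  "gr_ker = {p \<in> carrier (mpoly_ring S). \<forall>s\<in>S. ccoeff p s = 0}"

lemma ker_theta_bar_eq: "G \<subseteq> S \<Longrightarrow> ker_theta_bar P f R G = gr_ker \<inter> carrier (mpoly_ring G)"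
  using ker_theta_bar_iff carrier_mpoly_ring_mono unfolding gr_ker_def ccoeff_def by blast

lemma supp_dv:
  assumes "keys \<alpha> \<subseteq> S" shows "supp (dv \<alpha>) = (\<Union>s\<in>keys \<alpha>. supp (val s))"
proof -
  have "dv \<alpha> \<sigma> = 0 \<longleftrightarrow> (\<forall>s\<in>keys \<alpha>. val s \<sigma> = 0)" for \<sigma>
  proof -
    have "dv \<alpha> \<sigma> = 0 \<longleftrightarrow> (\<forall>s\<in>keys \<alpha>. of_nat (lookup \<alpha> s) * val s \<sigma> = 0)"
      unfolding dv_def by (rule sum_nonneg_eq_0_iff) (use assms val_props(2) in auto)
    then show ?thesis by (auto simp: in_keys_iff)
  qed
  then show ?thesis by (auto simp: supp_def)
qed

lemma dv_eq_val_if_supp: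
  assumes "keys \<alpha> \<subseteq> S" "C \<in> max_chains P" "supp (dv \<alpha>) \<subseteq> C" shows "dv \<alpha> = val (wt \<alpha>)"
  using dv_eq_val_iff[OF assms(1)] chn_subset[OF max_chain_chn[OF assms(2)] assms(3)] by blast

text \<open>The points of the torus of the component \<open>X\<^bsub>\<Delta>\<^esub>\<close> that belongs to the chain \<open>C\<close>.\<close>

definition cpt :: "'n face set \<Rightarrow> 'k \<Rightarrow> 'k ^ 'n \<Rightarrow> 'n wt \<Rightarrow> 'k" where
  "cpt C c t s = (if supp (val s) \<subseteq> C then tor c t s else 0)"

text \<open>The part of \<open>p\<close> in the variables from the cone over the simplex of \<open>C\<close>.\<close>

definition cpart :: "'n face set \<Rightarrow> ('n, 'k) mpoly \<Rightarrow> ('n, 'k) mpoly" where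
  "cpart C = hpart (\<lambda>\<alpha>. supp (dv \<alpha>) \<subseteq> C) True"

lemma mpoly_eval_cpt:
  assumes p: "p \<in> carrier (mpoly_ring S)"
  shows "mpoly_eval (cpt C c t) p = mpoly_eval (tor c t) (cpart C p)"
proof -
  have "mon_eval (cpt C c t) \<alpha> = (if supp (dv \<alpha>) \<subseteq> C then mon_eval (tor c t) \<alpha> else 0)"
    if \<alpha>: "\<alpha> \<in> keys p" for \<alpha>
  proof -
    have sub: "keys \<alpha> \<subseteq> S" using \<alpha> p by (auto simp: carrier_mpoly_ring)
    show ?thesis
    proof (cases "supp (dv \<alpha>) \<subseteq> C")
      case True
      have "mon_eval (cpt C c t) \<alpha> = mon_eval (tor c t) \<alpha>"
        by (rule mon_eval_cong) (use True supp_dv[OF sub] in \<open>auto simp: cpt_def\<close>)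
      then show ?thesis using True by simp
    next
      case False
      then obtain s where s: "s \<in> keys \<alpha>" "\<not> supp (val s) \<subseteq> C" using supp_dv[OF sub] by blast
      then have "cpt C c t s ^ lookup \<alpha> s = 0" by (simp add: cpt_def in_keys_iff)
      then have "mon_eval (cpt C c t) \<alpha> = 0"
        unfolding mon_eval_def using s(1) by (intro prod_zero) auto
      then show ?thesis using False by simp
    qed
  qed
  then have "mpoly_eval (cpt C c t) p =
      (\<Sum>\<alpha>\<in>keys p. if supp (dv \<alpha>) \<subseteq> C then lookup p \<alpha> * mon_eval (tor c t) \<alpha> else 0)"
    unfolding mpoly_eval_mon_eval by (intro sum.cong) auto
  also have "\<dots> = (\<Sum>\<alpha>\<in>{\<alpha> \<in> keys p. supp (dv \<alpha>) \<subseteq> C}. lookup p \<alpha> * mon_eval (tor c t) \<alpha>)"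
    by (rule sum.mono_neutral_cong_right) auto
  also have "\<dots> = mpoly_eval (tor c t) (cpart C p)"
    unfolding mpoly_eval_mon_eval by (rule sum.cong) (auto simp: cpart_def keys_hpart lookup_hpart)
  finally show ?thesis .
qed

lemma wcoeff_cpart:
  assumes p: "p \<in> carrier (mpoly_ring S)" and C: "C \<in> max_chains P" and s: "s \<in> S"
  shows "wcoeff (cpart C p) s = (if supp (val s) \<subseteq> C then ccoeff p s else 0)"
proof -
  have "(supp (dv \<alpha>) \<subseteq> C \<and> wt \<alpha> = s) \<longleftrightarrow> supp (val s) \<subseteq> C \<and> dv \<alpha> = val s \<and> wt \<alpha> = s"
    if "\<alpha> \<in> keys p" for \<alpha>
  proof -
    have "keys \<alpha> \<subseteq> S" using that p by (auto simp: carrier_mpoly_ring)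
    then show ?thesis using dv_eq_val_if_supp[OF _ C, of \<alpha>] by auto
  qed
  then have "{\<alpha> \<in> keys (cpart C p). wt \<alpha> = s} =
      (if supp (val s) \<subseteq> C then {\<alpha> \<in> keys p. dv \<alpha> = val s \<and> wt \<alpha> = s} else {})"
    by (auto simp: cpart_def keys_hpart)
  moreover have "lookup (cpart C p) \<alpha> = lookup p \<alpha>" if "\<alpha> \<in> keys (cpart C p)" for \<alpha>
    using that by (auto simp: cpart_def keys_hpart lookup_hpart)
  ultimately show ?thesis
    unfolding wcoeff_alt ccoeff_alt by (auto intro!: sum.cong simp: cpart_def lookup_hpart keys_hpart)
qed

lemma cpart_closed: "p \<in> carrier (mpoly_ring I) \<Longrightarrow> cpart C p \<in> carrier (mpoly_ring I)"
  unfolding cpart_def by (rule mpoly_ring_hpart_closed)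

text \<open>The kernel is the vanishing ideal of a union of tori, one for each maximal chain. In
  particular the graded ring is reduced.\<close>

lemma gr_ker_iff:
  assumes p: "p \<in> carrier (mpoly_ring S)"
  shows "p \<in> gr_ker \<longleftrightarrow>
    (\<forall>C\<in>max_chains P. \<forall>c t. c \<noteq> 0 \<longrightarrow> t \<in> torus \<longrightarrow> mpoly_eval (cpt C c t) p = 0)"
proof
  assume "p \<in> gr_ker"
  then have "wcoeff (cpart C p) s = 0" if "C \<in> max_chains P" for C s
    using wcoeff_cpart[OF p that, of s] wcoeff_in_cone_monoid[OF cpart_closed[OF p], of C s]
    by (cases "s \<in> S") (auto simp: gr_ker_def)
  then show "\<forall>C\<in>max_chains P. \<forall>c t. c \<noteq> 0 \<longrightarrow> t \<in> torus \<longrightarrow> mpoly_eval (cpt C c t) p = 0"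
    unfolding mpoly_eval_cpt[OF p] using wcoeff_eq_0_iff_tor by blast
next
  assume *: "\<forall>C\<in>max_chains P. \<forall>c t. c \<noteq> 0 \<longrightarrow> t \<in> torus \<longrightarrow> mpoly_eval (cpt C c t) p = 0"
  have "ccoeff p s = 0" if s: "s \<in> S" for s
  proof -
    obtain C where C: "C \<in> max_chains P" "supp (val s) \<subseteq> C"
      using chain_extends_to_max_chain[OF val_props(3)[OF s]] .
    have "\<forall>s. wcoeff (cpart C p) s = 0"
      using * C(1) unfolding mpoly_eval_cpt[OF p] wcoeff_eq_0_iff_tor by blast
    then show ?thesis using wcoeff_cpart[OF p C(1) s] C(2) by simp
  qed
  then show "p \<in> gr_ker" using p by (simp add: gr_ker_def)
qed

lemma gr_ker_ideal:
  assumes "G \<subseteq> S" shows "ideal (gr_ker \<inter> carrier (mpoly_ring G)) (mpoly_ring G)"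
proof (rule ideal_mpoly_ringI)
  have sub: "carrier (mpoly_ring G) \<subseteq> carrier (mpoly_ring S)" by (rule carrier_mpoly_ring_mono[OF assms])
  show "0 \<in> gr_ker \<inter> carrier (mpoly_ring G)" by (simp add: gr_ker_iff)
  fix p q :: "('n, 'k) mpoly" assume p: "p \<in> gr_ker \<inter> carrier (mpoly_ring G)"
  have pS: "p \<in> carrier (mpoly_ring S)" using p sub by blast
  show "p + q \<in> gr_ker \<inter> carrier (mpoly_ring G)" if q: "q \<in> gr_ker \<inter> carrier (mpoly_ring G)"
  proof -
    have qS: "q \<in> carrier (mpoly_ring S)" using q sub by blast
    show ?thesis
      using p q gr_ker_iff[OF pS] gr_ker_iff[OF qS] gr_ker_iff[OF mpoly_ring_add_closed[OF pS qS]]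
      by (auto simp: mpoly_eval_add mpoly_ring_add_closed)
  qed
  show "q * p \<in> gr_ker \<inter> carrier (mpoly_ring G)" if q: "q \<in> carrier (mpoly_ring G)"
  proof -
    have qS: "q \<in> carrier (mpoly_ring S)" using q sub by blast
    show ?thesis
      using p q gr_ker_iff[OF pS] gr_ker_iff[OF mpoly_ring_mult_closed[OF qS pS]]
      by (auto simp: mpoly_eval_mult mpoly_ring_mult_closed)
  qed
qed auto

lemma gr_ker_radical:
  assumes p: "p \<in> carrier (mpoly_ring S)" and k: "p ^ k \<in> gr_ker" "k > 0"
  shows "p \<in> gr_ker"
proof -
  have "p ^ k \<in> carrier (mpoly_ring S)" using k(1) by (simp add: gr_ker_def)
  from gr_ker_iff[OF this] have "\<forall>C\<in>max_chains P. \<forall>c t. c \<noteq> 0 \<longrightarrow> t \<in> torus \<longrightarrow> mpoly_eval (cpt C c t) p ^ k = 0"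
    using k(1) by (simp add: mpoly_eval_power)
  then show ?thesis using k(2) gr_ker_iff[OF p] by simp
qed


section \<open>Initial forms\<close>

lemma theta_eq_th: "theta P p = th p"
  by (simp add: theta_def th_def)

lemma ker_theta_iff:
  assumes "G \<subseteq> S"
  shows "(p :: ('n, 'k) mpoly) \<in> ker_theta P G \<longleftrightarrow> p \<in> carrier (mpoly_ring G) \<and> (\<forall>s. wcoeff p s = 0)"
proof (cases "p \<in> carrier (mpoly_ring G)")
  case True
  then have p: "p \<in> carrier (mpoly_ring S)" using carrier_mpoly_ring_mono[OF assms] by blast
  have "th p = \<zero>\<^bsub>K\<^esub> \<longleftrightarrow> (\<forall>s. wcoeff p s = 0)"
    using th_eq_iff[OF p mpoly_ring_0_closed] by (simp add: th_0)
  then show ?thesis using True by (simp add: ker_theta_def a_kernel_def' theta_eq_th)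
qed (simp add: ker_theta_def a_kernel_def')

lemma ker_theta_V_eq: "(ker_theta_V P :: ('n, 'k) mpoly set) = toric_ideal"
proof -
  have "restr \<Lambda> p = \<zero>\<^bsub>K\<^esub> \<longleftrightarrow> (\<forall>s. wcoeff p s = 0)"
    if p: "p \<in> carrier (mpoly_ring (coord_vars \<Lambda>))" for p :: "('n, 'k) mpoly"
    using th_eq_iff[OF subsetD[OF coord_subring p] mpoly_ring_0_closed]
    by (simp add: th_0 restr_eq_th[OF p])
  then show ?thesis by (auto simp: ker_theta_V_def a_kernel_def' toric_ideal_def)
qed

lemma deg_A_eq: "keys \<alpha> \<subseteq> S \<Longrightarrow> deg_A P f R \<alpha> = (fst (wt \<alpha>), dv \<alpha>)"
  unfolding deg_A_def wt_def dv_def fst_conv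
  by (intro arg_cong2[of _ _ _ _ Pair] refl ext sum.cong) (auto simp: quasi_val_basis_fun)

text \<open>If some monomial of weight \<open>s\<close> in the initial form has degree \<open>val s\<close>, then all monomials of
  weight \<open>s\<close> in \<open>g\<close> have this degree: it bounds their degrees from above, and the initial form has
  the least degree. So the surviving coefficients of weight \<open>s\<close> are all those of \<open>g\<close>.\<close>

lemma initial_form_in_gr_ker:
  assumes g: "g \<in> carrier (mpoly_ring S)" "\<forall>s. wcoeff g s = 0"
  shows "initial_form (deg_A_le P R) (deg_A P f R) g \<in> gr_ker"
proof -
  let ?h = "initial_form (deg_A_le P R) (deg_A P f R) g"
  have sub: "keys \<alpha> \<subseteq> S" if "\<alpha> \<in> keys g" for \<alpha> using that g by (auto simp: carrier_mpoly_ring)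
  have "ccoeff ?h s = 0" for s
  proof (cases "\<exists>\<alpha>\<in>keys ?h. dv \<alpha> = val s \<and> wt \<alpha> = s")
    case True
    then obtain \<alpha>0 where a0: "\<alpha>0 \<in> keys g" "dv \<alpha>0 = val s" "wt \<alpha>0 = s"
      and max: "\<forall>\<beta>\<in>keys g. deg_A_le P R (deg_A P f R \<beta>) (deg_A P f R \<alpha>0)"
      by (auto simp: keys_initial_form)
    have deg: "dv \<alpha> = val s" if a: "\<alpha> \<in> keys g" "wt \<alpha> = s" for \<alpha>
    proof -
      have "lex_le P R (val s) (dv \<alpha>)"
        using bspec[OF max a(1)] deg_A_eq[OF sub[OF a(1)]] deg_A_eq[OF sub[OF a0(1)]] a0 a
        by (simp add: deg_A_le_def)
      moreover have "lex_le P R (dv \<alpha>) (val s)" using dv_le_val[OF sub[OF a(1)]] a(2) by simp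
      ultimately show ?thesis using lex_le_antisym by blast
    qed
    have inh: "\<alpha> \<in> keys ?h" if a: "\<alpha> \<in> keys g" "wt \<alpha> = s" for \<alpha>
    proof -
      have "deg_A P f R \<alpha> = deg_A P f R \<alpha>0"
        using deg[OF a] a a0 deg_A_eq[OF sub[OF a(1)]] deg_A_eq[OF sub[OF a0(1)]] by simp
      then show ?thesis using max a(1) by (simp add: keys_initial_form)
    qed
    have "{\<alpha> \<in> keys ?h. dv \<alpha> = val s \<and> wt \<alpha> = s} = {\<alpha> \<in> keys g. wt \<alpha> = s}"
      using deg inh by (auto simp: keys_initial_form)
    moreover have "lookup ?h \<alpha> = lookup g \<alpha>" if "\<alpha> \<in> keys ?h" for \<alpha>
      using that by (auto simp: keys_initial_form lookup_initial_form)
    ultimately have "ccoeff ?h s = wcoeff g s"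
      unfolding ccoeff_alt wcoeff_alt by (intro sum.cong) (use inh in auto)
    then show ?thesis using g(2) by simp
  next
    case False
    then show ?thesis unfolding ccoeff_alt by (intro sum.neutral) blast
  qed
  then show ?thesis using initial_form_closed[OF g(1)] by (simp add: gr_ker_def)
qed

lemma val_vertex:
  assumes s: "\<sigma> \<in> faces P"
  shows "val (1, pt \<sigma>) = (\<lambda>\<tau>. if \<tau> = \<sigma> then 1 else 0)"
  by (rule val_eqI)
    (use s finite_faces in \<open>auto simp: combo_def supp_def chn_iff sum.delta
      if_distrib[of "\<lambda>z. z * _"] cong: if_cong\<close>)

text \<open>A common denominator of the coordinates turns a multiple of \<open>s\<close> into the weight of a
  monomial in the variables of the vertices, which are available because all \<open>f \<sigma>\<close> have degree
  one.\<close>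

lemma vertex_monomial:
  assumes s: "s \<in> S"
  obtains N \<beta> where "0 < N" "keys \<beta> \<subseteq> coord_vars \<Lambda>" "wt \<beta> = (int N * fst s, of_nat N *s snd s)"
    "dv \<beta> = (\<lambda>\<sigma>. of_nat N * val s \<sigma>)" "dv \<beta> = val (wt \<beta>)"
proof -
  have "\<exists>m::nat. 0 < m \<and> (\<exists>k::nat. of_nat m * val s \<sigma> = of_nat k)" for \<sigma>
  proof -
    obtain a b where ab: "quotient_of (val s \<sigma>) = (a, b)" by fastforce
    have b: "0 < b" using quotient_of_denom_pos[OF ab] .
    have v: "val s \<sigma> = of_int a / of_int b" using quotient_of_div[OF ab] .
    have "0 \<le> a" using val_props(2)[OF s, of \<sigma>] b unfolding v by (simp add: zero_le_divide_iff)
    then have "of_nat (nat b) * val s \<sigma> = of_nat (nat a)" using b unfolding v by simp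
    then show ?thesis using b by (intro exI[of _ "nat b"]) auto
  qed
  then obtain m where m: "\<And>\<sigma>. 0 < m \<sigma>" "\<And>\<sigma>. \<exists>k::nat. of_nat (m \<sigma>) * val s \<sigma> = of_nat k" by metis
  define N where "N = (\<Prod>\<sigma>\<in>faces P. m \<sigma> :: nat)"
  have N: "0 < N" unfolding N_def using m(1) by (simp add: prod_pos)
  have "\<exists>k::nat. of_nat N * val s \<sigma> = of_nat k" for \<sigma>
  proof (cases "\<sigma> \<in> faces P")
    case True
    then obtain j where "N = m \<sigma> * j" unfolding N_def using finite_faces by (metis dvd_def dvd_prodI)
    moreover obtain k :: nat where "of_nat (m \<sigma>) * val s \<sigma> = of_nat k" using m(2) by blast
    ultimately have "of_nat N * val s \<sigma> = of_nat (j * k)" by (simp add: mult_ac)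
    then show ?thesis by blast
  next
    case False
    then show ?thesis using val_support[OF s] by (intro exI[of _ 0]) simp
  qed
  then obtain k :: "'n face \<Rightarrow> nat" where k: "\<And>\<sigma>. of_nat N * val s \<sigma> = of_nat (k \<sigma>)" by metis
  define \<beta> where "\<beta> = (\<Sum>\<sigma>\<in>faces P. single (1 :: int, pt \<sigma>) (k \<sigma>))"
  have sub: "keys \<beta> \<subseteq> coord_vars \<Lambda>"
  proof -
    have "(\<Union>\<sigma>\<in>faces P. keys (single (1 :: int, pt \<sigma>) (k \<sigma>))) \<subseteq> coord_vars \<Lambda>"
      using pt_lattice by auto
    then show ?thesis unfolding \<beta>_def by (rule subset_trans[OF keys_sum])
  qed
  have dvsum: "dv (\<Sum>i\<in>A. F i) \<sigma> = (\<Sum>i\<in>A. dv (F i) \<sigma>)" for A and F :: "'n face \<Rightarrow> 'n mon" and \<sigma>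
    by (induction A rule: infinite_finite_induct) (simp_all add: dv_add zero_fun_def plus_fun_def)
  have dv: "dv \<beta> = (\<lambda>\<sigma>. of_nat N * val s \<sigma>)"
  proof
    fix \<tau>
    have "dv \<beta> \<tau> = (\<Sum>\<sigma>\<in>faces P. if \<sigma> = \<tau> then of_nat (k \<tau>) else 0)"
      unfolding \<beta>_def dvsum dv_single by (rule sum.cong) (auto simp: val_vertex)
    also have "\<dots> = of_nat N * val s \<tau>"
      using finite_faces val_support[OF s, of \<tau>] k[of \<tau>] by (auto simp: sum.delta)
    finally show "dv \<beta> \<tau> = of_nat N * val s \<tau>" .
  qed
  have subS: "keys \<beta> \<subseteq> S" using sub coord_vars_subset by blast
  have "combo (\<lambda>\<sigma>. of_nat N * val s \<sigma>) (int N * fst s, of_nat N *s snd s)"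
    using val_props(1)[OF s] by (simp add: combo_def sum_distrib_left mult.assoc)
  then have wt: "wt \<beta> = (int N * fst s, of_nat N *s snd s)"
    using combo_dv[OF subS] combo_unique_weight unfolding dv by blast
  have "supp (dv \<beta>) = supp (val s)" unfolding dv using N by (auto simp: supp_def)
  then have "dv \<beta> = val (wt \<beta>)" using dv_eq_val_iff[OF subS] val_props(3)[OF s] by simp
  then show ?thesis using that N sub wt dv by blast
qed

end

locale degenerating_weight = degree_one_stratification P R pt f
  for P :: "'n::finite face" and R and pt and f :: "'n face \<Rightarrow> ('n, 'k::field_char_0) func" +
  fixes G :: "'n wt set" and lam :: "'n wt \<Rightarrow> int"
  assumes G: "G \<subseteq> cone_monoid (lattice_points P)" "coord_vars (lattice_points P) \<subseteq> G"
    and same_initial: "in_nu_ideal P f R G (ker_theta P G) = in_lam_ideal G lam (ker_theta P G)"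
begin

abbreviation "V \<equiv> coord_vars \<Lambda>"
abbreviation "J \<equiv> in_lam_ideal V lam (toric_ideal :: ('n, 'k) mpoly set)"

lemma V_subring: "carrier (mpoly_ring V) \<subseteq> carrier (mpoly_ring G)"
  by (rule carrier_mpoly_ring_mono[OF G(2)])

text \<open>The hypothesis on \<open>lam\<close> enters the proof here: it carries the description of the initial forms
  for \<open>\<nu>\<close> over to those for \<open>lam\<close>, in the larger polynomial ring.\<close>

lemma initial_form_lam_in_gr_ker:
  assumes g: "g \<in> toric_ideal" "g \<noteq> 0"
  shows "initial_form (\<le>) (int_weight_deg lam) g \<in> gr_ker \<inter> carrier (mpoly_ring V)"
proof -
  interpret M: cring "mpoly_ring G :: ('n, 'k) mpoly ring" by (rule cring_mpoly_ring)
  have gV: "g \<in> carrier (mpoly_ring V)" "\<forall>s. wcoeff g s = 0" using g by (auto simp: toric_ideal_def)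
  then have gG: "g \<in> ker_theta P G" using ker_theta_iff[OF G(1)] V_subring by blast
  have kG: "ker_theta P G \<subseteq> (carrier (mpoly_ring G) :: ('n, 'k) mpoly set)"
    using ker_theta_iff[OF G(1)] by blast
  have "initial_form (\<le>) (int_weight_deg lam) ` (ker_theta P G - {0}) \<subseteq> (carrier (mpoly_ring G) :: ('n, 'k) mpoly set)"
    using kG initial_form_closed by blast
  from M.genideal_self[OF this]
  have "initial_form (\<le>) (int_weight_deg lam) g \<in> in_lam_ideal G lam (ker_theta P G)"
    unfolding initial_ideal_def using gG g(2) by blast
  moreover have "in_nu_ideal P f R G (ker_theta P G) \<subseteq> gr_ker \<inter> carrier (mpoly_ring G)"
    unfolding initial_ideal_def
  proof (rule M.genideal_minimal[OF gr_ker_ideal[OF G(1)]], rule image_subsetI)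
    fix h :: "('n, 'k) mpoly" assume h: "h \<in> ker_theta P G - {0}"
    then have "h \<in> carrier (mpoly_ring G)" "\<forall>s. wcoeff h s = 0" using ker_theta_iff[OF G(1)] by blast+
    then show "initial_form (deg_A_le P R) (deg_A P f R) h \<in> gr_ker \<inter> carrier (mpoly_ring G)"
      using initial_form_in_gr_ker initial_form_closed carrier_mpoly_ring_mono[OF G(1)] by blast
  qed
  ultimately show ?thesis using same_initial initial_form_closed[OF gV(1)] by blast
qed

lemma VS: "V \<subseteq> S"
  by (rule coord_vars_subset)

lemma J_ideal: "ideal J (mpoly_ring V)"
proof -
  interpret M: cring "mpoly_ring V :: ('n, 'k) mpoly ring" by (rule cring_mpoly_ring)
  show ?thesis
    unfolding initial_ideal_def
    by (rule M.genideal_ideal) (use initial_form_closed in \<open>auto simp: toric_ideal_def\<close>)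
qed

lemma J_subset_gr_ker: "J \<subseteq> gr_ker \<inter> carrier (mpoly_ring V)"
proof -
  interpret M: cring "mpoly_ring V :: ('n, 'k) mpoly ring" by (rule cring_mpoly_ring)
  show ?thesis
    unfolding initial_ideal_def
    by (rule M.genideal_minimal[OF gr_ker_ideal[OF VS]]) (use initial_form_lam_in_gr_ker in blast)
qed

lemma initial_form_in_J:
  assumes "g \<in> toric_ideal" "g \<noteq> 0" shows "initial_form (\<le>) (int_weight_deg lam) g \<in> J"
proof -
  interpret M: cring "mpoly_ring V :: ('n, 'k) mpoly ring" by (rule cring_mpoly_ring)
  have "initial_form (\<le>) (int_weight_deg lam) ` (toric_ideal - {0}) \<subseteq> (carrier (mpoly_ring V) :: ('n, 'k) mpoly set)"
    using initial_form_closed by (auto simp: toric_ideal_def)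
  from M.genideal_self[OF this] show ?thesis
    unfolding initial_ideal_def using assms by blast
qed

text \<open>Since a surviving monomial \<open>\<beta>\<close> does not lie in the kernel, the initial form of
  \<open>\<alpha> - \<beta>\<close> cannot be \<open>\<beta>\<close>, and it contains \<open>\<beta>\<close> only if \<open>\<alpha>\<close> survives as well.\<close>

lemma initial_binomial:
  assumes \<alpha>: "keys \<alpha> \<subseteq> V" and \<beta>: "keys \<beta> \<subseteq> V" and wt: "wt \<alpha> = wt \<beta>"
    and good: "dv \<beta> = val (wt \<beta>)" and ne: "\<alpha> \<noteq> \<beta>"
  shows "(if dv \<alpha> = val (wt \<alpha>) then single \<alpha> 1 - single \<beta> 1 else single \<alpha> 1) \<in> J"
proof -
  let ?g = "single \<alpha> 1 - single \<beta> 1 :: ('n, 'k) mpoly"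
  let ?d = "int_weight_deg lam"
  have g: "?g \<in> toric_ideal"
    using \<alpha> \<beta> wt by (auto simp: toric_ideal_def wcoeff_diff wcoeff_single
        intro!: mpoly_ring_diff_closed mpoly_ring_single_closed)
  have nz: "?g \<noteq> 0" using ne by (metis eq_iff_diff_eq_0 lookup_single_eq lookup_single_not_eq zero_neq_one)
  let ?h = "(if ?d \<beta> \<le> ?d \<alpha> then single \<alpha> 1 else 0) - (if ?d \<alpha> \<le> ?d \<beta> then single \<beta> 1 else 0) :: ('n, 'k) mpoly"
  have h: "?h \<in> J" "?h \<in> gr_ker"
    using initial_form_in_J[OF g nz] initial_form_lam_in_gr_ker[OF g nz] initial_form_binomial[OF ne, of ?d, where 'k = 'k]
    by auto
  have "wt \<beta> \<in> S" by (rule wt_in_cone_monoid) (use \<beta> VS in blast)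
  then have c: "ccoeff ?h (wt \<beta>) = 0" using h(2) by (simp add: gr_ker_def)
  have zero: "ccoeff (0 :: ('n, 'k) mpoly) (wt \<beta>) = 0" by (simp add: ccoeff_def)
  consider "?d \<alpha> < ?d \<beta>" | "?d \<alpha> = ?d \<beta>" | "?d \<beta> < ?d \<alpha>" by linarith
  then show ?thesis
  proof cases
    case 1
    then have "ccoeff ?h (wt \<beta>) = - 1"
      using good by (simp add: ccoeff_diff ccoeff_uminus ccoeff_single zero)
    then show ?thesis using c by simp
  next
    case 2
    then have "ccoeff ?h (wt \<beta>) = (if dv \<alpha> = val (wt \<alpha>) then 1 else 0) - 1"
      using good wt by (simp add: ccoeff_diff ccoeff_single)
    then have "dv \<alpha> = val (wt \<alpha>)" using c by (auto split: if_splits)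
    then show ?thesis using h(1) 2 by simp
  next
    case 3
    then have "ccoeff ?h (wt \<beta>) = (if dv \<alpha> = val (wt \<alpha>) then 1 else 0)"
      using wt by (simp add: ccoeff_diff ccoeff_single zero)
    then have "dv \<alpha> \<noteq> val (wt \<alpha>)" using c by auto
    then show ?thesis using h(1) 3 by simp
  qed
qed

definition J_rad :: "('n, 'k) mpoly set" where
  "J_rad = {p \<in> carrier (mpoly_ring V). \<exists>k>0. p ^ k \<in> J}"

lemma J_rad_eq: "ideal_radical (mpoly_ring V) J = J_rad"
  by (simp add: ideal_radical_def J_rad_def mpoly_ring_nat_pow)

lemma J_ops:
  shows "0 \<in> J" and "p \<in> J \<Longrightarrow> q \<in> J \<Longrightarrow> p + q \<in> J"
    and "p \<in> J \<Longrightarrow> q \<in> carrier (mpoly_ring V) \<Longrightarrow> q * p \<in> J"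
proof -
  interpret ideal J "mpoly_ring V" by (rule J_ideal)
  show "0 \<in> J" using additive_subgroup.zero_closed[OF ideal.axioms(1)[OF J_ideal]] by simp
  show "p + q \<in> J" if "p \<in> J" "q \<in> J" using additive_subgroup.a_closed[OF ideal.axioms(1)[OF J_ideal] that] by simp
  show "q * p \<in> J" if "p \<in> J" "q \<in> carrier (mpoly_ring V)" using I_l_closed[OF that] by simp
qed

lemma J_rad_add: "p \<in> J_rad \<Longrightarrow> q \<in> J_rad \<Longrightarrow> p + q \<in> J_rad"
proof -
  assume p: "p \<in> J_rad" and q: "q \<in> J_rad"
  obtain m n where mn: "p ^ m \<in> J" "m > 0" "q ^ n \<in> J" "n > 0" using p q by (auto simp: J_rad_def)
  have "(p + q) ^ (m + n) \<in> J"
    by (rule binomial_sum_power_in_ideal[where B = "carrier (mpoly_ring V)"])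
      (use p q mn in \<open>auto simp: J_rad_def intro: J_ops mpoly_ring_add_closed mpoly_ring_mult_closed\<close>)
  then show "p + q \<in> J_rad" using p q mn by (auto simp: J_rad_def intro!: mpoly_ring_add_closed)
qed

lemma J_subset_rad: "J \<subseteq> J_rad"
proof
  fix p assume "p \<in> J"
  then have "p \<in> carrier (mpoly_ring V)" "p ^ 1 \<in> J" using J_subset_gr_ker by auto
  then show "p \<in> J_rad" unfolding J_rad_def by blast
qed

lemma J_rad_sum: "(\<And>i. i \<in> A \<Longrightarrow> F i \<in> J_rad) \<Longrightarrow> (\<Sum>i\<in>A. F i) \<in> J_rad"
  using J_ops(1) J_subset_rad J_rad_add by (induction A rule: infinite_finite_induct) auto

lemma J_scale: "p \<in> J \<Longrightarrow> single 0 c * p \<in> J"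
  by (rule J_ops(3)) (auto intro: mpoly_ring_single_closed)

text \<open>A monomial that does not survive is nilpotent modulo \<open>J\<close>: a suitable power of it has the
  weight of a surviving monomial in the vertices.\<close>

lemma bad_monomial_in_J_rad:
  assumes \<alpha>: "keys \<alpha> \<subseteq> V" and bad: "dv \<alpha> \<noteq> val (wt \<alpha>)"
  shows "single \<alpha> c \<in> J_rad"
proof -
  have \<alpha>S: "keys \<alpha> \<subseteq> S" using \<alpha> VS by blast
  obtain N \<beta> where N: "0 < N" and \<beta>: "keys \<beta> \<subseteq> V" "wt \<beta> = (int N * fst (wt \<alpha>), of_nat N *s snd (wt \<alpha>))"
    "dv \<beta> = (\<lambda>\<sigma>. of_nat N * val (wt \<alpha>) \<sigma>)" "dv \<beta> = val (wt \<beta>)"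
    using vertex_monomial[OF wt_in_cone_monoid[OF \<alpha>S]] .
  define \<gamma> where "\<gamma> = (\<Sum>i<N. \<alpha>)"
  have dv\<gamma>: "dv (\<Sum>i<n. \<alpha>) \<sigma> = of_nat n * dv \<alpha> \<sigma>" for n :: nat and \<sigma>
    by (induction n) (simp_all add: dv_add zero_fun_def plus_fun_def algebra_simps del: sum_constant)
  have wt\<gamma>: "wt (\<Sum>i<n. \<alpha>) = (int n * fst (wt \<alpha>), of_nat n *s snd (wt \<alpha>))" for n :: nat
    by (induction n) (auto simp: wt_add prod_eq_iff vec_eq_iff algebra_simps simp del: sum_constant)
  have "keys (\<Sum>i<n. \<alpha>) \<subseteq> V" for n :: nat
    using keys_sum[of "\<lambda>_. \<alpha>" "{..<n}"] \<alpha> by blast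
  then have \<gamma>V: "keys \<gamma> \<subseteq> V" by (simp only: \<gamma>_def)
  have wts: "wt \<gamma> = wt \<beta>" unfolding \<gamma>_def wt\<gamma> \<beta>(2) ..
  have bad\<gamma>: "dv \<gamma> \<noteq> val (wt \<gamma>)"
  proof
    assume "dv \<gamma> = val (wt \<gamma>)"
    then have eq: "dv \<gamma> = dv \<beta>" using wts \<beta>(4) by simp
    have "dv \<alpha> \<sigma> = val (wt \<alpha>) \<sigma>" for \<sigma>
      using fun_cong[OF eq, of \<sigma>] dv\<gamma>[of N \<sigma>] N unfolding \<beta>(3) \<gamma>_def by simp
    then show False using bad by blast
  qed
  then have "\<gamma> \<noteq> \<beta>" using \<beta>(4) by auto
  from initial_binomial[OF \<gamma>V \<beta>(1) wts \<beta>(4) this] have "single \<gamma> 1 \<in> J" using bad\<gamma> by simp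
  from J_scale[OF this, of "c ^ N"] have "single \<alpha> c ^ N \<in> J"
    unfolding single_power \<gamma>_def by (simp add: mult_single del: sum_constant)
  then show ?thesis
    unfolding J_rad_def using N mpoly_ring_single_closed[OF \<alpha>] by blast
qed

text \<open>The kernel is spanned by the monomials that do not survive and the differences of surviving
  monomials of equal weight. The latter are their own initial forms.\<close>

lemma J_rad_eq_gr_ker: "J_rad = gr_ker \<inter> carrier (mpoly_ring V)"
proof
  show "J_rad \<subseteq> gr_ker \<inter> carrier (mpoly_ring V)"
  proof
    fix p assume "p \<in> J_rad"
    then obtain k where p: "p \<in> carrier (mpoly_ring V)" "p ^ k \<in> J" "k > 0" by (auto simp: J_rad_def)
    then have "p ^ k \<in> gr_ker" using J_subset_gr_ker by blast
    then show "p \<in> gr_ker \<inter> carrier (mpoly_ring V)"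
      using gr_ker_radical[OF subsetD[OF coord_subring p(1)] _ p(3)] p(1) by blast
  qed
  show "gr_ker \<inter> carrier (mpoly_ring V) \<subseteq> J_rad"
  proof
    fix p assume p: "p \<in> gr_ker \<inter> carrier (mpoly_ring V)"
    have sub: "keys \<alpha> \<subseteq> V" if "\<alpha> \<in> keys p" for \<alpha> using p that by (auto simp: carrier_mpoly_ring)
    let ?B = "{\<alpha> \<in> keys p. dv \<alpha> \<noteq> val (wt \<alpha>)}" and ?Q = "{\<alpha> \<in> keys p. dv \<alpha> = val (wt \<alpha>)}"
    let ?T = "\<lambda>\<alpha>. single \<alpha> (lookup p \<alpha>)"
    let ?Qs = "\<lambda>s. {\<alpha> \<in> ?Q. wt \<alpha> = s}"
    have bad: "(\<Sum>\<alpha>\<in>?B. ?T \<alpha>) \<in> J_rad"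
      by (rule J_rad_sum) (use sub bad_monomial_in_J_rad in blast)
    have good: "(\<Sum>\<alpha>\<in>?Qs s. ?T \<alpha>) \<in> J_rad" if s: "s \<in> wt ` ?Q" for s
    proof -
      obtain \<beta> where b: "\<beta> \<in> keys p" "dv \<beta> = val (wt \<beta>)" "wt \<beta> = s" using s by blast
      have "?Qs s = {\<alpha> \<in> keys p. dv \<alpha> = val s \<and> wt \<alpha> = s}" by auto
      moreover have "s \<in> S" using b(3) wt_in_cone_monoid sub[OF b(1)] VS by blast
      ultimately have "(\<Sum>\<alpha>\<in>?Qs s. lookup p \<alpha>) = 0" using p ccoeff_alt[of p s] by (simp add: gr_ker_def)
      then have "(\<Sum>\<alpha>\<in>?Qs s. single \<beta> (lookup p \<alpha>)) = 0"
        by (simp flip: single_sum)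
      then have "(\<Sum>\<alpha>\<in>?Qs s. ?T \<alpha>) = (\<Sum>\<alpha>\<in>?Qs s. ?T \<alpha> - single \<beta> (lookup p \<alpha>))"
        by (simp add: sum_subtractf)
      also have "\<dots> = (\<Sum>\<alpha>\<in>?Qs s. single 0 (lookup p \<alpha>) * (single \<alpha> 1 - single \<beta> 1))"
        by (simp add: algebra_simps mult_single)
      also have "\<dots> \<in> J_rad"
      proof (rule J_rad_sum)
        fix \<alpha> assume a: "\<alpha> \<in> ?Qs s"
        have "single \<alpha> 1 - single \<beta> 1 \<in> J"
        proof (cases "\<alpha> = \<beta>")
          case False
          then show ?thesis using initial_binomial[of \<alpha> \<beta>] a b sub by auto
        qed (simp add: J_ops)
        then show "single 0 (lookup p \<alpha>) * (single \<alpha> 1 - single \<beta> 1) \<in> J_rad"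
          using J_scale J_subset_rad by blast
      qed
      finally show ?thesis .
    qed
    have "p = (\<Sum>\<alpha>\<in>keys p. ?T \<alpha>)" by (rule mpoly_sum_monomials) auto
    also have "\<dots> = (\<Sum>\<alpha>\<in>?B. ?T \<alpha>) + (\<Sum>\<alpha>\<in>?Q. ?T \<alpha>)"
    proof -
      have "keys p = ?B \<union> ?Q" by blast
      moreover have "(\<Sum>\<alpha>\<in>?B \<union> ?Q. ?T \<alpha>) = (\<Sum>\<alpha>\<in>?B. ?T \<alpha>) + (\<Sum>\<alpha>\<in>?Q. ?T \<alpha>)"
        by (rule sum.union_disjoint) auto
      ultimately show ?thesis by (simp only:)
    qed
    also have "(\<Sum>\<alpha>\<in>?Q. ?T \<alpha>) = (\<Sum>s\<in>wt ` ?Q. \<Sum>\<alpha>\<in>?Qs s. ?T \<alpha>)"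
      by (rule sum.image_gen) simp
    finally have eq: "p = (\<Sum>\<alpha>\<in>?B. ?T \<alpha>) + (\<Sum>s\<in>wt ` ?Q. \<Sum>\<alpha>\<in>?Qs s. ?T \<alpha>)" .
    show "p \<in> J_rad"
      by (rule ssubst[OF eq, of "\<lambda>q. q \<in> J_rad"]) (rule J_rad_add[OF bad J_rad_sum[OF good]])
  qed
qed


section \<open>The limit and its components\<close>

text \<open>The lattice points of the simplex of \<open>C\<close>.\<close>

definition chain_chars :: "'n face set \<Rightarrow> 'n chr set" where
  "chain_chars C = {x \<in> \<Lambda>. supp (val (1, x)) \<subseteq> C}"

lemma normalized_weight_f: "\<sigma> \<in> faces P \<Longrightarrow> normalized_weight \<Lambda> (f \<sigma>) = (1, rvec (pt \<sigma>))"
  by (simp add: normalized_weight_def weight_f hom_deg_f rvec_def vec_eq_iff)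

lemma inj_vertices: "inj_on (\<lambda>\<sigma>. (1 :: real, rvec (pt \<sigma>))) (faces P)"
proof (rule inj_onI)
  fix \<sigma> \<tau> assume st: "\<sigma> \<in> faces P" "\<tau> \<in> faces P" "(1 :: real, rvec (pt \<sigma>)) = (1, rvec (pt \<tau>))"
  have "\<sigma> \<subseteq> \<tau>" if "\<sigma> \<in> faces P" "\<tau> \<in> faces P" "rvec (pt \<sigma>) = rvec (pt \<tau>)" for \<sigma> \<tau>
    by (rule subset_of_face_of[of \<tau> P \<sigma>])
      (use that pt[of \<sigma>] pt_in_face[of \<tau>] face_subset in \<open>auto simp: faces_def\<close>)
  then show "\<sigma> = \<tau>" using st by (metis Pair_inject subset_antisym)
qed

lemma chain_simplex_iff:
  assumes C: "C \<subseteq> faces P"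
  shows "z \<in> chain_simplex P f C \<longleftrightarrow>
    (\<exists>u. (\<forall>\<sigma>\<in>C. 0 \<le> u \<sigma>) \<and> (\<Sum>\<sigma>\<in>C. u \<sigma>) = 1 \<and> (\<Sum>\<sigma>\<in>C. u \<sigma> *\<^sub>R rvec (pt \<sigma>)) = z)"
proof -
  let ?p = "\<lambda>\<sigma>. (1 :: real, rvec (pt \<sigma>))"
  have inj: "inj_on ?p C" using inj_vertices C by (rule inj_on_subset)
  have fin: "finite C" using C finite_faces finite_subset by blast
  have im: "(\<lambda>\<sigma>. normalized_weight \<Lambda> (f \<sigma>)) ` C = ?p ` C"
    by (rule image_cong) (use C normalized_weight_f in auto)
  have "z \<in> chain_simplex P f C \<longleftrightarrow>
    (\<exists>w. (\<forall>x\<in>?p ` C. 0 \<le> w x) \<and> sum w (?p ` C) = 1 \<and> (\<Sum>x\<in>?p ` C. w x *\<^sub>R x) = (1, z))"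
    unfolding chain_simplex_def im using fin by (simp add: convex_hull_finite)
  also have "\<dots> \<longleftrightarrow> (\<exists>w. (\<forall>\<sigma>\<in>C. 0 \<le> w (?p \<sigma>)) \<and> (\<Sum>\<sigma>\<in>C. w (?p \<sigma>)) = 1 \<and>
      (\<Sum>\<sigma>\<in>C. w (?p \<sigma>) *\<^sub>R rvec (pt \<sigma>)) = z)"
    by (auto simp: sum.reindex[OF inj] prod_eq_iff fst_sum snd_sum)
  also have "\<dots> \<longleftrightarrow> (\<exists>u. (\<forall>\<sigma>\<in>C. 0 \<le> u \<sigma>) \<and> (\<Sum>\<sigma>\<in>C. u \<sigma>) = 1 \<and> (\<Sum>\<sigma>\<in>C. u \<sigma> *\<^sub>R rvec (pt \<sigma>)) = z)"
  proof
    assume "\<exists>u. (\<forall>\<sigma>\<in>C. 0 \<le> u \<sigma>) \<and> (\<Sum>\<sigma>\<in>C. u \<sigma>) = 1 \<and> (\<Sum>\<sigma>\<in>C. u \<sigma> *\<^sub>R rvec (pt \<sigma>)) = z"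
    then obtain u where u: "\<forall>\<sigma>\<in>C. 0 \<le> u \<sigma>" "(\<Sum>\<sigma>\<in>C. u \<sigma>) = 1" "(\<Sum>\<sigma>\<in>C. u \<sigma> *\<^sub>R rvec (pt \<sigma>)) = z" by blast
    have inv: "u (inv_into C ?p (?p \<sigma>)) = u \<sigma>" if "\<sigma> \<in> C" for \<sigma>
      by (simp only: inv_into_f_f[OF inj that])
    show "\<exists>w. (\<forall>\<sigma>\<in>C. 0 \<le> w (?p \<sigma>)) \<and> (\<Sum>\<sigma>\<in>C. w (?p \<sigma>)) = 1 \<and> (\<Sum>\<sigma>\<in>C. w (?p \<sigma>) *\<^sub>R rvec (pt \<sigma>)) = z"
      by (rule exI[of _ "\<lambda>x. u (inv_into C ?p x)"]) (use u inv in simp)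
  next
    assume "\<exists>w. (\<forall>\<sigma>\<in>C. 0 \<le> w (?p \<sigma>)) \<and> (\<Sum>\<sigma>\<in>C. w (?p \<sigma>)) = 1 \<and> (\<Sum>\<sigma>\<in>C. w (?p \<sigma>) *\<^sub>R rvec (pt \<sigma>)) = z"
    then obtain w where "(\<forall>\<sigma>\<in>C. 0 \<le> w (?p \<sigma>)) \<and> (\<Sum>\<sigma>\<in>C. w (?p \<sigma>)) = 1 \<and> (\<Sum>\<sigma>\<in>C. w (?p \<sigma>) *\<^sub>R rvec (pt \<sigma>)) = z" ..
    then show "\<exists>u. (\<forall>\<sigma>\<in>C. 0 \<le> u \<sigma>) \<and> (\<Sum>\<sigma>\<in>C. u \<sigma>) = 1 \<and> (\<Sum>\<sigma>\<in>C. u \<sigma> *\<^sub>R rvec (pt \<sigma>)) = z"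
      by (rule exI[of _ "\<lambda>\<sigma>. w (?p \<sigma>)"])
  qed
  finally show ?thesis .
qed

lemma chain_chars_eq:
  assumes C: "C \<in> max_chains P"
  shows "\<Lambda> \<inter> lattice_points (chain_simplex P f C) = chain_chars C"
proof -
  have ch: "chn C" and Cf: "C \<subseteq> faces P" using max_chain_chn[OF C] by (auto simp: chn_iff)
  have "rvec x \<in> chain_simplex P f C \<longleftrightarrow> supp (val (1, x)) \<subseteq> C" if x: "x \<in> \<Lambda>" for x
  proof
    have s: "(1, x) \<in> S" using coord_vars_subset x by blast
    assume "rvec x \<in> chain_simplex P f C"
    then obtain u where u: "\<forall>\<sigma>\<in>C. 0 \<le> u \<sigma>" "(\<Sum>\<sigma>\<in>C. u \<sigma>) = 1" "(\<Sum>\<sigma>\<in>C. u \<sigma> *\<^sub>R rvec (pt \<sigma>)) = rvec x"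
      using chain_simplex_iff[OF Cf] by blast
    let ?d = "\<lambda>\<sigma>. if \<sigma> \<in> C then u \<sigma> else 0"
    have d1: "(\<Sum>\<sigma>\<in>faces P. ?d \<sigma>) = of_int (fst (1 :: int, x))"
      using u(2) Cf finite_faces by (simp add: sum.If_cases Int_absorb1)
    have "(\<Sum>\<sigma>\<in>faces P. ?d \<sigma> *\<^sub>R rvec (pt \<sigma>)) = (\<Sum>\<sigma>\<in>C. u \<sigma> *\<^sub>R rvec (pt \<sigma>))"
      by (rule sum.mono_neutral_cong_right) (use Cf finite_faces in auto)
    then have d2: "(\<Sum>\<sigma>\<in>faces P. ?d \<sigma> *\<^sub>R rvec (pt \<sigma>)) = rvec (snd (1 :: int, x))"
      using u(3) by simp
    obtain w where w: "combo w (1, x)" "\<forall>\<sigma>. \<sigma> \<notin> C \<longrightarrow> w \<sigma> = 0" using max_chain_spans[OF C] by blast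
    have dw: "?d \<sigma> = real_of_rat (w \<sigma>)" for \<sigma>
      by (rule combo_chain_unique_real[OF ch w(1) _ _ d1 d2]) (use w in auto)
    have "0 \<le> w \<sigma>" for \<sigma>
    proof -
      have "0 \<le> real_of_rat (w \<sigma>)" unfolding dw[symmetric] using u(1) by simp
      then show ?thesis by simp
    qed
    then have "val (1, x) = w" using val_of_max_chain[OF C w] by blast
    then show "supp (val (1, x)) \<subseteq> C" using w(2) by (auto simp: supp_def)
  next
    have s: "(1, x) \<in> S" using coord_vars_subset x by blast
    assume "supp (val (1, x)) \<subseteq> C"
    then have out: "val (1, x) \<sigma> = 0" if "\<sigma> \<notin> C" for \<sigma> using that by (auto simp: supp_def)
    let ?u = "\<lambda>\<sigma>. real_of_rat (val (1, x) \<sigma>)"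
    have "(\<Sum>\<sigma>\<in>C. ?u \<sigma>) = (\<Sum>\<sigma>\<in>faces P. ?u \<sigma>)"
      by (rule sum.mono_neutral_left) (use Cf finite_faces out in auto)
    moreover have "(\<Sum>\<sigma>\<in>C. ?u \<sigma> *\<^sub>R rvec (pt \<sigma>)) = (\<Sum>\<sigma>\<in>faces P. ?u \<sigma> *\<^sub>R rvec (pt \<sigma>))"
      by (rule sum.mono_neutral_left) (use Cf finite_faces out in auto)
    ultimately show "rvec x \<in> chain_simplex P f C"
      unfolding chain_simplex_iff[OF Cf]
      using combo_real[OF val_props(1)[OF s]] val_props(2)[OF s] by (intro exI[of _ ?u]) simp
  qed
  then show ?thesis by (auto simp: chain_chars_def lattice_points_def)
qed

lemma character_set_chain:
  assumes C: "C \<in> max_chains P" shows "character_set (chain_chars C)"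
proof
  show "finite (chain_chars C)" using finite_lattice_points by (simp add: chain_chars_def)
  obtain \<sigma> where s: "\<sigma> \<in> C" using max_chain_dims[OF C, of 0] by blast
  then have "\<sigma> \<in> faces P" using max_chain_chn[OF C] by (auto simp: chn_iff)
  then have "pt \<sigma> \<in> chain_chars C"
    using s pt_lattice by (auto simp: chain_chars_def val_vertex supp_def)
  then show "chain_chars C \<noteq> {}" by blast
qed

lemma keys_chain_chars_iff:
  assumes \<alpha>: "keys \<alpha> \<subseteq> V" shows "keys \<alpha> \<subseteq> coord_vars (chain_chars C) \<longleftrightarrow> supp (dv \<alpha>) \<subseteq> C"
proof -
  have "keys \<alpha> \<subseteq> S" using \<alpha> VS by blast
  from supp_dv[OF this] show ?thesis using \<alpha> by (fastforce simp: chain_chars_def)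
qed

text \<open>On the coordinate subspace of \<open>C\<close> a polynomial takes the values of its part \<open>cpart C\<close>, and the
  monomials of this part all survive. So the kernel and the toric ideal of the simplex cut out the
  same points there.\<close>

lemma chain_variety_iff:
  assumes C: "C \<in> max_chains P"
  shows "(y :: ('n, 'k) vec_V set) \<in> chain_variety P f C \<longleftrightarrow>
    y \<in> proj_space (chain_chars C) \<and> (\<forall>p\<in>gr_ker \<inter> carrier (mpoly_ring V). \<forall>v\<in>y. poly_fun p v = 0)"
proof -
  interpret cs: character_set "chain_chars C" by (rule character_set_chain[OF C])
  have sub: "coord_vars (chain_chars C) \<subseteq> V" by (auto simp: chain_chars_def)
  have "(\<forall>p\<in>(cs.toric_ideal :: ('n, 'k) mpoly set). \<forall>v\<in>y. poly_fun p v = 0) \<longleftrightarrow>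
    (\<forall>p\<in>gr_ker \<inter> carrier (mpoly_ring V). \<forall>v\<in>y. poly_fun p v = 0)" if y: "y \<in> proj_space (chain_chars C)"
  proof (intro iffI ballI)
    fix p :: "('n, 'k) mpoly" and v assume all: "\<forall>p\<in>(cs.toric_ideal :: ('n, 'k) mpoly set). \<forall>v\<in>y. poly_fun p v = 0"
      and p: "p \<in> gr_ker \<inter> carrier (mpoly_ring V)" and v: "v \<in> y"
    have pS: "p \<in> carrier (mpoly_ring S)" using p by (simp add: gr_ker_def)
    have keysV: "keys \<alpha> \<subseteq> V" if "\<alpha> \<in> keys p" for \<alpha> using p that by (auto simp: carrier_mpoly_ring)
    have "v \<in> vec_space (chain_chars C)"
      using y v by (auto simp: proj_space_def proj_pt_def vec_space_def)
    then have v0: "v x = 0" if "x \<notin> chain_chars C" for x using that by (simp add: vec_space_def)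
    have "poly_fun p v = poly_fun (cpart C p) v"
      unfolding poly_fun_def mpoly_eval_mon_eval
    proof (rule sum.mono_neutral_cong_right)
      show "\<forall>\<alpha>\<in>keys p - keys (cpart C p). lookup p \<alpha> * mon_eval (\<lambda>i. v (snd i)) \<alpha> = 0"
      proof
        fix \<alpha> assume "\<alpha> \<in> keys p - keys (cpart C p)"
        then have a: "\<alpha> \<in> keys p" "\<not> supp (dv \<alpha>) \<subseteq> C" by (auto simp: cpart_def keys_hpart)
        then obtain i where i: "i \<in> keys \<alpha>" "i \<notin> coord_vars (chain_chars C)"
          using keys_chain_chars_iff[OF keysV[OF a(1)]] by blast
        then have "v (snd i) = 0" using v0 keysV[OF a(1)] by (cases i) auto
        then have "v (snd i) ^ lookup \<alpha> i = 0" using i(1) by (simp add: in_keys_iff)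
        then have "mon_eval (\<lambda>i. v (snd i)) \<alpha> = 0"
          unfolding mon_eval_def using i(1) by (intro prod_zero) auto
        then show "lookup p \<alpha> * mon_eval (\<lambda>i. v (snd i)) \<alpha> = 0" by simp
      qed
    qed (auto simp: cpart_def keys_hpart lookup_hpart)
    moreover have "cpart C p \<in> cs.toric_ideal"
      unfolding cs.toric_ideal_def
    proof (intro CollectI conjI allI)
      show "cpart C p \<in> carrier (mpoly_ring (coord_vars (chain_chars C)))"
        using keys_chain_chars_iff[OF keysV] by (auto simp: carrier_mpoly_ring cpart_def keys_hpart)
      fix s show "wcoeff (cpart C p) s = 0"
        using wcoeff_cpart[OF pS C, of s] wcoeff_in_cone_monoid[OF cpart_closed[OF pS], of C s] p
        by (cases "s \<in> S") (auto simp: gr_ker_def)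
    qed
    ultimately show "poly_fun p v = 0" using all v by simp
  next
    fix p :: "('n, 'k) mpoly" and v assume all: "\<forall>p\<in>gr_ker \<inter> carrier (mpoly_ring V). \<forall>v\<in>y. poly_fun p v = 0"
      and p: "p \<in> cs.toric_ideal" and v: "v \<in> y"
    have pV: "p \<in> carrier (mpoly_ring V)"
      using p carrier_mpoly_ring_mono[OF sub] by (auto simp: cs.toric_ideal_def)
    have "ccoeff p s = wcoeff p s" for s
    proof -
      have "dv \<alpha> = val (wt \<alpha>)" if a: "\<alpha> \<in> keys p" for \<alpha>
      proof -
        have k: "keys \<alpha> \<subseteq> V" "keys \<alpha> \<subseteq> coord_vars (chain_chars C)"
          using a p pV by (auto simp: cs.toric_ideal_def carrier_mpoly_ring)
        have "keys \<alpha> \<subseteq> S" using k(1) VS by blast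
        then show ?thesis using dv_eq_val_if_supp[OF _ C] keys_chain_chars_iff[OF k(1)] k(2) by blast
      qed
      then have "{\<alpha> \<in> keys p. dv \<alpha> = val s \<and> wt \<alpha> = s} = {\<alpha> \<in> keys p. wt \<alpha> = s}" by auto
      then show ?thesis by (simp add: ccoeff_alt wcoeff_alt)
    qed
    then have "p \<in> gr_ker" using p subsetD[OF coord_subring pV] by (simp add: gr_ker_def cs.toric_ideal_def)
    then show "poly_fun p v = 0" using all v pV by blast
  qed
  then show ?thesis
    unfolding chain_variety_def chain_chars_eq[OF C] cs.toric_variety_iff by blast
qed

lemma degeneration_limit_iff:
  "(y :: ('n, 'k) vec_V set) \<in> degeneration_limit P lam \<longleftrightarrow>
    y \<in> proj_space \<Lambda> \<and> (\<forall>p\<in>gr_ker \<inter> carrier (mpoly_ring V). \<forall>v\<in>y. poly_fun p v = 0)"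
proof -
  have "(\<forall>p\<in>J. \<forall>v\<in>y. poly_fun p v = 0) \<longleftrightarrow> (\<forall>p\<in>J_rad. \<forall>v\<in>y. poly_fun p v = 0)"
  proof
    assume all: "\<forall>p\<in>J. \<forall>v\<in>y. poly_fun p v = 0"
    show "\<forall>p\<in>J_rad. \<forall>v\<in>y. poly_fun p v = 0"
    proof (intro ballI)
      fix p v assume "p \<in> J_rad" "v \<in> y"
      then obtain k where "p ^ k \<in> J" by (auto simp: J_rad_def)
      then have "poly_fun p v ^ k = 0"
        using all \<open>v \<in> y\<close> by (force simp: poly_fun_def mpoly_eval_power)
      then show "poly_fun p v = 0" by simp
    qed
  qed (use J_subset_rad in blast)
  then show ?thesis
    by (simp add: degeneration_limit_def proj_zeros_def ker_theta_V_eq J_rad_eq_gr_ker)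
qed

lemma proj_space_mono: "A \<subseteq> B \<Longrightarrow> proj_space A \<subseteq> (proj_space B :: ('n, 'k) vec_V set set)"
  unfolding proj_space_def vec_space_def by (intro image_mono) blast

text \<open>The product of the nonzero coordinates of a point of the limit does not vanish there, so it
  survives, and the support of the point lies in one simplex.\<close>

lemma degeneration_limit_eq: "(degeneration_limit P lam :: ('n, 'k) vec_V set set) = (\<Union>C\<in>max_chains P. chain_variety P f C)"
proof (intro equalityI subsetI)
  fix y :: "('n, 'k) vec_V set" assume "y \<in> (\<Union>C\<in>max_chains P. chain_variety P f C)"
  then obtain C where C: "C \<in> max_chains P" "y \<in> chain_variety P f C" by blast
  have "chain_chars C \<subseteq> \<Lambda>" by (auto simp: chain_chars_def)
  then have "y \<in> proj_space \<Lambda>"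
    using proj_space_mono[of "chain_chars C" \<Lambda>] C(2) unfolding chain_variety_iff[OF C(1)] by blast
  then show "y \<in> degeneration_limit P lam"
    using C(2) unfolding chain_variety_iff[OF C(1)] degeneration_limit_iff by blast
next
  fix y :: "('n, 'k) vec_V set" assume "y \<in> degeneration_limit P lam"
  then have y: "y \<in> proj_space \<Lambda>" and all: "\<forall>p\<in>gr_ker \<inter> carrier (mpoly_ring V). \<forall>v\<in>y. poly_fun p v = 0"
    using degeneration_limit_iff by blast+
  obtain v where v: "v \<in> vec_space \<Lambda>" "v \<noteq> (\<lambda>x. 0)" "y = proj_pt v" using y by (auto simp: proj_space_def)
  define \<alpha> where "\<alpha> = expo (\<lambda>x. if v x = 0 then 0 else 1)"
  have \<alpha>V: "keys \<alpha> \<subseteq> V" unfolding \<alpha>_def by (rule keys_expo)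
  then have \<alpha>S: "keys \<alpha> \<subseteq> S" using VS by blast
  have "mon_eval (\<lambda>i. v (snd i)) \<alpha> \<noteq> 0"
    unfolding \<alpha>_def mon_eval_expo using finite_lattice_points by (simp add: prod_zero_iff)
  then have "poly_fun (single \<alpha> 1) v \<noteq> 0" by (simp add: poly_fun_def)
  then have "single \<alpha> 1 \<notin> gr_ker"
    using all proj_pt_refl[of v] v(3) mpoly_ring_single_closed[OF \<alpha>V] by blast
  then have "dv \<alpha> = val (wt \<alpha>)"
    using mpoly_ring_single_closed[OF \<alpha>S] by (auto simp: gr_ker_def ccoeff_single split: if_splits)
  then have "chn (supp (dv \<alpha>))" using dv_eq_val_iff[OF \<alpha>S] by blast
  then obtain C where C: "C \<in> max_chains P" "supp (dv \<alpha>) \<subseteq> C" using chain_extends_to_max_chain by blast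
  have "x \<in> chain_chars C" if "v x \<noteq> 0" for x
  proof -
    have x: "x \<in> \<Lambda>" using v(1) that by (auto simp: vec_space_def)
    then have "(1, x) \<in> keys \<alpha>" using that by (simp add: \<alpha>_def in_keys_iff lookup_expo)
    then show ?thesis using keys_chain_chars_iff[OF \<alpha>V, of C] C(2) by blast
  qed
  then have "v \<in> vec_space (chain_chars C)" by (auto simp: vec_space_def)
  then have "y \<in> proj_space (chain_chars C)" using v by (auto simp: proj_space_def)
  then show "y \<in> (\<Union>C\<in>max_chains P. chain_variety P f C)"
    using chain_variety_iff[OF C(1)] all C(1) by blast
qed

lemma radical_eq:
  "ideal_radical (mpoly_ring V) (in_lam_ideal V lam (ker_theta_V P)) =
    ker_theta_bar P f R G \<inter> carrier (mpoly_ring V)"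
  using J_rad_eq_gr_ker V_subring by (auto simp: ker_theta_V_eq J_rad_eq ker_theta_bar_eq[OF G(1)])

end

theorem theorem6p2:
  fixes P :: "(real ^ 'n) set"
    and X :: "(real ^ 'n) set \<Rightarrow> (int ^ 'n \<Rightarrow> 'k::{alg_closed_field, field_char_0}) set set"
    and f :: "(real ^ 'n) set \<Rightarrow> (int ^ 'n \<Rightarrow> 'k) \<Rightarrow> 'k"
    and R :: "(real ^ 'n) set rel"
    and G :: "(int \<times> (int ^ 'n)) set"
    and lam :: "int \<times> (int ^ 'n) \<Rightarrow> int"
  assumes "lattice_polytope P"
    and "aff_dim P = int CARD('n)"
    and "normal_polytope P"
    and "combinatorial_seshadri_stratification P X f"
    and "\<forall>\<sigma>\<in>faces P. hom_deg (lattice_points P) (f \<sigma>) = 1"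
    and "linear_order_on (faces P) R"
    and "\<forall>\<sigma>\<in>faces P. \<forall>\<tau>\<in>faces P. \<sigma> \<subseteq> \<tau> \<longrightarrow> (\<sigma>, \<tau>) \<in> R"
    and "gr_generators P f R G"
    and "in_nu_ideal P f R G (ker_theta P G) = in_lam_ideal G lam (ker_theta P G)"
  shows "ideal_radical (mpoly_ring (coord_vars (lattice_points P)))
             (in_lam_ideal (coord_vars (lattice_points P)) lam (ker_theta_V P)) =
           ker_theta_bar P f R G \<inter> carrier (mpoly_ring (coord_vars (lattice_points P))) \<and>
         (degeneration_limit P lam :: (int ^ 'n \<Rightarrow> 'k) set set) =
           (\<Union>C\<in>max_chains P. chain_variety P f C)"
proof -
  have poly: "polytope P" using assms(1) by (auto simp: lattice_polytope_def polytope_def)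
  define pt where "pt \<sigma> = - snd (weight (lattice_points P) (f \<sigma>))" for \<sigma>
  have nw: "fst (weight (lattice_points P) (f \<sigma>)) = - 1 \<and> rvec (pt \<sigma>) \<in> rel_interior \<sigma>"
    if s: "\<sigma> \<in> faces P" for \<sigma>
  proof -
    have "normalized_weight (lattice_points P) (f \<sigma>) \<in> {1} \<times> rel_interior \<sigma>"
      using assms(4) s by (simp add: combinatorial_seshadri_stratification_def)
    moreover have "hom_deg (lattice_points P) (f \<sigma>) = 1" using assms(5) s by blast
    moreover have "rvec (- x) = - rvec x" for x :: "'n chr" by (simp add: rvec_def vec_eq_iff)
    ultimately show ?thesis by (auto simp: normalized_weight_def pt_def)
  qed
  interpret degenerating_weight P R pt f G lam
  proof
    show "finite (faces P)"
      by (rule finite_subset[OF _ finite_polytope_faces[OF poly]]) (auto simp: faces_def)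
    show "weight (lattice_points P) (f \<sigma>) = (- 1, - pt \<sigma>)" if "\<sigma> \<in> faces P" for \<sigma>
      using nw[OF that] by (simp add: pt_def prod_eq_iff)
    show "G \<subseteq> cone_monoid (lattice_points P)" "coord_vars (lattice_points P) \<subseteq> G"
      using assms(8) by (auto simp: gr_generators_def)
  qed (use assms poly nw in auto)
  show ?thesis using radical_eq degeneration_limit_eq by blast
qed

end
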